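(* Let $g\ge 2$ and let $q_1,\ldots,q_g$, $D$, $\mathbf z$ be as follows: $q_i(x,y)=a_ix^2+2b_ixy+c_iy^2$ are integer binary quadratic forms, irreducible over the integers, with $a_i\equiv1\pmod 4$; $D:=\prod_{p\le 2g}p\prod_{k=1}^g a_kc_k\delta_k\prod_{i<j}\operatorname{Res}(q_i,q_j)\ne0$ where $\delta_k$ is the discriminant of $q_k$ and $\operatorname{Res}$ the resultant; $\mathbf z\in\mathbb Z^2$ satisfies $\gcd(q_i(\mathbf z),D)=1$ for all $i$. For real $M,Q_1,\ldots,Q_g\ge1$ define $$T(M,\mathbf Q):=\sum_{\substack{d_1\le Q_1,\ldots,d_g\le Q_g\\ \gcd(d_i,D)=1}}\ \sup_{\mathcal R:\ \partial(\mathcal R)\le M}\left|\#(\Lambda_{\mathbf d}\cap\mathcal R\cap\Psi)-\frac{\operatorname{vol}(\mathcal R)\,\rho(d_1,\ldots,d_g)}{(d_1\cdots d_gD)^2}\right|,$$ the sum being over positive integers $d_i$. Then, writing $Q:=Q_1\cdots Q_g$, there exist constants $\nu_1,\nu_2>1$ depending only on $g$ such that $$T(M,\mathbf Q)\ll Q(\log 2Q)^{\nu_1}+M\sqrt Q(\log 2Q)^{\nu_2}.$$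
   Context: For $\mathbf d=(d_1,\ldots,d_g)$ of positive integers: $\Lambda_{\mathbf d}:=\{\mathbf x\in\mathbb Z^2: d_i\mid q_i(\mathbf x),\ i=1,\ldots,g\}$, $\rho(\mathbf d):=\#(\Lambda_{\mathbf d}\cap[0,d_1\cdots d_g)^2)$, and $\Psi:=\{\mathbf x\in\mathbb Z^2:\mathbf x\equiv\mathbf z\pmod D\}$. The supremum is over convex regions $\mathcal R\subset\mathbb R^2$ with piecewise continuously differentiable boundary whose boundary length $\partial(\mathcal R)$ is at most $M$. Implied constants may depend on the forms and on $\mathbf z$. *)

theory Defs
  imports "HOL-Analysis.Analysis"
    "HOL-Computational_Algebra.Primes" "HOL-Number_Theory.Cong"
    "Subresultants.Resultant_Prelim"
begin

definition qform :: "int \<Rightarrow> int \<Rightarrow> int \<Rightarrow> int \<times> int \<Rightarrow> int" where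
  "qform a b c p = a * (fst p)^2 + 2 * b * fst p * snd p + c * (snd p)^2"

text \<open>The form as an element of Z[x][y] (isomorphic to Z[x,y]): c y^2 + (2 b x) y + a x^2.\<close>
definition qform_poly :: "int \<Rightarrow> int \<Rightarrow> int \<Rightarrow> int poly poly" where
  "qform_poly a b c = [: [:0, 0, a:], [:0, 2 * b:], [:c:] :]"

definition qdisc :: "int \<Rightarrow> int \<Rightarrow> int \<Rightarrow> int" where
  "qdisc a b c = (2 * b)^2 - 4 * a * c"

text \<open>Resultant of two binary quadratic forms (Sylvester determinant of the coefficient
  sequences), computed as the resultant of the dehomogenisations q(x,1); these have
  exact degree 2 whenever the leading coefficients a are nonzero.\<close>
definition qres :: "int \<Rightarrow> int \<Rightarrow> int \<Rightarrow> int \<Rightarrow> int \<Rightarrow> int \<Rightarrow> int" where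
  "qres a b c a' b' c' = resultant [:c, 2 * b, a:] [:c', 2 * b', a':]"

definition bigD :: "nat \<Rightarrow> (nat \<Rightarrow> int) \<Rightarrow> (nat \<Rightarrow> int) \<Rightarrow> (nat \<Rightarrow> int) \<Rightarrow> int" where
  "bigD g a b c =
     int (\<Prod> {p::nat. prime p \<and> p \<le> 2 * g})
     * (\<Prod>k<g. a k * c k * qdisc (a k) (b k) (c k))
     * (\<Prod>(i, j)\<in>{(i, j). i < j \<and> j < g}. qres (a i) (b i) (c i) (a j) (b j) (c j))"

definition Lam :: "nat \<Rightarrow> (nat \<Rightarrow> int) \<Rightarrow> (nat \<Rightarrow> int) \<Rightarrow> (nat \<Rightarrow> int) \<Rightarrow> (nat \<Rightarrow> nat) \<Rightarrow> (int \<times> int) set" where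
  "Lam g a b c d = {p. \<forall>i<g. int (d i) dvd qform (a i) (b i) (c i) p}"

definition rho :: "nat \<Rightarrow> (nat \<Rightarrow> int) \<Rightarrow> (nat \<Rightarrow> int) \<Rightarrow> (nat \<Rightarrow> int) \<Rightarrow> (nat \<Rightarrow> nat) \<Rightarrow> nat" where
  "rho g a b c d = card (Lam g a b c d \<inter>
      {p. 0 \<le> fst p \<and> fst p < int (\<Prod>i<g. d i) \<and> 0 \<le> snd p \<and> snd p < int (\<Prod>i<g. d i)})"

definition Psi :: "int \<Rightarrow> int \<times> int \<Rightarrow> (int \<times> int) set" where
  "Psi D z = {p. [fst p = fst z] (mod D) \<and> [snd p = snd z] (mod D)}"

definition to_real2 :: "int \<times> int \<Rightarrow> real \<times> real" where
  "to_real2 p = (real_of_int (fst p), real_of_int (snd p))"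

definition path_length :: "(real \<Rightarrow> real \<times> real) \<Rightarrow> real" where
  "path_length \<gamma> = integral {0..1} (\<lambda>t. norm (vector_derivative \<gamma> (at t)))"

definition regions :: "real \<Rightarrow> (real \<times> real) set set" where
  "regions M = {R. convex R \<and> bounded R \<and>
     (\<exists>\<gamma>. simple_path \<gamma> \<and> pathfinish \<gamma> = pathstart \<gamma> \<and>
          \<gamma> piecewise_C1_differentiable_on {0..1} \<and>
          path_image \<gamma> = frontier R \<and> path_length \<gamma> \<le> M)}"

definition err :: "nat \<Rightarrow> (nat \<Rightarrow> int) \<Rightarrow> (nat \<Rightarrow> int) \<Rightarrow> (nat \<Rightarrow> int) \<Rightarrow> int \<times> int
                   \<Rightarrow> (nat \<Rightarrow> nat) \<Rightarrow> (real \<times> real) set \<Rightarrow> real" where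
  "err g a b c z d R =
     (let D = bigD g a b c in
      \<bar>real (card {p \<in> Lam g a b c d \<inter> Psi D z. to_real2 p \<in> R})
       - measure lebesgue R * real (rho g a b c d)
         / (real (\<Prod>i<g. d i) * real_of_int D)^2\<bar>)"

definition Tsum :: "nat \<Rightarrow> (nat \<Rightarrow> int) \<Rightarrow> (nat \<Rightarrow> int) \<Rightarrow> (nat \<Rightarrow> int) \<Rightarrow> int \<times> int
                   \<Rightarrow> real \<Rightarrow> (nat \<Rightarrow> real) \<Rightarrow> ereal" where
  "Tsum g a b c z M Q =
     (\<Sum>d\<in>{d \<in> (\<Pi>\<^sub>E i\<in>{..<g}. {1..nat \<lfloor>Q i\<rfloor>}). \<forall>i<g. coprime (int (d i)) (bigD g a b c)}.
        (SUP R\<in>regions M. ereal (err g a b c z d R)))"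

end

theory Submission
  imports Defs
begin

text \<open>By the structure of the roots of \<open>t\<^sup>2 \<equiv> b\<^sup>2 - a c\<close> modulo divisors of \<open>d\<close>, the indicator function of
  \<open>\<Lambda>\<^sub>d\<close> is a signed sum of at most \<open>\<Prod>i. \<tau>(d\<^sub>i)\<^sup>3\<close> indicator functions of sublattices \<open>L \<subseteq> \<Lambda>\<^sub>d\<close>.
  Each \<open>L\<close> has a reduced basis with shortest vector \<open>v \<in> \<Lambda>\<^sub>d\<close>, and counting its points in a region by
  means of the fundamental cells met by the boundary costs \<open>O(1 + M / |v|)\<close>. The terms \<open>O(1)\<close> add up to
  \<open>Q\<close> times logarithms. Vectors with \<open>|v| > \<surd>Q\<close> contribute at most \<open>M / \<surd>Q\<close> each. For the others, \<open>d\<^sub>i\<close>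
  divides \<open>q\<^sub>i(v) \<noteq> 0\<close>, so that interchanging the sums leaves \<open>\<Sum>v. \<Prod>i. \<tau>(q\<^sub>i(v))\<^sup>4 / |v|\<close> over
  \<open>|v| \<le> \<surd>Q\<close>. Every \<open>n\<close> has a divisor \<open>d \<le> \<surd>n\<close> with \<open>\<tau>(n) \<le> 2 \<tau>(d)\<^sup>2\<close>, which reduces this sum to
  counting the \<open>v\<close> with \<open>d | q\<^sub>i(v)\<close> for \<open>d\<close> at most of the order of the box.\<close>

section \<open>The divisor function\<close>

text \<open>\<open>Lam\<close> is only a union of lattices, whose overlaps depend on the common
  factors of a point with the moduli. Signs resolve the overlaps and also settle the main term:
  \<open>rho\<close> is the same signed sum of lattice densities, so it is never evaluated and each
  lattice is compared with its own density. The supremum over regions stands inside the sum over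
  \<open>d\<close>, hence the short vector of a lattice has to be fixed before the region is known.
  The cut at \<open>sqrt Q\<close> is a balance: about \<open>Q\<close> lattices, up to logarithms,
  lose \<open>M / sqrt Q\<close> each, while the sum of \<open>1 / |v|\<close> over a box of side
  \<open>sqrt Q\<close> is again of order \<open>sqrt Q\<close>. Of the four factors tau in the
  overview, three count the lattices belonging to \<open>d_i\<close> and one counts the
  \<open>d_i\<close> that divide \<open>q_i(v)\<close>. Divisors beyond the side of the box would
  spoil the count in residue classes, whose rounding errors then dominate; hence the passage to
  small divisors. Each factor tau under a harmonic sum doubles the power of the logarithm, which is
  the origin of the exponents \<open>8 * g\<close> and \<open>2 ^ (8 * g + 2)\<close>.\<close>

definition tau :: "nat \<Rightarrow> nat" where "tau n = card {d. d dvd n}"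

lemma tau_mono: "m dvd n \<Longrightarrow> n > 0 \<Longrightarrow> tau m \<le> tau n"
  unfolding tau_def by (rule card_mono) (auto intro: dvd_trans)

lemma tau_mult_le:
  assumes "a > 0" "b > 0"
  shows "tau (a * b) \<le> tau a * tau b"
proof -
  have "{d. d dvd a * b} \<subseteq> (\<lambda>(x, y). x * y) ` ({d. d dvd a} \<times> {d. d dvd b})"
    by (auto elim!: dvd_productE)
  then have "card {d. d dvd a * b} \<le> card ({d. d dvd a} \<times> {d. d dvd b})"
    using assms by (intro surj_card_le) auto
  then show ?thesis by (simp add: tau_def card_cartesian_product)
qed

lemma tau_prime: "prime p \<Longrightarrow> tau p = 2"
proof -
  assume p: "prime p"
  then have "{d. d dvd p} = {1, p}" by (auto simp: prime_nat_iff)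
  moreover have "p \<noteq> 1" using p by auto
  ultimately show ?thesis by (simp add: tau_def)
qed

text \<open>Distinct sets of primes have distinct products, and these products divide
  \<open>n\<close>. This bounds the number of terms in the later inclusion-exclusion.\<close>

lemma card_Pow_prime_factors_le:
  assumes "n > 0"
  shows "card (Pow (prime_factors n)) \<le> tau n"
  unfolding tau_def
proof (rule card_inj_on_le)
  show "finite {d. d dvd n}" using assms by simp
  have mem: "p \<in> S \<longleftrightarrow> p dvd \<Prod>S" if Sp: "S \<subseteq> prime_factors n" "prime p" for S and p :: nat
  proof -
    have fin: "finite S" using Sp(1) finite_subset by blast
    show ?thesis
    proof
      assume "p dvd \<Prod>S"
      then obtain q where "q \<in> S" "p dvd q"
        using prime_dvd_prod_iff[OF fin Sp(2), of "\<lambda>x. x"] by auto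
      moreover have "prime q" using Sp(1) \<open>q \<in> S\<close> by auto
      ultimately show "p \<in> S" using Sp(2) primes_dvd_imp_eq by blast
    qed (use fin in \<open>auto intro: dvd_prodI\<close>)
  qed
  show "inj_on (\<lambda>S. \<Prod>S) (Pow (prime_factors n))"
  proof (rule inj_onI)
    fix S T assume *: "S \<in> Pow (prime_factors n)" "T \<in> Pow (prime_factors n)" "\<Prod>S = \<Prod>T"
    then have "p \<in> S \<longleftrightarrow> p \<in> T" if "prime p" for p using mem that by (metis PowD)
    moreover have "prime p" if "p \<in> S \<or> p \<in> T" for p using that * by auto
    ultimately show "S = T" by blast
  qed
  show "(\<lambda>S. \<Prod>S) ` Pow (prime_factors n) \<subseteq> {d. d dvd n}"
  proof safe
    fix S assume S: "S \<subseteq> prime_factors n"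
    then have "\<Prod>S dvd \<Prod>(prime_factors n)" by (intro prod_dvd_prod_subset) auto
    also have "\<Prod>(prime_factors n) dvd (\<Prod>p\<in>prime_factors n. p ^ multiplicity p n)"
      by (intro prod_dvd_prod dvd_power)
        (auto simp: prime_factors_multiplicity)
    also have "\<dots> = n" using assms by (simp add: prod_prime_factors)
    finally show "\<Prod>S dvd n" .
  qed
qed

text \<open>Let \<open>d\<close> be the largest divisor with square at most \<open>n\<close> and
  \<open>p\<close> a prime dividing \<open>n / d\<close>. Maximality gives
  \<open>(d * p)\<^sup>2 > n\<close>, so the cofactor \<open>f = n / (d * p)\<close> is small as
  well. From \<open>n = d * p * f\<close> follows \<open>tau n \<le> 2 * tau d * tau f\<close>, and
  the one of \<open>d\<close>, \<open>f\<close> with more divisors is the witness.\<close>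

lemma small_divisor:
  fixes n :: nat
  assumes "n > 0"
  shows "\<exists>d. d dvd n \<and> d\<^sup>2 \<le> n \<and> tau n \<le> 2 * (tau d)\<^sup>2"
proof (cases "n = 1")
  case True
  then show ?thesis by (intro exI[of _ 1]) (auto simp: tau_def)
next
  case False
  define A where "A = {d. d dvd n \<and> d\<^sup>2 \<le> n}"
  have fin: "finite A" unfolding A_def using assms by simp
  have "1 \<in> A" using assms by (simp add: A_def)
  define d where "d = Max A"
  have d: "d \<in> A" unfolding d_def using fin \<open>1 \<in> A\<close> by (intro Max_in) auto
  have dmax: "x \<le> d" if "x \<in> A" for x unfolding d_def using fin that by simp
  obtain e where e: "n = d * e" using d by (auto simp: A_def)
  have "e \<noteq> 1"
  proof
    assume "e = 1"
    then have "n * n \<le> n * 1" using e d by (simp add: A_def power2_eq_square)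
    then show False using assms False by (metis One_nat_def Suc_leI le_antisym mult_le_cancel1)
  qed
  then obtain p where p: "prime p" "p dvd e" using prime_factor_nat by blast
  then obtain f where f: "e = p * f" by auto
  have pos: "d > 0" "p > 0" "f > 0" using assms e f by auto
  have "\<not> (d * p)\<^sup>2 \<le> n"
  proof
    assume "(d * p)\<^sup>2 \<le> n"
    then have "d * p \<in> A" by (auto simp: A_def e f)
    then have "d * p \<le> d * 1" using dmax by simp
    then show False using pos prime_gt_1_nat[OF p(1)] by simp
  qed
  then have big: "n < (d * p)\<^sup>2" by simp
  have "f\<^sup>2 \<le> n"
  proof (rule ccontr)
    assume "\<not> f\<^sup>2 \<le> n"
    then have "n * n < f\<^sup>2 * (d * p)\<^sup>2" using big pos by (intro mult_strict_mono) auto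
    also have "\<dots> = n * n" by (simp add: e f power2_eq_square)
    finally show False by simp
  qed
  then have fA: "f \<in> A" by (auto simp: A_def e f)
  have "tau n \<le> tau d * (tau p * tau f)"
    unfolding e f using pos
    by (metis le_trans mult_le_mono2 nat_0_less_mult_iff tau_mult_le)
  then have *: "tau n \<le> 2 * (tau d * tau f)" by (simp add: tau_prime[OF p(1)] mult_ac)
  show ?thesis
  proof (cases "tau d \<le> tau f")
    case True
    then have "tau n \<le> 2 * (tau f)\<^sup>2" using * by (simp add: power2_eq_square) (meson le_trans mult_le_mono1 mult_le_mono2)
    then show ?thesis using fA by (auto simp: A_def)
  next
    case False
    then have "tau d * tau f \<le> (tau d)\<^sup>2" by (simp add: power2_eq_square)
    then have "tau n \<le> 2 * (tau d)\<^sup>2" using * by linarith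
    then show ?thesis using d by (auto simp: A_def)
  qed
qed

text \<open>Each step opens one factor \<open>\<tau>(n)\<close> as a sum over factorisations and uses submultiplicativity,
  which squares the bound.\<close>
lemma sum_tau_power_div_le:
  "(\<Sum>n=1..x. real (tau n) ^ k / real n) \<le> (harm x) ^ (2 ^ k)"
proof (induction k)
  case 0
  then show ?case by (simp add: harm_def inverse_eq_divide)
next
  case (Suc k)
  define f where "f n = real (tau n) ^ k / real n" for n
  have f0: "f n \<ge> 0" for n by (simp add: f_def)
  have step: "real (tau n) ^ Suc k / real n \<le> (\<Sum>a\<in>{a. a dvd n}. f a * f (n div a))" if "n > 0" for n
  proof -
    have "real (tau n) ^ k / real n \<le> f a * f (n div a)" if a: "a dvd n" for a
    proof -
      obtain b where b: "n = a * b" using a by auto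
      then have pos: "a > 0" "b > 0" using \<open>n > 0\<close> by auto
      have "real (tau n) ^ k \<le> (real (tau a) * real (tau b)) ^ k"
        using tau_mult_le[OF pos] b by (intro power_mono) (auto simp flip: of_nat_mult)
      then show ?thesis using pos b
        by (simp add: f_def divide_right_mono power_mult_distrib)
    qed
    then have "(\<Sum>a\<in>{a. a dvd n}. real (tau n) ^ k / real n) \<le> (\<Sum>a\<in>{a. a dvd n}. f a * f (n div a))"
      by (intro sum_mono) auto
    then show ?thesis by (simp add: tau_def)
  qed
  have "(\<Sum>n=1..x. real (tau n) ^ Suc k / real n) \<le> (\<Sum>n=1..x. \<Sum>a\<in>{a. a dvd n}. f a * f (n div a))"
    by (intro sum_mono step) auto
  also have "\<dots> = (\<Sum>(n, a)\<in>(SIGMA n:{1..x}. {a. a dvd n}). f a * f (n div a))"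
    by (subst sum.Sigma) auto
  also have "\<dots> \<le> (\<Sum>(a, b)\<in>{1..x} \<times> {1..x}. f a * f b)"
  proof (rule sum_le_included[where i = "\<lambda>(a, b). (a * b, a)"])
    show "\<forall>y\<in>{1..x} \<times> {1..x}. 0 \<le> (case y of (a, b) \<Rightarrow> f a * f b)" using f0 by auto
    show "\<forall>p\<in>(SIGMA n:{1..x}. {a. a dvd n}). \<exists>y\<in>{1..x} \<times> {1..x}.
            (case y of (a, b) \<Rightarrow> (a * b, a)) = p \<and>
            (case p of (n, a) \<Rightarrow> f a * f (n div a)) \<le> (case y of (a, b) \<Rightarrow> f a * f b)"
    proof
      fix p assume "p \<in> (SIGMA n:{1..x}. {a. a dvd n})"
      then obtain n a where p: "p = (n, a)" and n: "n \<in> {1..x}" "a dvd n" by auto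
      then obtain b where b: "n = a * b" by auto
      have pos: "a > 0" "b > 0" using n b by (auto intro: Nat.gr0I)
      then have "a \<le> x" "b \<le> x" using b n by (auto intro: order_trans[of _ "a * b"])
      then show "\<exists>y\<in>{1..x} \<times> {1..x}. (case y of (a, b) \<Rightarrow> (a * b, a)) = p \<and>
            (case p of (n, a) \<Rightarrow> f a * f (n div a)) \<le> (case y of (a, b) \<Rightarrow> f a * f b)"
        using n pos b p by (intro bexI[of _ "(a, b)"]) auto
    qed
  qed auto
  also have "\<dots> = (\<Sum>n=1..x. f n) ^ 2"
    by (simp add: power2_eq_square sum_product sum.cartesian_product)
  also have "\<dots> \<le> (harm x ^ (2 ^ k)) ^ 2"
    using Suc f0 by (intro power_mono sum_nonneg) (auto simp: f_def)
  finally show ?case by (simp add: power_mult[symmetric] mult_ac)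
qed

lemma harm_le_one_plus_ln:
  assumes "n \<ge> 1"
  shows "harm n \<le> 1 + ln (real n)"
proof -
  have "harm (Suc m) \<le> 1 + ln (real (Suc m))" for m
    using decseq_harm_diff_ln[THEN decseqD, of 0 m] by (simp add: harm_def)
  from this[of "n - 1"] assms show ?thesis by simp
qed

text \<open>Comparing every root with one fixed root \<open>s\<close> turns roots into divisors of
  \<open>e\<close>, which replaces a factorisation into prime powers.\<close>

lemma card_square_roots_le:
  fixes \<Delta> :: int and e :: nat
  assumes "e > 0" "odd e" "coprime \<Delta> (int e)"
  shows "card {t \<in> {0..<int e}. int e dvd t\<^sup>2 - \<Delta>} \<le> tau e"
proof (cases "{t \<in> {0..<int e}. int e dvd t\<^sup>2 - \<Delta>} = {}")
  case False
  then obtain s where s: "int e dvd s\<^sup>2 - \<Delta>" by auto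
  define G where "G t = nat (gcd (t - s) (int e))" for t
  have cs: "coprime (2 * s) (int e)"
  proof -
    have "coprime s (int e)"
    proof (rule coprimeI)
      fix k assume k: "k dvd s" "k dvd int e"
      then have "k dvd s\<^sup>2 - \<Delta>" "k dvd s\<^sup>2" using s by (auto simp: power2_eq_square)
      then have "k dvd s\<^sup>2 - (s\<^sup>2 - \<Delta>)" by (rule dvd_diff[rotated])
      then have "k dvd \<Delta>" by simp
      then show "is_unit k" using k assms(3) not_coprimeI by blast
    qed
    moreover have "coprime 2 (int e)" using assms(2) by simp
    ultimately show ?thesis by simp
  qed
  \<comment> \<open>As \<open>gcd (t - s) (t + s)\<close> is prime to \<open>e\<close>, a root \<open>t\<close> is \<open>s\<close> modulo \<open>G t\<close> and \<open>-s\<close> modulo the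
    complementary divisor.\<close>
  have key: "int e dvd x - y" if x: "int e dvd x\<^sup>2 - \<Delta>" and y: "int e dvd y\<^sup>2 - \<Delta>" and "G x = G y" for x y
  proof -
    define h where "h = gcd (x - s) (int e)"
    have hy: "h = gcd (y - s) (int e)" using that(3) unfolding G_def h_def by (simp add: nat_eq_iff2)
    have hpos: "h > 0" unfolding h_def using assms(1) by simp
    have main: "coprime h (int e div h) \<and> int e div h dvd w + s"
      if w: "int e dvd w\<^sup>2 - \<Delta>" and hw: "h = gcd (w - s) (int e)" for w
    proof
      have "int e dvd (w\<^sup>2 - \<Delta>) - (s\<^sup>2 - \<Delta>)" using w s by (rule dvd_diff)
      then have d: "int e dvd (w - s) * (w + s)" by (simp add: power2_eq_square algebra_simps)
      obtain u where u: "w - s = h * u" using hw by (metis dvdE gcd_dvd1)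
      obtain f where f: "int e = h * f" using hw by (metis dvdE gcd_dvd2)
      have cuf: "coprime u f"
      proof -
        have "h = gcd (h * u) (h * f)" using hw u f by simp
        also have "\<dots> = h * gcd u f" using hpos by (simp add: gcd_mult_left)
        finally show ?thesis using hpos by (simp add: coprime_iff_gcd_eq_1)
      qed
      have "h * f dvd h * (u * (w + s))" using d u f by (simp add: mult.assoc)
      then have "f dvd u * (w + s)" using hpos by simp
      then have fw: "f dvd w + s" using cuf by (simp add: coprime_dvd_mult_right_iff coprime_commute)
      then show "int e div h dvd w + s" using f hpos by simp
      have "coprime h f"
      proof (rule coprimeI)
        fix k assume k: "k dvd h" "k dvd f"
        then have "k dvd w - s" "k dvd w + s" using u fw by (auto intro: dvd_trans)
        then have "k dvd (w + s) - (w - s)" by (rule dvd_diff[rotated])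
        then have "k dvd 2 * s" by simp
        moreover have "k dvd int e" using k f by simp
        ultimately show "is_unit k" using cs not_coprimeI by blast
      qed
      then show "coprime h (int e div h)" using f hpos by simp
    qed
    have "int e div h dvd (x + s) - (y + s)"
      using main[OF x h_def] main[OF y hy] by (intro dvd_diff) auto
    moreover have "h dvd (x - s) - (y - s)"
      using gcd_dvd1[of "x - s" "int e"] gcd_dvd1[of "y - s" "int e"]
      unfolding h_def[symmetric] hy[symmetric] by (rule dvd_diff)
    ultimately have "h * (int e div h) dvd x - y"
      using main[OF x h_def] by (intro divides_mult) auto
    then show ?thesis by (simp add: h_def)
  qed
  show ?thesis
    unfolding tau_def
  proof (rule card_inj_on_le)
    show "inj_on G {t \<in> {0..<int e}. int e dvd t\<^sup>2 - \<Delta>}"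
    proof (rule inj_onI)
      fix x y assume *: "x \<in> {t \<in> {0..<int e}. int e dvd t\<^sup>2 - \<Delta>}"
        "y \<in> {t \<in> {0..<int e}. int e dvd t\<^sup>2 - \<Delta>}" "G x = G y"
      then have "int e dvd x - y" using key by auto
      then have "x mod int e = y mod int e" by (simp add: mod_eq_dvd_iff)
      then show "x = y" using * by simp
    qed
    show "G ` {t \<in> {0..<int e}. int e dvd t\<^sup>2 - \<Delta>} \<subseteq> {d. d dvd e}"
      by (auto simp: G_def) (metis gcd_dvd2 gcd_ge_0_int int_dvd_int_iff int_nat_eq)
    show "finite {d. d dvd e}" using assms(1) by simp
  qed
qed (simp only: card.empty)

section \<open>The congruence set of one form as a signed sum of lattices\<close>

abbreviation qdet :: "int \<Rightarrow> int \<Rightarrow> int \<Rightarrow> int" where "qdet a b c \<equiv> b\<^sup>2 - a * c"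

text \<open>The modulus that remains for \<open>q(x/k, y/k)\<close> in the condition
  \<open>d dvd q(x, y)\<close>: a quadratic form releases the factor
  \<open>k\<^sup>2\<close>.\<close>

definition red_mod :: "nat \<Rightarrow> nat \<Rightarrow> nat" where "red_mod d k = d div gcd d (k\<^sup>2)"

definition sq_roots :: "int \<Rightarrow> nat \<Rightarrow> int set" where
  "sq_roots \<Delta> e = {t \<in> {0..<int e}. int e dvd t\<^sup>2 - \<Delta>}"

text \<open>In an index \<open>(k, t, S)\<close>, \<open>k\<close> is the greatest common divisor of \<open>d\<close> and a point \<open>(x, y)\<close>, \<open>t\<close> is the value of
  \<open>(a x + b y) / y\<close> modulo \<open>d / gcd(d, k\<^sup>2)\<close>, and \<open>S\<close> runs through the inclusion-exclusion that removes
  the points with a larger greatest common divisor.\<close>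
definition lat_idx :: "int \<Rightarrow> nat \<Rightarrow> (nat \<times> int \<times> nat set) set" where
  "lat_idx \<Delta> d = (SIGMA k:{k. k dvd d}. sq_roots \<Delta> (red_mod d k) \<times> Pow (prime_factors (d div k)))"

text \<open>On a point \<open>k * (x', y')\<close> the last condition says
  \<open>a * x' + b * y'\<close> is congruent to \<open>t * y'\<close> modulo
  \<open>red_mod d k\<close>. Every condition is a linear congruence, so the set is a
  lattice.\<close>

definition lat :: "int \<Rightarrow> int \<Rightarrow> nat \<Rightarrow> nat \<times> int \<times> nat set \<Rightarrow> (int \<times> int) set" where
  "lat a b d = (\<lambda>(k, t, S). {(x, y). int k dvd x \<and> int k dvd y \<and>
      (\<forall>p\<in>S. int (k * p) dvd x \<and> int (k * p) dvd y) \<and>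
      int (k * red_mod d k) dvd a * x + (b - t) * y})"

definition lat_sign :: "nat \<times> int \<times> nat set \<Rightarrow> int" where
  "lat_sign = (\<lambda>(k, t, S). (-1) ^ card S)"

lemma red_mod_mult: "red_mod d k * gcd d (k\<^sup>2) = d"
  by (simp add: red_mod_def)

lemma red_mod_pos: "d > 0 \<Longrightarrow> red_mod d k > 0"
  using red_mod_mult[of d k] by (metis mult_is_0 neq0_conv)

lemma red_mod_dvd: "red_mod d k dvd d"
  by (metis dvd_triv_left red_mod_mult)

lemma dvd_square_red_mod: "d dvd k\<^sup>2 * red_mod d k"
proof -
  have "gcd d (k\<^sup>2) * red_mod d k dvd k\<^sup>2 * red_mod d k" by (rule mult_dvd_mono) simp_all
  then show ?thesis by (simp add: mult.commute[of "gcd d (k\<^sup>2)"] red_mod_mult)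
qed

lemma mult_red_mod_dvd:
  assumes "k dvd d" "d > 0"
  shows "k * red_mod d k dvd d"
proof -
  have "k dvd gcd d (k\<^sup>2)" using assms by (simp add: power2_eq_square)
  then have "k * red_mod d k dvd gcd d (k\<^sup>2) * red_mod d k" by (intro mult_dvd_mono) auto
  then show ?thesis by (simp add: mult.commute red_mod_mult)
qed

lemma square_dvd_red_mod:
  assumes "d > 0"
  shows "int d dvd int (k\<^sup>2) * q \<longleftrightarrow> int (red_mod d k) dvd q"
proof
  assume "int (red_mod d k) dvd q"
  then have "int (k\<^sup>2) * int (red_mod d k) dvd int (k\<^sup>2) * q" by simp
  moreover have "int d dvd int (k\<^sup>2) * int (red_mod d k)"
    using dvd_square_red_mod[of d k] by (metis int_dvd_int_iff of_nat_mult)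
  ultimately show "int d dvd int (k\<^sup>2) * q" by (rule dvd_trans[rotated])
next
  assume *: "int d dvd int (k\<^sup>2) * q"
  define g where "g = gcd d (k\<^sup>2)"
  have g: "g > 0" using assms by (simp add: g_def)
  obtain m where m: "k\<^sup>2 = g * m" unfolding g_def by (metis dvdE gcd_dvd2)
  have d: "d = g * red_mod d k" using red_mod_mult[of d k] by (simp add: g_def mult.commute)
  have "g = gcd (g * red_mod d k) (g * m)" using m d g_def by simp
  then have "g = g * gcd (red_mod d k) m" by (simp add: gcd_mult_left)
  then have "g * gcd (red_mod d k) m = g * 1" by (simp only: mult_1_right)
  then have "coprime (red_mod d k) m" using g by (simp only: mult_cancel1) (simp add: coprime_iff_gcd_eq_1)
  moreover have "int g * int (red_mod d k) dvd int g * (int m * q)"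
  proof -
    have "int g * int (red_mod d k) = int d" by (metis d of_nat_mult)
    moreover have "int g * (int m * q) = int (k\<^sup>2) * q" by (simp add: m)
    ultimately show ?thesis using * by (simp only:)
  qed
  then have "int (red_mod d k) dvd int m * q" using g by simp
  ultimately show "int (red_mod d k) dvd q"
    by (simp add: coprime_dvd_mult_right_iff)
qed

lemma finite_sq_roots: "finite (sq_roots \<Delta> e)"
  unfolding sq_roots_def by (rule finite_subset[of _ "{0..<int e}"]) auto

lemma finite_lat_idx: "d > 0 \<Longrightarrow> finite (lat_idx \<Delta> d)"
  unfolding lat_idx_def by (intro finite_SigmaI finite_cartesian_product finite_sq_roots) auto

lemma card_sq_roots_red_mod_le:
  assumes "d > 0" "odd d" "coprime \<Delta> (int d)"
  shows "card (sq_roots \<Delta> (red_mod d k)) \<le> tau d"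
proof -
  have dvd: "int (red_mod d k) dvd int d" using red_mod_dvd[of d k] by simp
  have "odd (red_mod d k)" using assms(2) red_mod_dvd dvd_trans by blast
  moreover have "coprime \<Delta> (int (red_mod d k))"
    using assms(3) dvd by (meson coprime_divisors dvd_refl)
  ultimately have "card (sq_roots \<Delta> (red_mod d k)) \<le> tau (red_mod d k)"
    unfolding sq_roots_def using card_square_roots_le red_mod_pos assms(1) by blast
  also have "\<dots> \<le> tau d" using assms(1) red_mod_dvd by (intro tau_mono) auto
  finally show ?thesis .
qed

text \<open>One factor \<open>tau d\<close> each for the choice of \<open>k\<close>, of
  \<open>t\<close> and of \<open>S\<close>.\<close>

lemma card_lat_idx_le:
  assumes "d > 0" "odd d" "coprime \<Delta> (int d)"
  shows "card (lat_idx \<Delta> d) \<le> tau d ^ 3"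
proof -
  have "card (lat_idx \<Delta> d) =
      (\<Sum>k\<in>{k. k dvd d}. card (sq_roots \<Delta> (red_mod d k)) * card (Pow (prime_factors (d div k))))"
    unfolding lat_idx_def using assms(1)
    by (subst card_SigmaI) (auto simp: card_cartesian_product finite_sq_roots)
  also have "\<dots> \<le> (\<Sum>k\<in>{k. k dvd d}. tau d * tau d)"
  proof (intro sum_mono mult_mono)
    fix k assume k: "k \<in> {k. k dvd d}"
    then have "d div k > 0" "d div k dvd d" using assms(1) by (auto elim: dvdE)
    then show "card (Pow (prime_factors (d div k))) \<le> tau d"
      using card_Pow_prime_factors_le tau_mono assms(1) le_trans by blast
  qed (use card_sq_roots_red_mod_le assms in auto)
  finally show ?thesis by (simp add: tau_def power3_eq_cube)
qed

lemma lat_diff: "p \<in> lat a b d j \<Longrightarrow> q \<in> lat a b d j \<Longrightarrow> (fst p - fst q, snd p - snd q) \<in> lat a b d j"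
proof -
  have *: "a * (x - x') + (b - t) * (y - y') = (a * x + (b - t) * y) - (a * x' + (b - t) * y')"
    for x x' y y' t :: int by (simp add: algebra_simps)
  show "p \<in> lat a b d j \<Longrightarrow> q \<in> lat a b d j \<Longrightarrow> (fst p - fst q, snd p - snd q) \<in> lat a b d j"
    unfolding lat_def by (auto simp only: split_beta fst_conv snd_conv mem_Collect_eq * intro!: dvd_diff)
qed

text \<open>Periodicity modulo \<open>d\<close>: it provides full rank, and it makes the density
  readable from a single square.\<close>

lemma multiples_in_lat:
  assumes "d > 0" "j \<in> lat_idx \<Delta> d" "int d dvd x" "int d dvd y"
  shows "(x, y) \<in> lat a b d j"
proof -
  obtain k t S where j: "j = (k, t, S)" by (cases j) auto
  have k: "k dvd d" and S: "S \<subseteq> prime_factors (d div k)" using assms(2) j by (auto simp: lat_idx_def)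
  have kp: "int (k * p) dvd int d" if "p \<in> S" for p
  proof -
    have "p dvd d div k" using S that by auto
    then have "k * p dvd k * (d div k)" by simp
    then have "k * p dvd d" using k by simp
    then show ?thesis by (simp only: int_dvd_int_iff)
  qed
  have "int (k * red_mod d k) dvd int d"
    using mult_red_mod_dvd[OF k assms(1)] by (simp only: int_dvd_int_iff)
  moreover have "int k dvd int d" using k by simp
  ultimately have "m dvd x" "m dvd y" if "m \<in> {int k, int (k * red_mod d k)} \<union> (\<lambda>p. int (k * p)) ` S" for m
    using assms(3,4) kp that by (auto simp del: of_nat_mult intro: dvd_trans)
  then show ?thesis unfolding lat_def j
    by (auto simp del: of_nat_mult intro!: dvd_add dvd_mult)
qed

section \<open>Roots attached to a primitive point\<close>

lemma qform_times: "a * qform a b c (x, y) = (a * x + b * y)\<^sup>2 - qdet a b c * y\<^sup>2"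
  by (simp add: qform_def power2_eq_square algebra_simps)

lemma qform_scale: "qform a b c (k * x, k * y) = k\<^sup>2 * qform a b c (x, y)"
  by (simp add: qform_def power2_eq_square algebra_simps)

lemma dvd_qform_of_root:
  assumes "coprime a e" "e dvd t\<^sup>2 - qdet a b c" "e dvd a * x + (b - t) * y"
  shows "e dvd qform a b c (x, y)"
proof -
  have "a * qform a b c (x, y) =
      (a * x + (b - t) * y) * (a * x + (b + t) * y) + (t\<^sup>2 - qdet a b c) * y\<^sup>2"
    by (simp add: qform_times power2_eq_square algebra_simps)
  then have "e dvd a * qform a b c (x, y)" using assms(2,3) by simp
  then show ?thesis using assms(1) by (simp add: coprime_dvd_mult_right_iff coprime_commute)
qed

text \<open>Needed for every lattice separately, not only for their signed sum: the shortest vector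
  of a lattice must have \<open>d\<close> dividing the value of the form.\<close>

lemma lat_subset:
  assumes "d > 0" "coprime a (int d)" "j \<in> lat_idx (qdet a b c) d" "p \<in> lat a b d j"
  shows "int d dvd qform a b c p"
proof -
  obtain k t S where j: "j = (k, t, S)" by (cases j) auto
  obtain x y where p: "p = (x, y)" by (cases p)
  have k: "k dvd d" and t: "int (red_mod d k) dvd t\<^sup>2 - qdet a b c"
    using assms(3) j by (auto simp: lat_idx_def sq_roots_def)
  have kpos: "k > 0" using k assms(1) by (auto intro: Nat.gr0I)
  have in_lat: "int k dvd x" "int k dvd y" "int (k * red_mod d k) dvd a * x + (b - t) * y"
    using assms(4) by (auto simp: lat_def j p)
  obtain x' y' where xy: "x = int k * x'" "y = int k * y'" using in_lat by (auto elim!: dvdE)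
  have "int k * int (red_mod d k) dvd int k * (a * x' + (b - t) * y')"
    using in_lat(3) xy by (simp add: algebra_simps)
  then have "int (red_mod d k) dvd a * x' + (b - t) * y'" using kpos by simp
  moreover have "coprime a (int (red_mod d k))"
    using assms(2) red_mod_dvd[of d k] by (meson coprime_divisors dvd_refl int_dvd_int_iff)
  ultimately have "int (red_mod d k) dvd qform a b c (x', y')" using t dvd_qform_of_root by blast
  then have "int d dvd int (k\<^sup>2) * qform a b c (x', y')" using square_dvd_red_mod assms(1) by blast
  then show ?thesis by (simp add: p xy qform_scale)
qed

lemma sum_Pow_alternating:
  assumes "finite P"
  shows "(\<Sum>S\<in>Pow P. (-1) ^ card S * of_bool (\<forall>p\<in>S. f p)) = (of_bool (\<forall>p\<in>P. \<not> f p) :: int)"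
  using assms
proof (induction P)
  case (insert q P)
  have inj: "inj_on (insert q) (Pow P)" using insert by (auto simp: inj_on_def)
  have "(\<Sum>S\<in>Pow (insert q P). (-1) ^ card S * of_bool (\<forall>p\<in>S. f p)) =
     (\<Sum>S\<in>Pow P. (-1) ^ card S * of_bool (\<forall>p\<in>S. f p)) +
     (\<Sum>S\<in>insert q ` Pow P. (-1) ^ card S * (of_bool (\<forall>p\<in>S. f p) :: int))"
    unfolding Pow_insert using insert by (intro sum.union_disjoint) auto
  also have "(\<Sum>S\<in>insert q ` Pow P. (-1) ^ card S * (of_bool (\<forall>p\<in>S. f p) :: int)) =
     (\<Sum>S\<in>Pow P. (-1) ^ card (insert q S) * of_bool (\<forall>p\<in>insert q S. f p))"
    by (simp add: sum.reindex[OF inj])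
  also have "\<dots> = (\<Sum>S\<in>Pow P. - of_bool (f q) * ((-1) ^ card S * of_bool (\<forall>p\<in>S. f p)))"
  proof (rule sum.cong)
    fix S assume "S \<in> Pow P"
    then have "finite S" "q \<notin> S" using insert finite_subset by auto
    then show "(-1) ^ card (insert q S) * of_bool (\<forall>p\<in>insert q S. f p) =
      - of_bool (f q) * ((-1) ^ card S * (of_bool (\<forall>p\<in>S. f p) :: int))" by simp
  qed simp
  also have "\<dots> = - of_bool (f q) * (\<Sum>S\<in>Pow P. (-1) ^ card S * of_bool (\<forall>p\<in>S. f p))"
    by (simp only: sum_distrib_left)
  finally show ?case by (simp add: insert.IH)
qed simp

text \<open>If the greatest common divisor exceeds \<open>k\<close>, the quotient has a prime
  factor, and that prime divides \<open>d div k\<close>. So inclusion-exclusion over these primes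
  singles out the points whose greatest common divisor with \<open>d\<close> is \<open>k\<close>
  itself.\<close>

lemma gcd_eq_iff_no_prime:
  assumes "k dvd d" "d > 0" "int k dvd x" "int k dvd y"
  shows "(\<forall>p\<in>prime_factors (d div k). \<not> (int (k * p) dvd x \<and> int (k * p) dvd y)) \<longleftrightarrow>
    gcd (gcd x y) (int d) = int k" (is "?L \<longleftrightarrow> ?R")
proof -
  define G where "G = nat (gcd (gcd x y) (int d))"
  have G: "int G = gcd (gcd x y) (int d)" by (simp add: G_def)
  have dvdG: "m dvd G \<longleftrightarrow> int m dvd x \<and> int m dvd y \<and> m dvd d" for m
    by (metis G gcd_greatest_iff int_dvd_int_iff)
  have kG: "k dvd G" using assms dvdG by blast
  have Gd: "G dvd d" using dvdG[of G] by simp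
  have Gpos: "G > 0" using Gd assms(2) by (auto intro: Nat.gr0I)
  have kpos: "k > 0" using assms by (auto intro: Nat.gr0I)
  have "?L \<longleftrightarrow> G = k"
  proof
    assume L: ?L
    show "G = k"
    proof (rule ccontr)
      assume "G \<noteq> k"
      obtain m where m: "G = k * m" using kG by auto
      then have "m \<noteq> 1" using \<open>G \<noteq> k\<close> by auto
      then obtain p where p: "prime p" "p dvd m" using prime_factor_nat by blast
      have "k * p dvd G" using m p by simp
      then have kp: "int (k * p) dvd x" "int (k * p) dvd y" "k * p dvd d" using dvdG by auto
      have "p dvd d div k" using kp(3) kpos by (metis dvd_mult_imp_div mult.commute)
      moreover have "d div k > 0" using assms by (auto elim: dvdE)
      ultimately have "p \<in> prime_factors (d div k)" using p by (auto simp: prime_factors_dvd)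
      then show False using L kp by blast
    qed
  next
    assume Gk: "G = k"
    show ?L
    proof (rule ballI, rule notI)
      fix p assume p: "p \<in> prime_factors (d div k)" "int (k * p) dvd x \<and> int (k * p) dvd y"
      have "p dvd d div k" using p by auto
      then have "k * p dvd k * (d div k)" by simp
      then have "k * p dvd d" using assms(1) by simp
      then have "k * p dvd k * 1" using dvdG p(2) Gk by (metis mult.right_neutral)
      then have "p dvd 1" using kpos by (metis dvd_mult_cancel1 dvd_1_left mult_is_0 neq0_conv mult.right_neutral)
      moreover have "prime p" using p(1) by auto
      ultimately show False by auto
    qed
  qed
  then show ?thesis using G by (metis of_nat_eq_iff)
qed

text \<open>If \<open>e\<close> divides the value at a primitive point, then \<open>y\<close> is a
  unit modulo \<open>e\<close>; hence \<open>t = (a * x + b * y) / y\<close> is the only candidate,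
  and completing the square shows that it is a root of \<open>qdet\<close>.\<close>

lemma card_matching_roots:
  assumes "e > 0" "coprime a (int e)" "gcd (gcd x y) (int e) = 1"
  shows "card {t \<in> sq_roots (qdet a b c) e. int e dvd a * x + (b - t) * y} =
    of_bool (int e dvd qform a b c (x, y))"
proof (cases "int e dvd qform a b c (x, y)")
  case True
  have dd: "int e dvd (a * x + b * y)\<^sup>2 - qdet a b c * y\<^sup>2"
    using True by (simp flip: qform_times)
  \<comment> \<open>A prime dividing \<open>y\<close> and \<open>e\<close> would divide
    \<open>(a * x)\<^sup>2\<close>, hence \<open>x\<close>, as \<open>a\<close> is prime to
    \<open>e\<close>; this contradicts primitivity.\<close>
  have cy: "coprime y (int e)"
  proof (rule ccontr)
    assume "\<not> coprime y (int e)"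
    then have "gcd y (int e) \<noteq> 1" by (simp add: coprime_iff_gcd_eq_1)
    then obtain p where p: "prime p" "p dvd gcd y (int e)"
      using prime_divisor_exists[of "gcd y (int e)"] assms(1) by (auto simp: is_unit_gcd)
    then have p2: "p dvd y" "p dvd int e" by auto
    have "p dvd ((a * x + b * y)\<^sup>2 - qdet a b c * y\<^sup>2) + qdet a b c * y\<^sup>2"
      using dd p2 by (intro dvd_add) (auto intro: dvd_trans simp: power2_eq_square)
    then have "p dvd (a * x + b * y)\<^sup>2" by simp
    then have "p dvd a * x + b * y" using p(1) prime_dvd_power by blast
    then have "p dvd (a * x + b * y) - b * y" using p2 by (intro dvd_diff) auto
    then have "p dvd a * x" by simp
    moreover have "\<not> p dvd a" using assms(2) p p2 not_coprimeI not_prime_unit by blast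
    ultimately have "p dvd x" using p(1) prime_dvd_mult_iff by blast
    then have "p dvd gcd (gcd x y) (int e)" using p2 by simp
    then show False using assms(3) p(1) by auto
  qed
  obtain i where i: "[y * i = 1] (mod int e)" using cong_solve_coprime_int[OF cy] by auto
  define t where "t = ((a * x + b * y) * i) mod int e"
  have t: "[t * y = a * x + b * y] (mod int e)"
  proof -
    have "[t * y = (a * x + b * y) * i * y] (mod int e)" unfolding t_def by (intro cong_mult) auto
    also have "(a * x + b * y) * i * y = (a * x + b * y) * (y * i)" by simp
    also have "[(a * x + b * y) * (y * i) = (a * x + b * y) * 1] (mod int e)" using i by (intro cong_mult) auto
    finally show ?thesis by simp
  qed
  have "{t \<in> sq_roots (qdet a b c) e. int e dvd a * x + (b - t) * y} = {t}"
  proof (intro equalityI subsetI; (elim singletonE)?)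
    fix s assume s: "s \<in> {t \<in> sq_roots (qdet a b c) e. int e dvd a * x + (b - t) * y}"
    then have "int e dvd (a * x + b * y) - s * y" by (simp add: algebra_simps)
    then have "[a * x + b * y = s * y] (mod int e)" by (simp add: cong_iff_dvd_diff)
    then have "[t * y = s * y] (mod int e)" using t cong_trans by blast
    then have "[t = s] (mod int e)" using cy by (simp add: cong_mult_rcancel)
    moreover have "0 \<le> s" "s < int e" using s by (auto simp: sq_roots_def)
    moreover have "0 \<le> t" "t < int e" using assms(1) by (auto simp: t_def)
    ultimately show "s \<in> {t}" using cong_less_imp_eq_int by auto
  next
    fix s assume st: "s = t"
    have 1: "int e dvd a * x + (b - t) * y"
      using cong_sym[OF t] by (simp add: cong_iff_dvd_diff algebra_simps)
    have "[(t * y)\<^sup>2 = (a * x + b * y)\<^sup>2] (mod int e)" using t by (rule cong_pow)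
    moreover have "[(a * x + b * y)\<^sup>2 = qdet a b c * y\<^sup>2] (mod int e)" using dd by (simp add: cong_iff_dvd_diff)
    ultimately have "[t\<^sup>2 * y\<^sup>2 = qdet a b c * y\<^sup>2] (mod int e)" by (metis cong_trans power_mult_distrib)
    then have "[t\<^sup>2 = qdet a b c] (mod int e)" using cy by (simp add: cong_mult_rcancel)
    then have 2: "int e dvd t\<^sup>2 - qdet a b c" by (simp add: cong_iff_dvd_diff)
    moreover have "0 \<le> t" "t < int e" using assms(1) by (auto simp: t_def)
    ultimately show "s \<in> {t \<in> sq_roots (qdet a b c) e. int e dvd a * x + (b - t) * y}"
      using 1 st by (simp add: sq_roots_def)
  qed
  then show ?thesis using True by simp
next
  case False
  then have "{t \<in> sq_roots (qdet a b c) e. int e dvd a * x + (b - t) * y} = {}"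
    using dvd_qform_of_root[OF assms(2)] by (auto simp: sq_roots_def)
  then show ?thesis using False by (simp only: card.empty) simp
qed

text \<open>Let \<open>G\<close> be the greatest common divisor of the point and \<open>d\<close>.
  The alternating sum over \<open>S\<close> cancels all \<open>k\<close> other than
  \<open>G\<close>; for \<open>k = G\<close> exactly one \<open>t\<close> survives if
  \<open>d\<close> divides the value of the form, and none otherwise.\<close>

lemma sum_lat_sign:
  assumes "d > 0" "coprime a (int d)"
  shows "(\<Sum>j\<in>lat_idx (qdet a b c) d. lat_sign j * of_bool (p \<in> lat a b d j)) =
    of_bool (int d dvd qform a b c p)"
proof -
  obtain x y where p: "p = (x, y)" by (cases p)
  define G where "G = nat (gcd (gcd x y) (int d))"
  have G: "int G = gcd (gcd x y) (int d)" by (simp add: G_def)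
  have Gd: "G dvd d" by (metis G gcd_dvd2 int_dvd_int_iff)
  have Gpos: "G > 0" using Gd assms(1) by (auto intro: Nat.gr0I)
  have Gxy: "int G dvd x" "int G dvd y" unfolding G by (auto intro: dvd_trans)
  let ?R = "\<lambda>k. sq_roots (qdet a b c) (red_mod d k)"
  let ?N = "\<lambda>k. {t \<in> ?R k. int (k * red_mod d k) dvd a * x + (b - t) * y}"
  have inner: "(\<Sum>(t, S)\<in>?R k \<times> Pow (prime_factors (d div k)). lat_sign (k, t, S) * of_bool (p \<in> lat a b d (k, t, S))) =
     (if k = G then int (card (?N G)) else 0)" if k: "k dvd d" for k
  proof (cases "int k dvd x \<and> int k dvd y")
    case True
    have "(\<Sum>(t, S)\<in>?R k \<times> Pow (prime_factors (d div k)). lat_sign (k, t, S) * of_bool (p \<in> lat a b d (k, t, S))) =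
      (\<Sum>t\<in>?R k. \<Sum>S\<in>Pow (prime_factors (d div k)). of_bool (int (k * red_mod d k) dvd a * x + (b - t) * y) *
         ((-1) ^ card S * of_bool (\<forall>q\<in>S. int (k * q) dvd x \<and> int (k * q) dvd y)))"
      unfolding sum.cartesian_product using True by (intro sum.cong) (auto simp: lat_sign_def lat_def p)
    also have "\<dots> = (\<Sum>t\<in>?R k. of_bool (int (k * red_mod d k) dvd a * x + (b - t) * y) *
         of_bool (gcd (gcd x y) (int d) = int k))"
      unfolding sum_distrib_left[symmetric]
      by (subst sum_Pow_alternating) (use gcd_eq_iff_no_prime[OF k assms(1)] True in auto)
    also have "\<dots> = of_bool (G = k) * int (card (?N k))"
      unfolding G[symmetric] sum_distrib_right[symmetric]
      using finite_sq_roots by (simp add: sum.If_cases of_bool_def Int_def)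
    finally show ?thesis by auto
  next
    case False
    then have "k \<noteq> G" using Gxy by auto
    then show ?thesis using False by (auto simp: lat_def p intro!: sum.neutral)
  qed
  have "(\<Sum>j\<in>lat_idx (qdet a b c) d. lat_sign j * of_bool (p \<in> lat a b d j)) =
    (\<Sum>k\<in>{k. k dvd d}. \<Sum>(t, S)\<in>?R k \<times> Pow (prime_factors (d div k)). lat_sign (k, t, S) * of_bool (p \<in> lat a b d (k, t, S)))"
    unfolding lat_idx_def using assms(1) by (subst sum.Sigma) (auto simp: finite_sq_roots split_beta)
  also have "\<dots> = (\<Sum>k\<in>{k. k dvd d}. if k = G then int (card (?N G)) else 0)"
    by (intro sum.cong) (simp_all only: inner mem_Collect_eq)
  also have "\<dots> = int (card (?N G))" using Gd assms(1) by simp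
  also have "card (?N G) = of_bool (int d dvd qform a b c p)"
  proof -
    obtain x' y' where xy: "x = int G * x'" "y = int G * y'" using Gxy by (auto elim!: dvdE)
    have dG: "int d = int G * int (d div G)" using Gd by (simp flip: of_nat_mult)
    have "int G = int G * gcd (gcd x' y') (int (d div G))"
      using G unfolding xy by (subst (asm) dG) (simp add: gcd_mult_left abs_mult)
    then have "int G * gcd (gcd x' y') (int (d div G)) = int G * 1" by (simp only: mult_1_right)
    then have "gcd (gcd x' y') (int (d div G)) = 1" using Gpos by (simp only: mult_cancel_left) simp
    \<comment> \<open>Taking \<open>G\<close> out of the point makes it primitive modulo
      \<open>d div G\<close>; the root count needs this modulo \<open>red_mod d G\<close>.\<close>
    moreover have "red_mod d G dvd d div G"
      using mult_red_mod_dvd[OF Gd assms(1)] Gpos by (simp add: dvd_div_iff_mult Gd mult.commute)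
    ultimately have g1: "gcd (gcd x' y') (int (red_mod d G)) = 1"
      by (metis coprime_divisors coprime_iff_gcd_eq_1 dvd_refl int_dvd_int_iff)
    have cop: "coprime a (int (red_mod d G))"
      using assms(2) red_mod_dvd[of d G] by (meson coprime_divisors dvd_refl int_dvd_int_iff)
    have "int (G * red_mod d G) dvd a * x + (b - t) * y \<longleftrightarrow> int (red_mod d G) dvd a * x' + (b - t) * y'" for t
    proof -
      have "a * x + (b - t) * y = int G * (a * x' + (b - t) * y')" by (simp add: xy algebra_simps)
      then show ?thesis using Gpos by simp
    qed
    then have "card (?N G) = card {t \<in> ?R G. int (red_mod d G) dvd a * x' + (b - t) * y'}" by simp
    also have "\<dots> = of_bool (int (red_mod d G) dvd qform a b c (x', y'))"
      by (rule card_matching_roots[OF red_mod_pos[OF assms(1)] cop g1])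
    also have "\<dots> = of_bool (int d dvd qform a b c p)"
      using square_dvd_red_mod[OF assms(1), of G] by (simp add: p xy qform_scale)
    finally show ?thesis .
  qed
  finally show ?thesis by simp
qed

section \<open>Boundary curves of convex regions\<close>

no_notation Matrix.scalar_prod (infix "\<bullet>" 70)

lemma affine_functional_collinear:
  fixes e p o' :: "real \<times> real"
  assumes "e \<noteq> 0" "e \<bullet> p = e \<bullet> o'"
  shows "\<exists>s. p = o' + s *\<^sub>R (- snd e, fst e)"
proof -
  obtain e1 e2 where e: "e = (e1, e2)" by (cases e)
  obtain p1 p2 where p: "p = (p1, p2)" by (cases p)
  obtain q1 q2 where q: "o' = (q1, q2)" by (cases o')
  have pos: "e1\<^sup>2 + e2\<^sup>2 \<noteq> 0" using assms(1) by (simp add: e zero_prod_def sum_power2_eq_zero_iff)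
  have h: "e1 * (p1 - q1) + e2 * (p2 - q2) = 0" using assms(2) by (simp add: e p q algebra_simps)
  define s where "s = (e1 * (p2 - q2) - e2 * (p1 - q1)) / (e1\<^sup>2 + e2\<^sup>2)"
  have "(p1 - q1) * (e1\<^sup>2 + e2\<^sup>2) = - e2 * (e1 * (p2 - q2) - e2 * (p1 - q1)) + e1 * (e1 * (p1 - q1) + e2 * (p2 - q2))"
    by (simp add: power2_eq_square algebra_simps)
  then have 1: "p1 - q1 = - e2 * s" unfolding h s_def times_divide_eq_right nonzero_eq_divide_eq[OF pos] by simp
  have "(p2 - q2) * (e1\<^sup>2 + e2\<^sup>2) = e1 * (e1 * (p2 - q2) - e2 * (p1 - q1)) + e2 * (e1 * (p1 - q1) + e2 * (p2 - q2))"
    by (simp add: power2_eq_square algebra_simps)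
  then have 2: "p2 - q2 = e1 * s" unfolding h s_def times_divide_eq_right nonzero_eq_divide_eq[OF pos] by simp
  show ?thesis using 1 2 by (intro exI[of _ s]) (simp add: e p q algebra_simps)
qed

text \<open>Two of three frontier points on a line through an interior point lie on the same side of
  it. The nearer one is strictly between the interior point and a point of the closure, hence itself
  interior.\<close>

lemma three_frontier_points_on_line:
  fixes R :: "(real \<times> real) set"
  assumes "convex R" "e \<noteq> 0" "o' \<in> interior R" "card P = 3" "P \<subseteq> frontier R" "\<And>p. p \<in> P \<Longrightarrow> e \<bullet> p = e \<bullet> o'"
  shows False
proof -
  define u where "u = (- snd e, fst e)"
  have u0: "u \<noteq> 0" using assms(2) by (auto simp: u_def zero_prod_def prod_eq_iff)
  have "\<exists>s. p = o' + s *\<^sub>R u" if "p \<in> P" for p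
    using affine_functional_collinear[OF assms(2) assms(6)[OF that]] by (simp add: u_def)
  then obtain s where s: "\<And>p. p \<in> P \<Longrightarrow> p = o' + s p *\<^sub>R u" by metis
  have Pfr: "p \<in> closure R" "p \<notin> interior R" if "p \<in> P" for p
    using that assms(5) by (auto simp: frontier_def)
  have inj: "inj_on s P" using s by (metis inj_onI)
  have s0: "s p \<noteq> 0" if "p \<in> P" for p
    using s[OF that] Pfr[OF that] assms(3) by auto
  have no: False if "p \<in> P" "q \<in> P" "0 < s p / s q" "s p / s q < 1" for p q
  proof -
    define mu where "mu = s p / s q"
    have "p = (1 - mu) *\<^sub>R o' + mu *\<^sub>R q"
    proof -
      have "(1 - mu) *\<^sub>R o' + mu *\<^sub>R q = (1 - mu) *\<^sub>R o' + mu *\<^sub>R (o' + s q *\<^sub>R u)" using s[OF that(2)] by simp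
      also have "\<dots> = o' + (mu * s q) *\<^sub>R u" by (simp add: algebra_simps)
      also have "mu * s q = s p" using s0[OF that(2)] by (simp add: mu_def)
      finally show ?thesis using s[OF that(1)] by simp
    qed
    moreover have "o' \<noteq> q" using Pfr that assms(3) by blast
    ultimately have "p \<in> open_segment o' q"
      using that by (auto simp: in_segment mu_def)
    then show False
      using in_interior_closure_convex_segment[OF assms(1,3) Pfr(1)[OF that(2)]] Pfr(2)[OF that(1)] by blast
  qed
  have noS: False if "p \<in> P" "q \<in> P" "p \<noteq> q" "s p * s q > 0" for p q
  proof -
    have "s p \<noteq> s q" using inj that by (auto simp: inj_on_def)
    moreover have "s p / s q > 0" using that(4) by (auto simp: zero_less_divide_iff zero_less_mult_iff)
    moreover have "s q / s p > 0" using that(4) by (auto simp: zero_less_divide_iff zero_less_mult_iff)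
    moreover have "s p / s q < 1 \<or> s q / s p < 1"
      using that(4) \<open>s p \<noteq> s q\<close> by (auto simp: divide_less_eq zero_less_mult_iff)
    ultimately show False using no that by blast
  qed
  obtain x y z where P: "P = {x, y, z}" "x \<noteq> y" "y \<noteq> z" "x \<noteq> z" using assms(4) by (auto simp: card_3_iff)
  then have "s x \<noteq> 0" "s y \<noteq> 0" "s z \<noteq> 0" using s0 by blast+
  then have "s x * s y > 0 \<or> s y * s z > 0 \<or> s x * s z > 0"
    unfolding zero_less_mult_iff by linarith
  then show False using noS P by blast
qed

lemma closure_diff_open_interval:
  fixes I :: "real set"
  assumes "convex I" "bounded I"
  shows "closure I - I \<subseteq> {Inf I, Sup I}"
proof
  fix y assume y: "y \<in> closure I - I"
  then have ne: "I \<noteq> {}" by auto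
  have bdd: "bdd_above I" "bdd_below I" using assms(2) by (auto simp: bounded_imp_bdd_above bounded_imp_bdd_below)
  have "closure I \<subseteq> {Inf I..Sup I}"
    using bdd by (intro closure_minimal) (auto intro: cInf_lower cSup_upper)
  then have b: "Inf I \<le> y" "y \<le> Sup I" using y by auto
  show "y \<in> {Inf I, Sup I}"
  proof (rule ccontr)
    assume "y \<notin> {Inf I, Sup I}"
    then have "Inf I < y" "y < Sup I" using b by auto
    then obtain a c where ac: "a \<in> I" "a < y" "c \<in> I" "y < c"
      using ne bdd by (meson cInf_less_iff less_cSup_iff)
    then have "closed_segment a c \<subseteq> I" using assms(1) by (simp add: convex_contains_segment)
    then have "y \<in> I" using ac by (auto simp: closed_segment_eq_real_ivl)
    then show False using y by auto
  qed
qed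

text \<open>The linear functional maps the interior onto a bounded interval, and levels inside it
  are settled by the three-point argument. The closure of \<open>R\<close> is the closure of its
  interior, so the only other levels that can occur on the frontier are the two ends of the
  interval.\<close>

lemma convex_frontier_line_finite:
  fixes R :: "(real \<times> real) set"
  assumes "convex R" "bounded R" "e \<noteq> 0" "interior R \<noteq> {}"
  shows "\<exists>F. finite F \<and> (\<forall>y P. y \<notin> F \<longrightarrow> P \<subseteq> frontier R \<longrightarrow> (\<forall>p\<in>P. e \<bullet> p = y) \<longrightarrow> card P \<noteq> 3)"
proof -
  define I where "I = (\<lambda>p. e \<bullet> p) ` interior R"
  have lin: "linear (\<lambda>p. e \<bullet> p)" by (simp add: bounded_linear.linear bounded_linear_inner_right)
  have "convex I" unfolding I_def using assms(1) lin by (intro convex_linear_image convex_interior)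
  moreover have "bounded I" unfolding I_def
    using assms(2) by (intro bounded_linear_image bounded_linear_inner_right bounded_subset[OF assms(2) interior_subset])
  ultimately have fin: "finite (closure I - I)" using closure_diff_open_interval finite_subset by blast
  have cl: "(\<lambda>p. e \<bullet> p) ` closure R \<subseteq> closure I"
  proof -
    have "closure R = closure (interior R)" using assms by (simp add: convex_closure_interior)
    then show ?thesis unfolding I_def
      by (metis closure_linear_image_subset lin)
  qed
  have "card P \<noteq> 3" if "y \<notin> closure I - I" "P \<subseteq> frontier R" "\<forall>p\<in>P. e \<bullet> p = y" for y P
  proof
    assume c: "card P = 3"
    then have "P \<noteq> {}" by auto
    then obtain p where p: "p \<in> P" by blast
    then have "p \<in> closure R" using that(2) by (auto simp: frontier_def)
    then have "e \<bullet> p \<in> closure I" using cl by blast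
    then have "y \<in> I" using that p by simp
    then obtain o' where o': "o' \<in> interior R" "y = e \<bullet> o'" unfolding I_def by (rule imageE)
    show False
      by (rule three_frontier_points_on_line[OF assms(1,3) o'(1) c that(2)]) (use that(3) o'(2) in simp)
  qed
  then show ?thesis using fin by blast
qed

text \<open>A flat region lies on a line. A level containing two points of that line forces the
  functional to be constant on it, so there is at most one exceptional level.\<close>

lemma flat_frontier_line_finite:
  fixes R :: "(real \<times> real) set"
  assumes "convex R" "e \<noteq> 0" "interior R = {}"
  shows "\<exists>F. finite F \<and> (\<forall>y P. y \<notin> F \<longrightarrow> P \<subseteq> frontier R \<longrightarrow> (\<forall>p\<in>P. e \<bullet> p = y) \<longrightarrow> card P \<noteq> 3)"
proof -
  obtain h k where h: "h \<noteq> 0" "R \<subseteq> {x. h \<bullet> x = k}"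
    using empty_interior_subset_hyperplane[OF assms(1,3)] by blast
  have "closure R \<subseteq> {x. h \<bullet> x = k}" using h by (intro closure_minimal) (auto simp: closed_hyperplane)
  then have fr: "frontier R \<subseteq> {x. h \<bullet> x = k}" by (auto simp: frontier_def)
  define F where "F = {y. \<exists>p q. p \<noteq> q \<and> h \<bullet> p = k \<and> h \<bullet> q = k \<and> e \<bullet> p = y \<and> e \<bullet> q = y}"
  have "y = y'" if yF: "y \<in> F" "y' \<in> F" for y y'
  proof -
    obtain p q where pq: "p \<noteq> q" "h \<bullet> p = k" "h \<bullet> q = k" "e \<bullet> p = y" "e \<bullet> q = y" using yF(1) unfolding F_def by blast
    obtain p' where p': "h \<bullet> p' = k" "e \<bullet> p' = y'" using yF(2) unfolding F_def by blast
    obtain s where s: "q = p + s *\<^sub>R (- snd h, fst h)" using affine_functional_collinear[of h q p] h pq by auto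
    obtain s' where s': "p' = p + s' *\<^sub>R (- snd h, fst h)" using affine_functional_collinear[of h p' p] h pq p' by auto
    have "s \<noteq> 0"
    proof
      assume "s = 0"
      then have "q = p" using s by (simp add: prod_eq_iff)
      then show False using pq(1) by simp
    qed
    moreover have "e \<bullet> q = e \<bullet> p + s * (e \<bullet> (- snd h, fst h))" by (simp only: s inner_add_right inner_scaleR_right)
    ultimately have "e \<bullet> (- snd h, fst h) = 0" using pq by simp
    moreover have "e \<bullet> p' = e \<bullet> p + s' * (e \<bullet> (- snd h, fst h))" by (simp only: s' inner_add_right inner_scaleR_right)
    ultimately show ?thesis using pq p' by simp
  qed
  then have fin: "finite F" by (metis finite.simps is_singletonI' is_singleton_def)
  have "card P \<noteq> 3" if "y \<notin> F" "P \<subseteq> frontier R" "\<forall>p\<in>P. e \<bullet> p = y" for y P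
  proof
    assume "card P = 3"
    then obtain p q where "p \<in> P" "q \<in> P" "p \<noteq> q" unfolding card_3_iff by blast
    moreover from this have "h \<bullet> p = k" "h \<bullet> q = k" using that(2) fr by blast+
    ultimately have "y \<in> F" using that(3) unfolding F_def by blast
    then show False using that by simp
  qed
  then show ?thesis using fin by blast
qed

text \<open>Outside the exceptional levels there are at most two frontier points; the third
  parameter allows for the endpoints 0 and 1, which map to the same point.\<close>

lemma simple_closed_path_line_card:
  fixes R :: "(real \<times> real) set"
  assumes "convex R" "bounded R" "e \<noteq> 0" "simple_path \<gamma>" "path_image \<gamma> = frontier R"
  shows "\<exists>F. finite F \<and> (\<forall>y. y \<notin> F \<longrightarrow> (\<forall>T. T \<subseteq> {t \<in> {0..1}. e \<bullet> \<gamma> t = y} \<longrightarrow> finite T \<longrightarrow> card T \<le> 3))"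
proof -
  obtain F where F: "finite F" "\<And>y P. y \<notin> F \<Longrightarrow> P \<subseteq> frontier R \<Longrightarrow> (\<forall>p\<in>P. e \<bullet> p = y) \<Longrightarrow> card P \<noteq> 3"
    using convex_frontier_line_finite[OF assms(1-3)] flat_frontier_line_finite[OF assms(1,3)]
    by (cases "interior R = {}") metis+
  have "card T \<le> 3" if "y \<notin> F" "T \<subseteq> {t \<in> {0..1}. e \<bullet> \<gamma> t = y}" "finite T" for y T
  proof (rule ccontr)
    assume "\<not> card T \<le> 3"
    \<comment> \<open>Without the parameter 1 the path is injective, so four parameters still leave
      three distinct points.\<close>
    then have "3 \<le> card (T - {1})" using card_Diff_singleton_if[of T 1] by (auto split: if_splits)
    then obtain U where U: "U \<subseteq> T - {1}" "card U = 3" by (meson obtain_subset_with_card_n)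
    have "inj_on \<gamma> U"
    proof (rule inj_onI)
      fix s t assume st: "s \<in> U" "t \<in> U" "\<gamma> s = \<gamma> t"
      then have "s \<in> {0..1}" "t \<in> {0..1}" "s \<noteq> 1" "t \<noteq> 1" using U that by auto
      then show "s = t" using assms(4) st unfolding simple_path_def loop_free_def by blast
    qed
    then have "card (\<gamma> ` U) = 3" using U by (simp add: card_image)
    moreover have "\<gamma> ` U \<subseteq> frontier R" unfolding assms(5)[symmetric] path_image_def
      using U(1) that(2) by blast
    ultimately show False using F(2)[OF that(1), of "\<gamma> ` U"] U that by auto
  qed
  then show ?thesis using F(1) by blast
qed

text \<open>Banach's indicatrix argument: almost every level is crossed at most three times.\<close>
lemma variation_le_of_multiplicity:
  fixes f :: "real \<Rightarrow> real"
  assumes cont: "continuous_on {0..1} f" and "finite F" and B: "\<And>t. t \<in> {0..1} \<Longrightarrow> \<bar>f t\<bar> \<le> B"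
    and mult: "\<And>y T. y \<notin> F \<Longrightarrow> T \<subseteq> {t \<in> {0..1}. f t = y} \<Longrightarrow> finite T \<Longrightarrow> card T \<le> 3"
    and d: "d division_of {0..1}"
  shows "(\<Sum>K\<in>d. \<bar>f (Sup K) - f (Inf K)\<bar>) \<le> 6 * B"
proof -
  have B0: "B \<ge> 0" using B[of 0] by simp
  have fin: "finite d" using d by (rule division_of_finite)
  \<comment> \<open>Open, so that a level in \<open>I K\<close> is attained in the interior of
    \<open>K\<close>; as the interiors of a division are disjoint, different \<open>K\<close> give
    different parameters.\<close>
  define I where "I K = {min (f (Sup K)) (f (Inf K))<..<max (f (Sup K)) (f (Inf K))}" for K
  have K: "\<exists>u v. u \<le> v \<and> K = {u..v} \<and> 0 \<le> u \<and> v \<le> 1 \<and> Sup K = v \<and> Inf K = u" if Kd: "K \<in> d" for K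
  proof -
    obtain u v where uv: "K = cbox u v" using division_ofD(4)[OF d Kd] by auto
    moreover have "K \<noteq> {}" "K \<subseteq> {0..1}" using division_ofD(2,3)[OF d Kd] by auto
    ultimately have "u \<le> v" "0 \<le> u" "v \<le> 1" by auto
    then show ?thesis using uv by auto
  qed
  have cross: "\<exists>t. t \<in> interior K \<and> f t = y" if "K \<in> d" "y \<in> I K" for K y
  proof -
    obtain u v where uv: "u \<le> v" "K = {u..v}" "0 \<le> u" "v \<le> 1" "Sup K = v" "Inf K = u" using K[OF \<open>K \<in> d\<close>] by blast
    have c: "continuous_on {u..v} f" using cont uv by (auto elim: continuous_on_subset)
    have y: "min (f v) (f u) < y" "y < max (f v) (f u)" using that uv by (auto simp: I_def)
    have "\<exists>t. u \<le> t \<and> t \<le> v \<and> f t = y"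
    proof (cases "f u \<le> f v")
      case True
      then show ?thesis using IVT'[of f u y v] y uv c by auto
    next
      case False
      then show ?thesis using IVT2'[of f v y u] y uv c by auto
    qed
    then obtain t where t: "u \<le> t" "t \<le> v" "f t = y" by blast
    have "t \<noteq> u" "t \<noteq> v" using t y by auto
    then show ?thesis using t uv by (intro exI[of _ t]) auto
  qed
  have bound: "(\<Sum>K\<in>d. indicat_real (I K) y) \<le> 3 * indicat_real {-B..B} y" if "y \<notin> F" for y
  proof -
    define A where "A = {K \<in> d. y \<in> I K}"
    have sum: "(\<Sum>K\<in>d. indicat_real (I K) y) = real (card A)"
      using fin by (simp add: A_def indicator_def sum.If_cases Int_def of_bool_def)
    have "\<forall>K\<in>A. \<exists>t. t \<in> interior K \<and> f t = y" using cross by (auto simp: A_def)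
    then obtain \<tau> where \<tau>: "\<And>K. K \<in> A \<Longrightarrow> \<tau> K \<in> interior K \<and> f (\<tau> K) = y" by metis
    have inj: "inj_on \<tau> A"
    proof (rule inj_onI)
      fix K K' assume KK: "K \<in> A" "K' \<in> A" "\<tau> K = \<tau> K'"
      then have "\<tau> K \<in> interior K \<inter> interior K'" using \<tau>[of K] \<tau>[of K'] by auto
      then show "K = K'" using division_ofD(5)[OF d, of K K'] KK by (auto simp: A_def)
    qed
    have in01: "\<tau> K \<in> {0..1}" if "K \<in> A" for K
    proof -
      have "\<tau> K \<in> K" using \<tau>[OF that] interior_subset by blast
      moreover have "K \<in> d" using that by (simp add: A_def)
      ultimately show ?thesis using division_ofD(2)[OF d] by blast
    qed
    show ?thesis
    proof (cases "A = {}")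
      case True
      then show ?thesis using sum by simp
    next
      case False
      have finA: "finite A" using fin by (simp add: A_def)
      have "card (\<tau> ` A) \<le> 3" using \<tau> in01 finA by (intro mult[OF that]) auto
      then have "card A \<le> 3" using inj by (simp add: card_image)
      moreover obtain K where "K \<in> A" using False by blast
      then have "\<bar>y\<bar> \<le> B" using \<tau>[of K] B in01[of K] by metis
      then have "y \<in> {-B..B}" by auto
      ultimately show ?thesis using sum by simp
    qed
  qed
  have meas: "measure lborel (I K) = \<bar>f (Sup K) - f (Inf K)\<bar>" for K
    by (simp add: I_def max_def min_def)
  have int: "integrable lborel (indicat_real (I K))" for K
    by (auto simp: I_def intro!: integrable_real_indicator)
  have "(\<Sum>K\<in>d. \<bar>f (Sup K) - f (Inf K)\<bar>) = (\<Sum>K\<in>d. \<integral>y. indicat_real (I K) y \<partial>lborel)"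
    by (simp add: meas)
  also have "\<dots> = (\<integral>y. (\<Sum>K\<in>d. indicat_real (I K) y) \<partial>lborel)"
    by (rule Bochner_Integration.integral_sum[symmetric]) (rule int)
  also have "\<dots> \<le> (\<integral>y. 3 * indicat_real {-B..B} y \<partial>lborel)"
  proof (rule integral_mono_AE)
    have "AE y in lborel. y \<notin> F" using assms(2) by (intro AE_not_in finite_imp_null_set_lborel)
    then show "AE y in lborel. (\<Sum>K\<in>d. indicat_real (I K) y) \<le> 3 * indicat_real {-B..B} y"
      by eventually_elim (rule bound)
    show "integrable lborel (\<lambda>y. 3 * indicat_real {-B..B} y)"
      using B0 by (intro integrable_mult_right integrable_real_indicator) (auto simp: emeasure_lborel_Icc_eq)
  qed (use int in auto)
  \<comment> \<open>At most three crossings on a range of levels of length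
    \<open>2 * B\<close>.\<close>
  also have "\<dots> = 6 * B" using B0 by simp
  finally show ?thesis .
qed

text \<open>The predicate \<^const>\<open>piecewise_C1_differentiable_on\<close> allows an unbounded derivative at the
  break points, and \<^const>\<open>integral\<close> is 0 where the speed is not integrable; convexity of the
  enclosed region rules this out.\<close>
lemma region_path_speed_integrable:
  fixes R :: "(real \<times> real) set"
  assumes R: "convex R" "bounded R"
    and \<gamma>: "simple_path \<gamma>" "path_image \<gamma> = frontier R" "\<gamma> piecewise_C1_differentiable_on {0..1}"
  shows "(\<lambda>t. vector_derivative \<gamma> (at t)) absolutely_integrable_on {0..1}"
    and "\<And>u v. 0 \<le> u \<Longrightarrow> u \<le> v \<Longrightarrow> v \<le> 1 \<Longrightarrow>
      ((\<lambda>t. vector_derivative \<gamma> (at t)) has_integral \<gamma> v - \<gamma> u) {u..v}"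
proof -
  let ?g = "\<lambda>t. vector_derivative \<gamma> (at t)"
  have cont: "continuous_on {0..1} \<gamma>" using \<gamma>(3) by (simp add: piecewise_C1_differentiable_on_def)
  obtain S where S: "finite S" "\<gamma> C1_differentiable_on ({0..1} - S)"
    using \<gamma>(3) by (auto simp: piecewise_C1_differentiable_on_def)
  have der: "(\<gamma> has_vector_derivative ?g t) (at t)" if "t \<in> {0..1} - S" for t
    using S(2) that by (metis C1_differentiable_on_eq vector_derivative_works)
  show ftc: "(?g has_integral \<gamma> v - \<gamma> u) {u..v}" if "0 \<le> u" "u \<le> v" "v \<le> 1" for u v
    by (rule fundamental_theorem_of_calculus_interior_strong[OF S(1)])
      (use that der in \<open>auto intro: continuous_on_subset[OF cont]\<close>)
  have "bounded (path_image \<gamma>)" unfolding \<gamma>(2) frontier_def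
    by (rule bounded_subset[OF bounded_closure[OF R(2)]]) auto
  then obtain B where B: "\<And>p. p \<in> path_image \<gamma> \<Longrightarrow> norm p \<le> B" by (auto simp: bounded_iff)
  have var: "(\<Sum>K\<in>d. \<bar>e \<bullet> \<gamma> (Sup K) - e \<bullet> \<gamma> (Inf K)\<bar>) \<le> 6 * B"
    if d: "d division_of {0..1}" and e: "norm e = 1" for d e
  proof -
    have "e \<noteq> 0" using e by auto
    then obtain F where F: "finite F"
      "\<And>y T. y \<notin> F \<Longrightarrow> T \<subseteq> {t \<in> {0..1}. e \<bullet> \<gamma> t = y} \<Longrightarrow> finite T \<Longrightarrow> card T \<le> 3"
      using simple_closed_path_line_card[OF R _ \<gamma>(1,2)] by metis
    have "\<bar>e \<bullet> \<gamma> t\<bar> \<le> B" if "t \<in> {0..1}" for t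
      using Cauchy_Schwarz_ineq2[of e "\<gamma> t"] e B[of "\<gamma> t"] that by (auto simp: path_image_def)
    then show ?thesis
      using F d by (intro variation_le_of_multiplicity[where F = F]) (auto intro!: continuous_intros cont)
  qed
  \<comment> \<open>An integrable function whose indefinite integral has bounded variation is
    absolutely integrable; here that integral is the path, and its variation is controlled by the
    two coordinates.\<close>
  have "?g absolutely_integrable_on cbox 0 1"
  proof (rule bounded_variation_absolutely_integrable_interval)
    show "?g integrable_on cbox 0 1" using ftc[of 0 1] by (auto simp: integrable_on_def)
    fix d :: "real set set" assume "d division_of cbox 0 1"
    then have d: "d division_of {0..1}" by simp
    have "(\<Sum>K\<in>d. norm (integral K ?g)) \<le>
      (\<Sum>K\<in>d. \<bar>(1, 0) \<bullet> \<gamma> (Sup K) - (1, 0) \<bullet> \<gamma> (Inf K)\<bar> + \<bar>(0, 1) \<bullet> \<gamma> (Sup K) - (0, 1) \<bullet> \<gamma> (Inf K)\<bar>)"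
    proof (rule sum_mono)
      fix K assume Kd: "K \<in> d"
      obtain u v where uv: "K = cbox u v" using division_ofD(4)[OF d Kd] by auto
      moreover have "K \<noteq> {}" "K \<subseteq> {0..1}" using division_ofD(2,3)[OF d Kd] by auto
      ultimately have uv': "u \<le> v" "0 \<le> u" "v \<le> 1" "Sup K = v" "Inf K = u" by auto
      have "integral K ?g = \<gamma> v - \<gamma> u" using ftc[OF uv'(2,1,3)] uv by (simp add: integral_unique)
      moreover have "norm (\<gamma> v - \<gamma> u) \<le> \<bar>fst (\<gamma> v - \<gamma> u)\<bar> + \<bar>snd (\<gamma> v - \<gamma> u)\<bar>"
        by (metis norm_Pair_le prod.collapse real_norm_def)
      ultimately show "norm (integral K ?g) \<le>
          \<bar>(1, 0) \<bullet> \<gamma> (Sup K) - (1, 0) \<bullet> \<gamma> (Inf K)\<bar> + \<bar>(0, 1) \<bullet> \<gamma> (Sup K) - (0, 1) \<bullet> \<gamma> (Inf K)\<bar>"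
        by (simp add: uv' inner_prod_def)
    qed
    also have "\<dots> \<le> 6 * B + 6 * B"
      unfolding sum.distrib using d by (intro add_mono var) (auto simp: norm_Pair)
    finally show "(\<Sum>K\<in>d. norm (integral K ?g)) \<le> 6 * B + 6 * B" .
  qed
  then show "?g absolutely_integrable_on {0..1}" by simp
qed

text \<open>The curve is cut into pieces of arc length at most \<open>r\<close>, and one point of
  each piece serves as a centre. Absolute integrability of the velocity makes
  \<open>path_length\<close> a genuine bound for chords.\<close>

lemma regions_frontier_cover:
  assumes "R \<in> regions M" "r > 0"
  shows "\<exists>C. finite C \<and> real (card C) \<le> M / r + 1 \<and> frontier R \<subseteq> (\<Union>c\<in>C. cball c r)"
proof -
  obtain \<gamma> where R: "convex R" "bounded R"
    and \<gamma>: "simple_path \<gamma>" "\<gamma> piecewise_C1_differentiable_on {0..1}"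
      "path_image \<gamma> = frontier R" "path_length \<gamma> \<le> M"
    using assms(1) unfolding regions_def by blast
  let ?g = "\<lambda>t. vector_derivative \<gamma> (at t)"
  note ai = region_path_speed_integrable(1)[OF R \<gamma>(1,3,2)]
  note ftc = region_path_speed_integrable(2)[OF R \<gamma>(1,3,2)]
  have ni: "(\<lambda>t. norm (?g t)) integrable_on {0..1}" using ai by (simp add: absolutely_integrable_on_def)
  define l where "l t = integral {0..t} (\<lambda>t. norm (?g t))" for t
  have sub: "(\<lambda>t. norm (?g t)) integrable_on {u..v}" if "0 \<le> u" "v \<le> 1" for u v
    using ni that by (auto intro: integrable_subinterval_real)
  have diff: "norm (\<gamma> v - \<gamma> u) \<le> l v - l u" if "0 \<le> u" "u \<le> v" "v \<le> 1" for u v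
  proof -
    have "l u + integral {u..v} (\<lambda>t. norm (?g t)) = l v"
      unfolding l_def using that sub[of 0 v] by (intro Henstock_Kurzweil_Integration.integral_combine) auto
    moreover have "norm (\<gamma> v - \<gamma> u) \<le> integral {u..v} (\<lambda>t. norm (?g t))"
      using ftc[OF that] sub[OF that(1,3)]
      by (metis (no_types, lifting) has_integral_integrable integral_norm_bound_integral integral_unique order_refl)
    ultimately show ?thesis by simp
  qed
  have l0: "l t \<ge> 0" for t unfolding l_def by (cases "(\<lambda>t. norm (?g t)) integrable_on {0..t}") (auto intro: integral_nonneg simp: not_integrable_integral)
  have lM: "l t \<le> M" if "t \<in> {0..1}" for t
    using order_trans[OF norm_ge_zero diff[of t 1]] that \<gamma>(4) unfolding path_length_def l_def[symmetric] by simp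
  have M0: "M \<ge> 0" using l0[of 0] lM[of 0] by simp
  define pick where "pick k = (SOME t. t \<in> {0..1} \<and> \<lfloor>l t / r\<rfloor> = k)" for k
  define C where "C = (\<lambda>k. \<gamma> (pick k)) ` {0..\<lfloor>M / r\<rfloor>}"
  have "frontier R \<subseteq> (\<Union>c\<in>C. cball c r)"
  proof
    fix p assume "p \<in> frontier R"
    then obtain t where t: "p = \<gamma> t" "t \<in> {0..1}" unfolding \<gamma>(3)[symmetric] path_image_def by (rule imageE)
    define k where "k = \<lfloor>l t / r\<rfloor>"
    have pk: "pick k \<in> {0..1} \<and> \<lfloor>l (pick k) / r\<rfloor> = k"
      unfolding pick_def by (rule someI[of _ t]) (use t k_def in simp)
    have "k \<in> {0..\<lfloor>M / r\<rfloor>}" using l0[of t] lM[OF t(2)] assms(2)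
      by (auto simp: k_def intro!: floor_mono divide_right_mono)
    moreover have "dist (\<gamma> (pick k)) p \<le> r"
    proof -
      have "\<bar>l t / r - l (pick k) / r\<bar> \<le> 1" using pk unfolding k_def by linarith
      then have "\<bar>(l t - l (pick k)) / r\<bar> \<le> 1" by (simp add: diff_divide_distrib)
      then have "\<bar>l t - l (pick k)\<bar> \<le> r" using assms(2) by (simp add: abs_divide divide_le_eq)
      moreover have "dist (\<gamma> (pick k)) p \<le> \<bar>l t - l (pick k)\<bar>"
      proof (cases "t \<le> pick k")
        case True
        then show ?thesis using diff[of t "pick k"] t pk by (auto simp: dist_norm)
      next
        case False
        then show ?thesis using diff[of "pick k" t] t pk by (auto simp: dist_norm norm_minus_commute)
      qed
      ultimately show ?thesis by simp
    qed
    ultimately show "p \<in> (\<Union>c\<in>C. cball c r)" by (auto simp: C_def)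
  qed
  moreover have "real (card C) \<le> M / r + 1"
  proof -
    have "card C \<le> card {0..\<lfloor>M / r\<rfloor>}" unfolding C_def by (rule card_image_le) simp
    also have "\<dots> = nat (\<lfloor>M / r\<rfloor> + 1)" by simp
    finally have "real (card C) \<le> real (nat (\<lfloor>M / r\<rfloor> + 1))" by simp
    also have "\<dots> = of_int \<lfloor>M / r\<rfloor> + 1" using M0 assms(2) by simp
    also have "\<dots> \<le> M / r + 1" by simp
    finally show ?thesis .
  qed
  ultimately show ?thesis by (intro exI[of _ C]) (auto simp: C_def)
qed

section \<open>Lattice points in regions\<close>

definition nsq :: "int \<times> int \<Rightarrow> int" where "nsq p = (fst p)\<^sup>2 + (snd p)\<^sup>2"

definition cross :: "int \<times> int \<Rightarrow> int \<times> int \<Rightarrow> int" where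
  "cross p q = fst p * snd q - snd p * fst q"

definition idot :: "int \<times> int \<Rightarrow> int \<times> int \<Rightarrow> int" where
  "idot p q = fst p * fst q + snd p * snd q"

definition lcomb :: "int \<Rightarrow> int \<times> int \<Rightarrow> int \<Rightarrow> int \<times> int \<Rightarrow> int \<times> int" where
  "lcomb m v n w = (m * fst v + n * fst w, m * snd v + n * snd w)"

text \<open>A subgroup of the integer plane. Full rank is expressed separately, by a modulus whose
  multiples all belong to the subgroup.\<close>

definition int_lattice :: "(int \<times> int) set \<Rightarrow> bool" where
  "int_lattice L \<longleftrightarrow> (0, 0) \<in> L \<and> (\<forall>p\<in>L. \<forall>q\<in>L. p - q \<in> L)"

lemma lattice_lcomb:
  assumes L: "int_lattice L" and "p \<in> L" "q \<in> L"
  shows "lcomb m p n q \<in> L"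
proof -
  have z: "0 \<in> L" and d: "\<And>p q. p \<in> L \<Longrightarrow> q \<in> L \<Longrightarrow> p - q \<in> L"
    using L by (auto simp: int_lattice_def zero_prod_def)
  have neg: "- p \<in> L" if "p \<in> L" for p using d[OF z that] by simp
  have add: "p + q \<in> L" if "p \<in> L" "q \<in> L" for p q using d[OF that(1) neg[OF that(2)]] by simp
  have nat: "(int k * fst p, int k * snd p) \<in> L" if p: "p \<in> L" for k p
  proof (induction k)
    case (Suc k)
    have "(int (Suc k) * fst p, int (Suc k) * snd p) = (int k * fst p, int k * snd p) + p"
      by (simp add: prod_eq_iff algebra_simps)
    then show ?case using add[OF Suc p] by simp
  qed (use z in \<open>simp add: zero_prod_def\<close>)
  have int: "(k * fst p, k * snd p) \<in> L" if p: "p \<in> L" for k p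
  proof (cases "k \<ge> 0")
    case True
    then show ?thesis using nat[OF p, of "nat k"] by simp
  next
    case False
    then show ?thesis using neg[OF nat[OF p, of "nat (- k)"]] by simp
  qed
  have "lcomb m p n q = (m * fst p, m * snd p) + (n * fst q, n * snd q)" by (simp add: lcomb_def)
  then show ?thesis using add[OF int[OF assms(2)] int[OF assms(3)], of m n] by simp
qed

lemma cross_lcomb: "cross v (lcomb m u n w) = m * cross v u + n * cross v w"
  by (simp add: cross_def lcomb_def algebra_simps)

lemma idot_lcomb: "idot v (lcomb m u n w) = m * idot v u + n * idot v w"
  by (simp add: idot_def lcomb_def algebra_simps)

lemma lagrange_identity: "nsq v * nsq w = (idot v w)\<^sup>2 + (cross v w)\<^sup>2"
  by (simp add: nsq_def idot_def cross_def power2_eq_square algebra_simps)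

lemma nsq_nonneg: "nsq p \<ge> 0"
  by (simp add: nsq_def)

lemma nsq_pos: "p \<noteq> (0, 0) \<Longrightarrow> nsq p > 0"
  by (cases p) (auto simp: nsq_def sum_power2_gt_zero_iff)

text \<open>Lagrange reduction: \<open>v\<close> is a shortest vector and \<open>w\<close> completes it with the smallest possible
  determinant and the smallest component along \<open>v\<close>.\<close>
lemma reduced_basis:
  assumes L: "int_lattice L" and e: "e > 0" "\<And>x y. e dvd x \<Longrightarrow> e dvd y \<Longrightarrow> (x, y) \<in> L"
  shows "\<exists>v w. v \<in> L \<and> w \<in> L \<and> cross v w \<noteq> 0 \<and> nsq v \<le> nsq w \<and> 2 * \<bar>idot v w\<bar> \<le> nsq v \<and>
    (\<forall>u\<in>L. \<exists>m n. u = lcomb m v n w)"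
proof -
  have e1: "(e, 0) \<in> L" and e2: "(0, e) \<in> L" using e(2) by auto
  obtain v where v: "v \<in> L" "v \<noteq> (0, 0)" and vmin: "\<And>u. u \<in> L \<Longrightarrow> u \<noteq> (0, 0) \<Longrightarrow> nat (nsq v) \<le> nat (nsq u)"
    using ex_has_least_nat[of "\<lambda>u. u \<in> L \<and> u \<noteq> (0, 0)" "(e, 0)" "\<lambda>u. nat (nsq u)"] e1 e(1) by auto
  have vmin': "nsq v \<le> nsq u" if "u \<in> L" "u \<noteq> (0, 0)" for u
    using vmin[OF that] nsq_nonneg[of u] nsq_nonneg[of v] by simp
  have vpos: "nsq v > 0" using v nsq_pos by simp
  have "\<exists>u. u \<in> L \<and> cross v u \<noteq> 0"
  proof (cases "snd v = 0")
    case True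
    then have "fst v \<noteq> 0" using v by (cases v) auto
    then show ?thesis using e2 e(1) by (intro exI[of _ "(0, e)"]) (auto simp: cross_def)
  next
    case False
    then show ?thesis using e1 e(1) by (intro exI[of _ "(e, 0)"]) (auto simp: cross_def)
  qed
  then obtain w0 where w0: "w0 \<in> L" "cross v w0 \<noteq> 0"
    and wmin: "\<And>u. u \<in> L \<Longrightarrow> cross v u \<noteq> 0 \<Longrightarrow> nat \<bar>cross v w0\<bar> \<le> nat \<bar>cross v u\<bar>"
    using ex_has_least_nat[of "\<lambda>u. u \<in> L \<and> cross v u \<noteq> 0" _ "\<lambda>u. nat \<bar>cross v u\<bar>"] by metis
  \<comment> \<open>\<open>idot v w0 / nsq v\<close> rounded to the nearest integer, so that the
    component of \<open>w\<close> along \<open>v\<close> is at most half of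
    \<open>v\<close>.\<close>
  define k where "k = (2 * idot v w0 + nsq v) div (2 * nsq v)"
  define w where "w = lcomb (- k) v 1 w0"
  have wL: "w \<in> L" unfolding w_def using lattice_lcomb[OF L v(1) w0(1)] .
  have cvv: "cross v v = 0" and ivv: "idot v v = nsq v"
    by (simp_all add: cross_def idot_def nsq_def power2_eq_square)
  have cw: "cross v w = cross v w0" by (simp add: w_def cross_lcomb cvv)
  have iw: "idot v w = idot v w0 - k * nsq v" by (simp add: w_def idot_lcomb ivv)
  have "2 * idot v w + nsq v = (2 * idot v w0 + nsq v) mod (2 * nsq v)"
    unfolding iw k_def by (simp add: minus_div_mult_eq_mod[symmetric] algebra_simps)
  then have "0 \<le> 2 * idot v w + nsq v" "2 * idot v w + nsq v < 2 * nsq v" using vpos by simp_all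
  then have iw2: "2 * \<bar>idot v w\<bar> \<le> nsq v" by linarith
  have "w \<noteq> (0, 0)" using cw w0(2) by (auto simp: cross_def)
  then have "nsq v \<le> nsq w" using vmin' wL by simp
  moreover have "\<exists>m n. u = lcomb m v n w" if u: "u \<in> L" for u
  proof -
    \<comment> \<open>Two divisions with remainder. The remainder of \<open>cross\<close> is smaller
      than the minimal nonzero value, so \<open>u1\<close> is parallel to \<open>v\<close>; the
      remainder along \<open>v\<close> is then shorter than \<open>v\<close>, hence zero.\<close>
    define n where "n = cross v u div cross v w"
    define u1 where "u1 = lcomb 1 u (- n) w"
    have u1L: "u1 \<in> L" unfolding u1_def using lattice_lcomb[OF L u wL] .
    have cu1: "cross v u1 = cross v u mod cross v w"
      by (simp add: u1_def cross_lcomb n_def minus_div_mult_eq_mod[symmetric])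
    have "\<bar>cross v u1\<bar> < \<bar>cross v w0\<bar>"
      unfolding cu1 cw using w0(2) by (simp add: abs_mod_less)
    then have c0: "cross v u1 = 0" using wmin[OF u1L] by (cases "cross v u1 = 0") auto
    define m where "m = idot v u1 div nsq v"
    define u2 where "u2 = lcomb 1 u1 (- m) v"
    have u2L: "u2 \<in> L" unfolding u2_def using lattice_lcomb[OF L u1L v(1)] .
    have c2: "cross v u2 = 0" by (simp add: u2_def cross_lcomb c0 cvv)
    have "idot v u2 = idot v u1 mod nsq v"
      by (simp add: u2_def idot_lcomb ivv m_def minus_div_mult_eq_mod[symmetric])
    then have i2: "0 \<le> idot v u2" "idot v u2 < nsq v" using vpos by simp_all
    have "u2 = (0, 0)"
    proof (rule ccontr)
      assume "u2 \<noteq> (0, 0)"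
      then have "nsq v \<le> nsq u2" using vmin' u2L by simp
      then have "nsq v * nsq v \<le> nsq v * nsq u2" using vpos by simp
      also have "\<dots> = idot v u2 * idot v u2" using lagrange_identity[of v u2] c2 by (simp add: power2_eq_square)
      also have "\<dots> < nsq v * nsq v" using i2 by (intro mult_strict_mono') auto
      finally show False by simp
    qed
    then have "u = lcomb m v n w"
      by (auto simp: u2_def u1_def lcomb_def prod_eq_iff)
    then show ?thesis by blast
  qed
  ultimately show ?thesis using v(1) wL cw w0(2) iw2
    by (intro exI[of _ v] exI[of _ w] conjI ballI) simp_all
qed

section \<open>Counting points by the cells of a reduced basis\<close>

locale lattice_basis =
  fixes v w :: "int \<times> int"
  assumes cross_nonzero: "cross v w \<noteq> 0"
    and nsq_le: "nsq v \<le> nsq w"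
    and idot_le: "2 * \<bar>idot v w\<bar> \<le> nsq v"
begin

abbreviation v1 :: real where "v1 \<equiv> real_of_int (fst v)"
abbreviation v2 :: real where "v2 \<equiv> real_of_int (snd v)"
abbreviation w1 :: real where "w1 \<equiv> real_of_int (fst w)"
abbreviation w2 :: real where "w2 \<equiv> real_of_int (snd w)"

text \<open>With \<open>tc\<close>: the coordinates in the basis \<open>v\<close>, \<open>w\<close>,
  by Cramer's rule; \<open>rcomb\<close> is the inverse map.\<close>

definition sc :: "real \<times> real \<Rightarrow> real" where
  "sc p = (fst p * w2 - snd p * w1) / cross v w"

definition tc :: "real \<times> real \<Rightarrow> real" where
  "tc p = (v1 * snd p - v2 * fst p) / cross v w"

definition vlen :: real where "vlen = sqrt (nsq v)"

definition rcomb :: "real \<Rightarrow> real \<Rightarrow> real \<times> real" where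
  "rcomb s t = (s * v1 + t * w1, s * v2 + t * w2)"

lemma linear_sc: "linear sc"
  by (rule linearI) (simp_all add: sc_def algebra_simps add_divide_distrib diff_divide_distrib)

lemma linear_tc: "linear tc"
  by (rule linearI) (simp_all add: tc_def algebra_simps add_divide_distrib diff_divide_distrib)

lemma cross_real: "real_of_int (cross v w) = v1 * w2 - v2 * w1"
  by (simp add: cross_def)

lemma sc_rcomb [simp]: "sc (rcomb s t) = s"
proof -
  have "(s * v1 + t * w1) * w2 - (s * v2 + t * w2) * w1 = s * real_of_int (cross v w)"
    unfolding cross_real by (simp add: algebra_simps)
  then show ?thesis using cross_nonzero by (simp add: sc_def rcomb_def)
qed

lemma tc_rcomb [simp]: "tc (rcomb s t) = t"
proof -
  have "v1 * (s * v2 + t * w2) - v2 * (s * v1 + t * w1) = t * real_of_int (cross v w)"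
    unfolding cross_real by (simp add: algebra_simps)
  then show ?thesis using cross_nonzero by (simp add: tc_def rcomb_def)
qed

lemma rcomb_coords: "rcomb (sc p) (tc p) = p"
proof -
  obtain x y where p: "p = (x, y)" by (cases p)
  have "(x * w2 - y * w1) * v1 + (v1 * y - v2 * x) * w1 = x * real_of_int (cross v w)"
    "(x * w2 - y * w1) * v2 + (v1 * y - v2 * x) * w2 = y * real_of_int (cross v w)"
    unfolding cross_real by (simp_all add: algebra_simps)
  then show ?thesis using cross_nonzero
    by (simp add: rcomb_def sc_def tc_def p add_divide_distrib[symmetric])
qed

lemma nsq_v_pos: "nsq v > 0"
  using cross_nonzero by (intro nsq_pos) (auto simp: cross_def)

lemma vlen_pos: "vlen > 0"
  using nsq_v_pos by (simp add: vlen_def)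

lemma coord_bound_aux:
  fixes x y :: real
  assumes "u = v \<or> u = w"
  shows "\<bar>x * snd u - y * fst u\<bar> / \<bar>real_of_int (cross v w)\<bar> \<le> 2 * norm (x, y) / vlen"
proof -
  have cs: "(x * snd u - y * fst u)\<^sup>2 \<le> (x\<^sup>2 + y\<^sup>2) * nsq u"
  proof -
    have "(x\<^sup>2 + y\<^sup>2) * nsq u = (x * snd u - y * fst u)\<^sup>2 + (x * fst u + y * snd u)\<^sup>2"
      by (simp add: nsq_def power2_eq_square algebra_simps)
    then show ?thesis by simp
  qed
  have uw: "nsq u \<le> nsq w" using assms nsq_le by auto
  have "4 * (cross v w)\<^sup>2 = 4 * (nsq v * nsq w) - (2 * \<bar>idot v w\<bar>)\<^sup>2"
    using lagrange_identity[of v w] by simp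
  moreover have "(2 * \<bar>idot v w\<bar>)\<^sup>2 \<le> (nsq v)\<^sup>2" using idot_le by (intro power_mono) auto
  moreover have "(nsq v)\<^sup>2 \<le> nsq v * nsq w" using nsq_le nsq_v_pos by (simp add: power2_eq_square)
  ultimately have "3 * (nsq v * nsq w) \<le> 4 * (cross v w)\<^sup>2" by linarith
  moreover have "0 \<le> nsq v * nsq w" using nsq_nonneg by (intro mult_nonneg_nonneg) auto
  ultimately have "nsq v * nsq w \<le> 4 * (cross v w)\<^sup>2" by linarith
  then have cr: "real_of_int (nsq v) * real_of_int (nsq w) \<le> 4 * (real_of_int (cross v w))\<^sup>2"
    by (metis (mono_tags) of_int_le_iff of_int_mult of_int_numeral of_int_power)
  have "(\<bar>x * snd u - y * fst u\<bar> * vlen)\<^sup>2 = (x * snd u - y * fst u)\<^sup>2 * nsq v"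
    using nsq_v_pos by (simp add: power_mult_distrib vlen_def)
  also have "\<dots> \<le> (x\<^sup>2 + y\<^sup>2) * nsq u * nsq v" using cs nsq_v_pos by (intro mult_right_mono) auto
  also have "\<dots> \<le> (x\<^sup>2 + y\<^sup>2) * nsq w * nsq v" using uw nsq_v_pos by (intro mult_right_mono mult_left_mono) auto
  also have "\<dots> \<le> (x\<^sup>2 + y\<^sup>2) * (4 * (real_of_int (cross v w))\<^sup>2)"
    unfolding mult.assoc using cr by (intro mult_left_mono) (simp_all add: mult.commute)
  also have "\<dots> = (2 * norm (x, y) * \<bar>real_of_int (cross v w)\<bar>)\<^sup>2"
    by (simp add: power_mult_distrib norm_Pair)
  finally have "\<bar>x * snd u - y * fst u\<bar> * vlen \<le> 2 * norm (x, y) * \<bar>real_of_int (cross v w)\<bar>"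
    by (rule power2_le_imp_le) simp
  then show ?thesis using vlen_pos cross_nonzero by (simp add: field_simps)
qed

lemma sc_bound: "\<bar>sc p\<bar> \<le> 2 * norm p / vlen"
  using coord_bound_aux[of w "fst p" "snd p"] by (simp add: sc_def)

lemma tc_bound: "\<bar>tc p\<bar> \<le> 2 * norm p / vlen"
  using coord_bound_aux[of v "fst p" "snd p"]
  by (simp add: tc_def abs_minus_commute mult.commute)

text \<open>Half-open parallelograms, so that the cells partition the plane and each contains
  exactly one node.\<close>

definition cell :: "real \<times> real \<Rightarrow> int \<times> int \<Rightarrow> (real \<times> real) set" where
  "cell c k = {p. \<lfloor>sc (p - c)\<rfloor> = fst k \<and> \<lfloor>tc (p - c)\<rfloor> = snd k}"

definition node :: "real \<times> real \<Rightarrow> int \<times> int \<Rightarrow> real \<times> real" where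
  "node c k = c + rcomb (fst k) (snd k)"

lemma node_in_cell: "node c k \<in> cell c k"
  by (simp add: node_def cell_def)

lemma cell_translate: "cell c k = (+) (node c k) ` cell 0 0"
proof (intro equalityI subsetI)
  fix p assume p: "p \<in> cell c k"
  have "sc (p - node c k) = sc (p - c) - fst k" "tc (p - node c k) = tc (p - c) - snd k"
    using linear_diff[OF linear_sc, of "p - c" "rcomb (fst k) (snd k)"]
      linear_diff[OF linear_tc, of "p - c" "rcomb (fst k) (snd k)"]
    by (simp_all add: node_def diff_diff_eq)
  then have "p - node c k \<in> cell 0 0" using p by (simp add: cell_def)
  then show "p \<in> (+) (node c k) ` cell 0 0" by (intro image_eqI[of _ _ "p - node c k"]) auto
next
  fix p assume "p \<in> (+) (node c k) ` cell 0 0"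
  then obtain q where q: "q \<in> cell 0 0" "p = node c k + q" by blast
  have "p - c = rcomb (fst k) (snd k) + q" using q by (simp add: node_def)
  then have "sc (p - c) = of_int (fst k) + sc q" "tc (p - c) = of_int (snd k) + tc q"
    using linear_add[OF linear_sc] linear_add[OF linear_tc] by simp_all
  then show "p \<in> cell c k" using q by (simp add: cell_def)
qed

lemma convex_cell: "convex (cell c k)"
proof -
  have aff: "f ((1 - a) *\<^sub>R p + a *\<^sub>R q - c) = (1 - a) * f (p - c) + a * f (q - c)"
    if "linear f" for f :: "real \<times> real \<Rightarrow> real" and a p q
  proof -
    have "(1 - a) *\<^sub>R p + a *\<^sub>R q - c = (1 - a) *\<^sub>R (p - c) + a *\<^sub>R (q - c)"
      by (simp add: algebra_simps)
    then show ?thesis using that by (simp add: linear_add linear_scale)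
  qed
  have fl: "\<lfloor>(1 - a) * x + a * y\<rfloor> = m" if "\<lfloor>x\<rfloor> = m" "\<lfloor>y\<rfloor> = m" "0 \<le> a" "a \<le> 1" for a x y :: real and m
  proof -
    have "x \<in> {of_int m..<of_int m + 1}" "y \<in> {of_int m..<of_int m + 1}" using that by (auto simp: floor_eq_iff)
    moreover have "convex {of_int m..<of_int m + (1::real)}" by (rule convex_real_interval)
    ultimately have "(1 - a) *\<^sub>R x + a *\<^sub>R y \<in> {of_int m..<of_int m + 1}"
      using that(3,4) by (intro convexD_alt) auto
    then show ?thesis by (simp add: floor_eq_iff)
  qed
  show ?thesis
    unfolding convex_alt cell_def using fl by (auto simp: aff[OF linear_sc] aff[OF linear_tc])
qed

lemma bounded_cell: "bounded (cell c k)"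
proof -
  have "bounded (cell 0 0)"
  proof (rule boundedI)
    fix p assume p: "p \<in> cell 0 0"
    have "\<bar>sc p\<bar> \<le> 1" "\<bar>tc p\<bar> \<le> 1" using p by (auto simp: cell_def floor_eq_iff)
    then have st: "\<bar>sc p * x\<bar> \<le> \<bar>x\<bar>" "\<bar>tc p * x\<bar> \<le> \<bar>x\<bar>" for x by (auto simp: abs_mult mult_left_le_one_le)
    have "norm p \<le> \<bar>fst p\<bar> + \<bar>snd p\<bar>" by (metis norm_Pair_le prod.collapse real_norm_def)
    moreover have "\<bar>fst p\<bar> \<le> \<bar>v1\<bar> + \<bar>w1\<bar>"
      using st(1)[of "v1"] st(2)[of "w1"] arg_cong[OF rcomb_coords[of p], of fst]
      unfolding rcomb_def fst_conv by linarith
    moreover have "\<bar>snd p\<bar> \<le> \<bar>v2\<bar> + \<bar>w2\<bar>"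
      using st(1)[of "v2"] st(2)[of "w2"] arg_cong[OF rcomb_coords[of p], of snd]
      unfolding rcomb_def snd_conv by linarith
    ultimately show "norm p \<le> \<bar>v1\<bar> + \<bar>w1\<bar> + \<bar>v2\<bar> + \<bar>w2\<bar>" by simp
  qed
  then show ?thesis unfolding cell_translate[of c k] by (rule bounded_translation)
qed

definition covol :: real where "covol = measure lebesgue (cell 0 0)"

lemma cell_lmeasurable: "cell c k \<in> lmeasurable"
  by (intro measurable_convex convex_cell bounded_cell)

lemma measure_cell: "measure lebesgue (cell c k) = covol"
  unfolding covol_def cell_translate[of c k] by (simp add: measure_translation)

lemma cell_disjoint: "k \<noteq> k' \<Longrightarrow> cell c k \<inter> cell c k' = {}"
  by (auto simp: cell_def prod_eq_iff)

text \<open>On the ball each coordinate varies over an interval of length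
  \<open>4 * r / vlen\<close>, which has at most that many integer parts plus two. The choice
  \<open>r = vlen\<close> gives \<open>6\<^sup>2 = 36\<close>, the constant of the later
  estimates.\<close>

lemma cells_meeting_ball:
  assumes "r \<ge> 0"
  shows "finite {k. cell c k \<inter> cball q r \<noteq> {}}"
    and "real (card {k. cell c k \<inter> cball q r \<noteq> {}}) \<le> (4 * r / vlen + 2)\<^sup>2"
proof -
  define \<rho> where "\<rho> = 2 * r / vlen"
  have rho: "\<rho> \<ge> 0" using assms vlen_pos by (simp add: \<rho>_def)
  define J where "J f = {\<lfloor>f (q - c) - \<rho>\<rfloor>..\<lfloor>f (q - c) + \<rho>\<rfloor>}" for f :: "real \<times> real \<Rightarrow> real"
  have mem: "\<lfloor>f (p - c)\<rfloor> \<in> J f" if "linear f" "\<And>p. \<bar>f p\<bar> \<le> 2 * norm p / vlen" "p \<in> cball q r" for f p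
  proof -
    have "f (p - c) - f (q - c) = f (p - q)" using linear_diff[OF that(1), of "p - c" "q - c"] by simp
    moreover have "\<bar>f (p - q)\<bar> \<le> \<rho>"
    proof -
      have "2 * norm (p - q) / vlen \<le> \<rho>" unfolding \<rho>_def using that(3) vlen_pos
        by (intro divide_right_mono) (auto simp: dist_norm norm_minus_commute)
      then show ?thesis using that(2)[of "p - q"] by linarith
    qed
    ultimately have "f (q - c) - \<rho> \<le> f (p - c)" "f (p - c) \<le> f (q - c) + \<rho>" by linarith+
    then show ?thesis by (auto simp: J_def intro: floor_mono)
  qed
  have sub: "{k. cell c k \<inter> cball q r \<noteq> {}} \<subseteq> J sc \<times> J tc"
  proof
    fix k assume "k \<in> {k. cell c k \<inter> cball q r \<noteq> {}}"
    then obtain p where p: "p \<in> cell c k" "p \<in> cball q r" by blast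
    show "k \<in> J sc \<times> J tc"
      using mem[OF linear_sc sc_bound p(2)] mem[OF linear_tc tc_bound p(2)] p(1)
      by (cases k) (auto simp: cell_def)
  qed
  have fin: "finite (J sc \<times> J tc)" by (simp add: J_def)
  show "finite {k. cell c k \<inter> cball q r \<noteq> {}}" using sub fin by (rule finite_subset)
  have cJ: "real (card (J f)) \<le> 2 * \<rho> + 2" for f
  proof -
    have "\<lfloor>f (q - c) - \<rho>\<rfloor> \<le> \<lfloor>f (q - c) + \<rho>\<rfloor>" using rho by (intro floor_mono) auto
    then show ?thesis unfolding J_def by (simp add: of_nat_nat) linarith
  qed
  have "card {k. cell c k \<inter> cball q r \<noteq> {}} \<le> card (J sc \<times> J tc)"
    using sub fin by (rule card_mono[rotated])
  then have "real (card {k. cell c k \<inter> cball q r \<noteq> {}}) \<le> real (card (J sc)) * real (card (J tc))"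
    by (simp only: card_cartesian_product of_nat_mult[symmetric] of_nat_le_iff)
  also have "\<dots> \<le> (2 * \<rho> + 2) * (2 * \<rho> + 2)" using cJ rho by (intro mult_mono) auto
  also have "\<dots> = (4 * r / vlen + 2)\<^sup>2" by (simp add: power2_eq_square \<rho>_def)
  finally show "real (card {k. cell c k \<inter> cball q r \<noteq> {}}) \<le> (4 * r / vlen + 2)\<^sup>2" .
qed

text \<open>Both the node count and the area divided by \<open>covol\<close> lie between the number
  of cells inside \<open>R\<close> and the number of cells meeting \<open>R\<close>. The cells in
  between are connected and neither inside nor outside \<open>R\<close>, hence they meet the
  frontier and one of the covering balls.\<close>

lemma node_count:
  assumes R: "R \<in> lmeasurable" "bounded R" and C: "finite C" "frontier R \<subseteq> (\<Union>q\<in>C. cball q r)" and r: "r \<ge> 0"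
  shows "finite {k. node c k \<in> R}"
    "\<bar>real (card {k. node c k \<in> R}) * covol - measure lebesgue R\<bar> \<le> covol * (real (card C) * (4 * r / vlen + 2)\<^sup>2)"
proof -
  define B where "B = {k. cell c k \<inter> R \<noteq> {}}"
  define A where "A = {k. cell c k \<subseteq> R}"
  define N where "N = {k. node c k \<in> R}"
  define E where "E q = {k. cell c k \<inter> cball q r \<noteq> {}}" for q
  obtain b where b: "R \<subseteq> cball 0 b" "b \<ge> 0"
    using bounded_subset_cbox_symmetric[OF R(2)] R(2) by (metis bounded_pos mem_cball_0 less_imp_le subsetI)
  have "B \<subseteq> {k. cell c k \<inter> cball 0 b \<noteq> {}}" using b by (auto simp: B_def)
  then have finB: "finite B" using cells_meeting_ball(1)[OF b(2)] finite_subset by blast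
  have AN: "A \<subseteq> N" and NB: "N \<subseteq> B" unfolding A_def N_def B_def using node_in_cell by blast+
  show "finite {k. node c k \<in> R}" using NB finB finite_subset unfolding N_def by blast
  have finN: "finite N" using NB finB by (rule finite_subset)
  have finA: "finite A" using AN finN by (rule finite_subset)
  have BA: "B - A \<subseteq> (\<Union>q\<in>C. E q)"
  proof
    fix k assume k: "k \<in> B - A"
    then have "cell c k \<inter> frontier R \<noteq> {}"
      by (intro connected_Int_frontier convex_connected convex_cell) (auto simp: A_def B_def)
    then show "k \<in> (\<Union>q\<in>C. E q)" using C(2) unfolding E_def by blast
  qed
  have "card (B - A) \<le> card (\<Union>q\<in>C. E q)"
    using BA C(1) cells_meeting_ball(1)[OF r] by (intro card_mono) (auto simp: E_def)
  also have "\<dots> \<le> (\<Sum>q\<in>C. card (E q))" using C(1) by (rule card_UN_le)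
  finally have "real (card (B - A)) \<le> (\<Sum>q\<in>C. real (card (E q)))"
    by (metis of_nat_le_iff of_nat_sum)
  also have "\<dots> \<le> (\<Sum>q\<in>C. (4 * r / vlen + 2)\<^sup>2)"
    unfolding E_def by (intro sum_mono cells_meeting_ball(2) r)
  finally have BAc: "real (card (B - A)) \<le> real (card C) * (4 * r / vlen + 2)\<^sup>2" by simp
  have cov0: "covol \<ge> 0" by (simp add: covol_def)
  have U: "measure lebesgue (\<Union>k\<in>S. cell c k) = real (card S) * covol" "(\<Union>k\<in>S. cell c k) \<in> lmeasurable" if "finite S" for S
  proof -
    have "emeasure lebesgue (cell c k) \<noteq> \<infinity>" for k
      using fmeasurableD2[OF cell_lmeasurable[of c k]] by (simp add: infinity_ennreal_def)
    then have "measure lebesgue (\<Union>k\<in>S. cell c k) = (\<Sum>k\<in>S. measure lebesgue (cell c k))"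
      using that cell_lmeasurable
      by (intro measure_finite_Union)
        (simp_all only: disjoint_family_on_def cell_disjoint image_subset_iff fmeasurableD ball_simps
          simp_thms not_False_eq_True, simp_all add: fmeasurableD cell_disjoint)
    then show "measure lebesgue (\<Union>k\<in>S. cell c k) = real (card S) * covol" by (simp add: measure_cell)
    show "(\<Union>k\<in>S. cell c k) \<in> lmeasurable" using that cell_lmeasurable by (intro fmeasurable.finite_UN) auto
  qed
  have "(\<Union>k\<in>A. cell c k) \<subseteq> R" by (auto simp: A_def)
  then have lo: "real (card A) * covol \<le> measure lebesgue R"
    using measure_mono_fmeasurable[of "\<Union>k\<in>A. cell c k" R lebesgue] U[OF finA] R(1) by (auto simp: fmeasurableD)
  have "R \<subseteq> (\<Union>k\<in>B. cell c k)"
  proof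
    fix p assume "p \<in> R"
    moreover have "p \<in> cell c (\<lfloor>sc (p - c)\<rfloor>, \<lfloor>tc (p - c)\<rfloor>)" by (simp add: cell_def)
    ultimately show "p \<in> (\<Union>k\<in>B. cell c k)" unfolding B_def by blast
  qed
  then have hi: "measure lebesgue R \<le> real (card B) * covol"
    using measure_mono_fmeasurable[of R "\<Union>k\<in>B. cell c k" lebesgue] U[OF finB] R(1) by (auto simp: fmeasurableD)
  have cards: "card A \<le> card N" "card N \<le> card B" using AN NB finN finB by (auto intro: card_mono)
  have "card B = card A + card (B - A)"
    using card_Diff_subset[OF finA order_trans[OF AN NB]] card_mono[OF finB order_trans[OF AN NB]] by simp
  then have Beq: "real (card B) = real (card A) + real (card (B - A))" by simp
  have "real (card A) * covol \<le> real (card N) * covol" "real (card N) * covol \<le> real (card B) * covol"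
    using cards cov0 by (auto intro: mult_right_mono)
  moreover have "real (card B) * covol - real (card A) * covol \<le> covol * (real (card C) * (4 * r / vlen + 2)\<^sup>2)"
  proof -
    have "real (card B) * covol - real (card A) * covol = covol * real (card (B - A))"
      by (simp add: Beq algebra_simps)
    then show ?thesis using mult_left_mono[OF BAc cov0] by simp
  qed
  ultimately have "\<bar>real (card N) * covol - measure lebesgue R\<bar> \<le> covol * (real (card C) * (4 * r / vlen + 2)\<^sup>2)"
    using lo hi by linarith
  then show "\<bar>real (card {k. node c k \<in> R}) * covol - measure lebesgue R\<bar> \<le> covol * (real (card C) * (4 * r / vlen + 2)\<^sup>2)"
    by (simp add: N_def)
qed

lemma lattice_points_eq_nodes:
  assumes "int_lattice L" "v \<in> L" "w \<in> L" "\<forall>u\<in>L. \<exists>m n. u = lcomb m v n w"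
  shows "card {p. p - z \<in> L \<and> to_real2 p \<in> R} = card {k. node (to_real2 z) k \<in> R}"
    "finite {k. node (to_real2 z) k \<in> R} \<Longrightarrow> finite {p. p - z \<in> L \<and> to_real2 p \<in> R}"
proof -
  have node: "node (to_real2 z) k = to_real2 (z + lcomb (fst k) v (snd k) w)" for k
    by (simp add: node_def to_real2_def rcomb_def lcomb_def)
  have inj: "inj (\<lambda>k. node c k)" for c
    by (rule injI) (metis cell_disjoint disjoint_iff node_in_cell)
  have bij: "bij_betw (\<lambda>k. z + lcomb (fst k) v (snd k) w) {k. node (to_real2 z) k \<in> R} {p. p - z \<in> L \<and> to_real2 p \<in> R}"
    unfolding bij_betw_def
  proof
    show "inj_on (\<lambda>k. z + lcomb (fst k) v (snd k) w) {k. node (to_real2 z) k \<in> R}"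
    proof (rule inj_onI)
      fix k l assume "z + lcomb (fst k) v (snd k) w = z + lcomb (fst l) v (snd l) w"
      then have "node (to_real2 z) k = node (to_real2 z) l" by (simp only: node)
      then show "k = l" by (rule injD[OF inj])
    qed
    show "(\<lambda>k. z + lcomb (fst k) v (snd k) w) ` {k. node (to_real2 z) k \<in> R} = {p. p - z \<in> L \<and> to_real2 p \<in> R}"
    proof (intro equalityI subsetI)
      fix p assume "p \<in> (\<lambda>k. z + lcomb (fst k) v (snd k) w) ` {k. node (to_real2 z) k \<in> R}"
      then show "p \<in> {p. p - z \<in> L \<and> to_real2 p \<in> R}"
        using lattice_lcomb[OF assms(1-3)] by (auto simp: node)
    next
      fix p assume p: "p \<in> {p. p - z \<in> L \<and> to_real2 p \<in> R}"
      then obtain m n where "p - z = lcomb m v n w" using assms(4) by blast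
      then have "p = z + lcomb m v n w" by (metis add.commute diff_add_cancel)
      then show "p \<in> (\<lambda>k. z + lcomb (fst k) v (snd k) w) ` {k. node (to_real2 z) k \<in> R}"
        using p by (intro image_eqI[of _ _ "(m, n)"]) (auto simp: node)
    qed
  qed
  show "card {p. p - z \<in> L \<and> to_real2 p \<in> R} = card {k. node (to_real2 z) k \<in> R}"
    using bij_betw_same_card[OF bij] by simp
  show "finite {k. node (to_real2 z) k \<in> R} \<Longrightarrow> finite {p. p - z \<in> L \<and> to_real2 p \<in> R}"
    using bij_betw_finite[OF bij] by simp
qed

end

section \<open>Lattice density from large squares\<close>

definition box_points :: "int \<Rightarrow> (int \<times> int) set" where
  "box_points e = {0..<e} \<times> {0..<e}"

lemma linear_bound_square_imp_zero:
  fixes x K :: real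
  assumes "\<And>N::nat. N \<ge> 1 \<Longrightarrow> (real N)\<^sup>2 * \<bar>x\<bar> \<le> K * (real N + 2)"
  shows "x = 0"
proof (rule ccontr)
  assume "x \<noteq> 0"
  have "K * 3 \<ge> \<bar>x\<bar>" using assms[of 1] by simp
  then have K0: "K \<ge> 0" by linarith
  obtain N :: nat where N: "3 * K / \<bar>x\<bar> < real N" using reals_Archimedean2 by blast
  moreover have "3 * K / \<bar>x\<bar> \<ge> 0" using K0 by simp
  ultimately have N1: "N \<ge> 1" using less_le_trans by (metis One_nat_def Suc_leI not_gr_zero of_nat_0 not_less)
  have "3 * K < real N * \<bar>x\<bar>" using N \<open>x \<noteq> 0\<close> by (simp add: divide_less_eq)
  then have "real N * (3 * K) < real N * (real N * \<bar>x\<bar>)" using N1 by simp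
  also have "\<dots> \<le> K * (real N + 2)" using assms[OF N1] by (simp add: power2_eq_square mult.assoc)
  also have "\<dots> \<le> K * (3 * real N)" using K0 N1 by (intro mult_left_mono) auto
  finally show False by simp
qed

text \<open>The shift by one half makes the closed square of area \<open>s\<^sup>2\<close> contain
  precisely the integer points of the half-open box, for integral \<open>s\<close>.\<close>

definition rbox :: "real \<Rightarrow> (real \<times> real) set" where
  "rbox s = cbox (-1/2, -1/2) (s - 1/2, s - 1/2)"

lemma rbox_eq: "rbox s = {-1/2..s - 1/2} \<times> {-1/2..s - 1/2}"
  by (simp add: rbox_def cbox_Pair_eq)

lemma to_real2_rbox: "to_real2 p \<in> rbox (of_int s) \<longleftrightarrow> p \<in> box_points s"
proof -
  have "-1/2 \<le> real_of_int x \<and> real_of_int x \<le> real_of_int s - 1/2 \<longleftrightarrow> 0 \<le> x \<and> x < s" for x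
    by linarith
  then show ?thesis by (cases p) (simp add: to_real2_def rbox_eq box_points_def)
qed

lemma measure_rbox: "s \<ge> 0 \<Longrightarrow> measure lebesgue (rbox s) = s\<^sup>2"
  by (simp add: rbox_def content_Pair power2_eq_square)

lemma rbox_frontier_cover:
  assumes "e \<ge> (1::nat)" "N \<ge> (1::nat)"
  shows "\<exists>C. finite C \<and> card C \<le> 4 * (N + 2) \<and>
    frontier (rbox (real N * real e)) \<subseteq> (\<Union>c\<in>C. cball c (real e))"
proof -
  let ?s = "real N * real e - 1/2"
  \<comment> \<open>The sides start at \<open>-1/2\<close>, whose integer part on the scale
    \<open>e\<close> is \<open>-1\<close>; hence \<open>N + 2\<close> centres for each of the four
    sides.\<close>
  define I where "I = {-1..int N}"
  define C where "C = (\<lambda>i. (-1/2, of_int i * real e)) ` I \<union> (\<lambda>i. (?s, of_int i * real e)) ` I \<union>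
     (\<lambda>i. (of_int i * real e, -1/2)) ` I \<union> (\<lambda>i. (of_int i * real e, ?s)) ` I"
  have cI: "card I = N + 2" by (simp add: I_def)
  have "card C \<le> card I + card I + card I + card I"
    unfolding C_def by (intro order_trans[OF card_Un_le] add_mono card_image_le) (auto simp: I_def)
  then have "card C \<le> 4 * (N + 2)" by (simp add: cI)
  moreover have "finite C" by (simp add: C_def I_def)
  moreover have "frontier (rbox (real N * real e)) \<subseteq> (\<Union>c\<in>C. cball c (real e))"
  proof
    fix p assume "p \<in> frontier (rbox (real N * real e))"
    then have p: "p \<in> rbox (real N * real e)" "p \<notin> box (-1/2, -1/2) (?s, ?s)"
      by (auto simp: frontier_def rbox_def interior_cbox)
    obtain x y where xy: "p = (x, y)" by (cases p)
    have rng: "-1/2 \<le> x" "x \<le> ?s" "-1/2 \<le> y" "y \<le> ?s" using p(1) by (auto simp: rbox_eq xy)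
    have edge: "x = -1/2 \<or> x = ?s \<or> y = -1/2 \<or> y = ?s"
      using p(2) rng unfolding xy by (auto simp: mem_box Basis_prod_def)
    have near: "\<exists>i\<in>I. \<bar>u - of_int i * real e\<bar> \<le> real e" if "-1/2 \<le> u" "u \<le> ?s" for u
    proof -
      define i where "i = \<lfloor>u / real e\<rfloor>"
      have e0: "real e \<ge> 1" using assms by simp
      have "of_int i \<le> u / real e" "u / real e < of_int i + 1" by (auto simp: i_def)
      then have i: "of_int i * real e \<le> u" "u < of_int i * real e + real e"
        using e0 by (auto simp: field_simps)
      have "- real e < of_int i * real e + real e" using i that e0 by linarith
      then have "0 < (of_int i + 2) * real e" by (simp add: algebra_simps)
      then have "of_int i + (2::real) > 0" using e0 by (simp add: zero_less_mult_iff)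
      then have "i \<ge> -1" by linarith
      moreover have "of_int i * real e < real N * real e" using i that by linarith
      then have "of_int i < real N" using e0 by simp
      then have "i \<le> int N" by linarith
      ultimately show ?thesis using i by (intro bexI[of _ i]) (auto simp: I_def)
    qed
    have d: "dist (u, a) (u, b) = \<bar>a - b\<bar>" "dist (a, u) (b, u) = \<bar>a - b\<bar>" for u a b :: real
      by (simp_all add: dist_Pair_Pair dist_real_def)
    obtain i where i: "i \<in> I" "\<bar>x - of_int i * real e\<bar> \<le> real e" using near[of x] rng by blast
    obtain j where j: "j \<in> I" "\<bar>y - of_int j * real e\<bar> \<le> real e" using near[of y] rng by blast
    have "p \<in> cball (x, of_int j * real e) (real e)" "p \<in> cball (of_int i * real e, y) (real e)"
      unfolding xy mem_cball d using i j by (simp_all add: abs_minus_commute)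
    then show "p \<in> (\<Union>c\<in>C. cball c (real e))"
      using edge i(1) j(1) unfolding C_def by blast
  qed
  ultimately show ?thesis by blast
qed

lemma card_periodic_box:
  assumes L: "int_lattice L" and e: "e > 0" "\<And>x y. e dvd x \<Longrightarrow> e dvd y \<Longrightarrow> (x, y) \<in> L"
  shows "card (L \<inter> box_points (int N * e)) = N\<^sup>2 * card (L \<inter> box_points e)"
proof -
  let ?f = "\<lambda>p::int \<times> int. ((fst p div e, snd p div e), (fst p mod e, snd p mod e))"
  have per: "(x mod e, y mod e) \<in> L \<longleftrightarrow> (x, y) \<in> L" for x y
  proof -
    have "(x mod e, y mod e) = lcomb 1 (x, y) (-1) (e * (x div e), e * (y div e))"
      by (simp add: lcomb_def minus_mult_div_eq_mod)
    moreover have "(x, y) = lcomb 1 (x mod e, y mod e) 1 (e * (x div e), e * (y div e))"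
      by (simp add: lcomb_def)
    moreover have "(e * (x div e), e * (y div e)) \<in> L" using e by simp
    ultimately show ?thesis using lattice_lcomb[OF L] by metis
  qed
  have divN: "0 \<le> x \<and> x < int N * e \<longleftrightarrow> 0 \<le> x div e \<and> x div e < int N" for x
  proof -
    have "x < int N * e \<longleftrightarrow> x div e < int N"
    proof
      assume "x < int N * e"
      moreover have "x div e * e \<le> x" using pos_mod_sign[OF e(1), of x] by (simp add: minus_mod_eq_div_mult[symmetric])
      ultimately have "x div e * e < int N * e" by simp
      then show "x div e < int N" using e(1) by simp
    next
      assume "x div e < int N"
      then have "(x div e + 1) * e \<le> int N * e" using e(1) by (intro mult_right_mono) auto
      moreover have "x < (x div e + 1) * e"
        using pos_mod_bound[OF e(1), of x] div_mult_mod_eq[of x e] unfolding distrib_right by linarith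
      ultimately show "x < int N * e" by simp
    qed
    then show ?thesis using e(1) by (simp add: pos_imp_zdiv_nonneg_iff)
  qed
  have "bij_betw ?f (L \<inter> box_points (int N * e)) (({0..<int N} \<times> {0..<int N}) \<times> (L \<inter> box_points e))"
    unfolding bij_betw_def
  proof
    show "inj_on ?f (L \<inter> box_points (int N * e))"
      by (rule inj_onI) (metis (no_types, lifting) Pair_inject div_mult_mod_eq prod_eq_iff)
    show "?f ` (L \<inter> box_points (int N * e)) = ({0..<int N} \<times> {0..<int N}) \<times> (L \<inter> box_points e)"
    proof (intro equalityI subsetI)
      fix q assume "q \<in> ?f ` (L \<inter> box_points (int N * e))"
      then obtain x y where xy: "(x, y) \<in> L" "(x, y) \<in> box_points (int N * e)" "q = ?f (x, y)" by auto
      then show "q \<in> ({0..<int N} \<times> {0..<int N}) \<times> (L \<inter> box_points e)"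
        using e(1) per[of x y] divN[of x] divN[of y] by (auto simp: box_points_def)
    next
      fix q assume q: "q \<in> ({0..<int N} \<times> {0..<int N}) \<times> (L \<inter> box_points e)"
      obtain i j x y where ij: "q = ((i, j), (x, y))" by (metis prod.exhaust)
      have r: "0 \<le> i" "i < int N" "0 \<le> j" "j < int N" "0 \<le> x" "x < e" "0 \<le> y" "y < e" "(x, y) \<in> L"
        using q by (auto simp: ij box_points_def)
      have dm: "(e * k + u) div e = k" "(e * k + u) mod e = u" if "0 \<le> u" "u < e" for k u
        using that e(1) by simp_all
      have "q = ?f (e * i + x, e * j + y)" using dm r by (simp add: ij)
      moreover have "(e * i + x, e * j + y) \<in> L" using per[of "e * i + x" "e * j + y"] dm r by simp
      moreover have "(e * i + x, e * j + y) \<in> box_points (int N * e)"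
        using divN[of "e * i + x"] divN[of "e * j + y"] dm r by (simp add: box_points_def)
      ultimately show "q \<in> ?f ` (L \<inter> box_points (int N * e))" by blast
    qed
  qed
  then have "card (L \<inter> box_points (int N * e)) = card (({0..<int N} \<times> {0..<int N}) \<times> (L \<inter> box_points e))"
    by (rule bij_betw_same_card)
  then show ?thesis by (simp add: card_cartesian_product power2_eq_square)
qed

context lattice_basis
begin

text \<open>Comparing the two counts in ever larger squares identifies the cell volume, so no
  determinant formula is needed.\<close>
lemma covol_times_density:
  assumes L: "int_lattice L" "v \<in> L" "w \<in> L" "\<forall>u\<in>L. \<exists>m n. u = lcomb m v n w"
    and e: "e \<ge> 1" "\<And>x y. int e dvd x \<Longrightarrow> int e dvd y \<Longrightarrow> (x, y) \<in> L"
  shows "covol * real (card (L \<inter> box_points (int e))) = (real e)\<^sup>2"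
proof -
  define c where "c = real (card (L \<inter> box_points (int e)))"
  define K where "K = covol * (4 * (4 * real e / vlen + 2)\<^sup>2)"
  have cov0: "covol \<ge> 0" by (simp add: covol_def)
  have "covol * c - (real e)\<^sup>2 = 0"
  proof (rule linear_bound_square_imp_zero)
    fix N :: nat assume N: "N \<ge> 1"
    obtain C where C: "finite C" "card C \<le> 4 * (N + 2)"
      "frontier (rbox (real N * real e)) \<subseteq> (\<Union>c\<in>C. cball c (real e))"
      using rbox_frontier_cover[OF e(1) N] by blast
    have lm: "rbox (real N * real e) \<in> lmeasurable" "bounded (rbox (real N * real e))"
      by (simp_all add: rbox_def)
    have seq: "{p. p - 0 \<in> L \<and> to_real2 p \<in> rbox (real N * real e)} = L \<inter> box_points (int N * int e)"
      using to_real2_rbox[of _ "int N * int e"] by auto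
    have "card (L \<inter> box_points (int N * int e)) = N\<^sup>2 * card (L \<inter> box_points (int e))"
      using e by (intro card_periodic_box L) auto
    then have "card {k. node (to_real2 0) k \<in> rbox (real N * real e)} = N\<^sup>2 * card (L \<inter> box_points (int e))"
      using lattice_points_eq_nodes(1)[OF L, of 0 "rbox (real N * real e)"] unfolding seq by simp
    then have "real (card {k. node (to_real2 0) k \<in> rbox (real N * real e)}) = (real N)\<^sup>2 * c"
      by (simp add: c_def)
    then have "\<bar>(real N)\<^sup>2 * c * covol - (real N * real e)\<^sup>2\<bar> \<le> covol * (real (card C) * (4 * real e / vlen + 2)\<^sup>2)"
      using node_count(2)[OF lm C(1,3), of "to_real2 0"] by (simp add: measure_rbox)
    also have "\<dots> \<le> covol * (real (4 * (N + 2)) * (4 * real e / vlen + 2)\<^sup>2)"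
      using C(2) cov0 by (intro mult_left_mono mult_right_mono) (simp_all only: of_nat_le_iff, auto)
    also have "\<dots> = K * (real N + 2)" by (simp add: K_def algebra_simps)
    also have "\<bar>(real N)\<^sup>2 * c * covol - (real N * real e)\<^sup>2\<bar> = (real N)\<^sup>2 * \<bar>covol * c - (real e)\<^sup>2\<bar>"
    proof -
      have "(real N)\<^sup>2 * c * covol - (real N * real e)\<^sup>2 = (real N)\<^sup>2 * (covol * c - (real e)\<^sup>2)"
        by (simp add: power_mult_distrib algebra_simps)
      then show ?thesis by (simp add: abs_mult)
    qed
    finally show "(real N)\<^sup>2 * \<bar>covol * c - (real e)\<^sup>2\<bar> \<le> K * (real N + 2)" .
  qed
  then show ?thesis by (simp add: c_def)
qed

end

definition snorm :: "int \<times> int \<Rightarrow> int" where "snorm p = max \<bar>fst p\<bar> \<bar>snd p\<bar>"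

text \<open>The reduced basis has to be chosen once: the same \<open>v\<close> serves every region
  and every translate. Covering the frontier at the scale \<open>vlen\<close> takes at most
  \<open>M / vlen + 1\<close> balls, each met by at most 36 cells. The sup norm is at most
  \<open>vlen\<close> and fits the square boxes in which short vectors are counted.\<close>

lemma lattice_point_count:
  assumes L: "int_lattice L" and e: "e \<ge> 1" "\<And>x y. int e dvd x \<Longrightarrow> int e dvd y \<Longrightarrow> (x, y) \<in> L"
  shows "\<exists>v. v \<in> L \<and> v \<noteq> (0, 0) \<and> (\<forall>M R z. R \<in> regions M \<longrightarrow>
     finite {p. p - z \<in> L \<and> to_real2 p \<in> R} \<and>
     \<bar>real (card {p. p - z \<in> L \<and> to_real2 p \<in> R})
        - measure lebesgue R * real (card (L \<inter> box_points (int e))) / (real e)\<^sup>2\<bar>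
      \<le> 36 * (1 + M / real_of_int (snorm v)))"
proof -
  obtain v w where vw: "v \<in> L" "w \<in> L" "cross v w \<noteq> 0" "nsq v \<le> nsq w" "2 * \<bar>idot v w\<bar> \<le> nsq v"
    "\<forall>u\<in>L. \<exists>m n. u = lcomb m v n w"
    using reduced_basis[OF L, of "int e"] e by auto
  interpret lattice_basis v w using vw by unfold_locales
  have v0: "v \<noteq> (0, 0)" using vw(3) by (auto simp: cross_def)
  have cd: "covol * real (card (L \<inter> box_points (int e))) = (real e)\<^sup>2"
    using covol_times_density[OF L vw(1,2,6) e] .
  moreover have "(real e)\<^sup>2 > 0" using e(1) by simp
  ultimately have cov: "covol > 0" using covol_def
    by (metis less_eq_real_def measure_nonneg mult_zero_left less_irrefl)
  have dens: "real (card (L \<inter> box_points (int e))) / (real e)\<^sup>2 = 1 / covol"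
    using cd cov \<open>(real e)\<^sup>2 > 0\<close> by (simp add: field_simps)
  have sn: "real_of_int (snorm v) > 0" "real_of_int (snorm v) \<le> vlen"
  proof -
    show "real_of_int (snorm v) > 0" using v0 by (cases v) (auto simp: snorm_def)
    have "(snorm v)\<^sup>2 \<le> nsq v" by (auto simp: snorm_def nsq_def max_def)
    then have "(real_of_int (snorm v))\<^sup>2 \<le> real_of_int (nsq v)"
      by (metis of_int_le_iff of_int_power)
    then show "real_of_int (snorm v) \<le> vlen" unfolding vlen_def by (rule real_le_rsqrt)
  qed
  have "finite {p. p - z \<in> L \<and> to_real2 p \<in> R} \<and>
     \<bar>real (card {p. p - z \<in> L \<and> to_real2 p \<in> R})
        - measure lebesgue R * real (card (L \<inter> box_points (int e))) / (real e)\<^sup>2\<bar>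
      \<le> 36 * (1 + M / real_of_int (snorm v))" if R: "R \<in> regions M" for M R z
  proof
    obtain C where C: "finite C" "real (card C) \<le> M / vlen + 1" "frontier R \<subseteq> (\<Union>c\<in>C. cball c vlen)"
      using regions_frontier_cover[OF R vlen_pos] by blast
    have cb: "convex R" "bounded R" using R by (auto simp: regions_def)
    have Rm: "R \<in> lmeasurable" using cb by (rule measurable_convex)
    let ?n = "real (card {p. p - z \<in> L \<and> to_real2 p \<in> R})"
    note nc = node_count[OF Rm cb(2) C(1,3) less_imp_le[OF vlen_pos], of "to_real2 z"]
    note ln = lattice_points_eq_nodes[OF L vw(1,2,6), of z R]
    show "finite {p. p - z \<in> L \<and> to_real2 p \<in> R}" using nc(1) ln(2) by blast
    have "\<bar>?n * covol - measure lebesgue R\<bar> \<le> covol * (real (card C) * (4 * vlen / vlen + 2)\<^sup>2)"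
      using nc(2) ln(1) by simp
    then have n1: "\<bar>?n * covol - measure lebesgue R\<bar> \<le> covol * (real (card C) * 36)"
      using vlen_pos by simp
    have "?n - measure lebesgue R * real (card (L \<inter> box_points (int e))) / (real e)\<^sup>2 = (?n * covol - measure lebesgue R) / covol"
      unfolding times_divide_eq_right[symmetric] dens using cov by (simp add: diff_divide_distrib)
    then have "\<bar>?n - measure lebesgue R * real (card (L \<inter> box_points (int e))) / (real e)\<^sup>2\<bar>
        = \<bar>?n * covol - measure lebesgue R\<bar> / covol"
      using cov by (simp add: abs_divide)
    also have "\<dots> \<le> real (card C) * 36"
      using n1 cov by (simp add: divide_le_eq mult.commute)
    also have "\<dots> \<le> (M / vlen + 1) * 36" using C(2) by (rule mult_right_mono) simp
    also have "\<dots> \<le> 36 * (1 + M / real_of_int (snorm v))"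
    proof -
      \<comment> \<open>Comes from the frontier being a nonempty path image, so that at least one
        ball is needed.\<close>
      have "M \<ge> 0"
      proof -
        have "frontier R \<noteq> {}" using R by (auto simp: regions_def)
        then have "C \<noteq> {}" using C(3) by blast
        then have "real (card C) \<ge> 1" using C(1) by (simp add: Suc_le_eq card_gt_0_iff)
        then have "M / vlen \<ge> 0" using C(2) by linarith
        then show ?thesis using vlen_pos by (simp add: zero_le_divide_iff)
      qed
      then have "M / vlen \<le> M / real_of_int (snorm v)" using sn by (intro divide_left_mono) auto
      then show ?thesis unfolding mult.commute[of _ "36::real"] by simp
    qed
    finally show "\<bar>?n - measure lebesgue R * real (card (L \<inter> box_points (int e))) / (real e)\<^sup>2\<bar>
      \<le> 36 * (1 + M / real_of_int (snorm v))" .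
  qed
  then show ?thesis using vw(1) v0 by blast
qed

section \<open>Divisor sums over values of a form\<close>

definition tauc :: "int \<Rightarrow> int \<Rightarrow> nat" where
  "tauc D m = card {d::nat. int d dvd m \<and> coprime (int d) D}"

definition sbox :: "nat \<Rightarrow> (int \<times> int) set" where
  "sbox N = {- int N..int N} \<times> {- int N..int N}"

lemma finite_sbox: "finite (sbox N)"
  by (simp add: sbox_def)

lemma mem_sbox_iff: "p \<in> sbox N \<longleftrightarrow> snorm p \<le> int N"
  by (cases p) (auto simp: sbox_def snorm_def)

lemma finite_int_divisors: "m \<noteq> 0 \<Longrightarrow> finite {d::nat. int d dvd m}"
proof -
  assume "m \<noteq> 0"
  then have "0 < nat \<bar>m\<bar>" by simp
  from finite_divisors_nat[OF this] show ?thesis by simp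
qed

text \<open>The admissible divisors are closed under \<open>lcm\<close>, so the largest of them is a
  multiple of all. This turns \<open>tauc\<close> into \<open>tau\<close> of one number.\<close>

lemma coprime_part:
  assumes "m \<noteq> 0"
  shows "\<exists>n::nat. n > 0 \<and> int n dvd m \<and> coprime (int n) D \<and> (\<forall>d. int d dvd m \<and> coprime (int d) D \<longleftrightarrow> d dvd n)"
proof -
  define A where "A = {d::nat. int d dvd m \<and> coprime (int d) D}"
  have fin: "finite A" using finite_int_divisors[OF assms] by (rule rev_finite_subset) (auto simp: A_def)
  have "1 \<in> A" by (simp add: A_def)
  define n where "n = Max A"
  have n: "n \<in> A" unfolding n_def using fin \<open>1 \<in> A\<close> by (intro Max_in) auto
  have npos: "n > 0" using n assms by (auto simp: A_def intro: Nat.gr0I)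
  have "d dvd n" if d: "d \<in> A" for d
  proof -
    have "int (lcm d n) dvd m" using d n by (simp add: A_def lcm_least flip: lcm_int_int_eq)
    moreover have "coprime (int (lcm d n)) D"
    proof -
      have "coprime (int (d * n)) D" using d n by (simp add: A_def)
      moreover have "int (lcm d n) dvd int (d * n)" by (simp only: int_dvd_int_iff) (simp add: lcm_least)
      ultimately show ?thesis by (meson coprime_divisors dvd_refl)
    qed
    ultimately have "lcm d n \<in> A" by (simp add: A_def)
    then have "lcm d n \<le> n" unfolding n_def using fin by simp
    moreover have "n dvd lcm d n" by simp
    moreover have "lcm d n > 0" using npos d assms by (auto simp: A_def lcm_pos_nat intro!: Nat.gr0I)
    ultimately have "lcm d n = n" by (meson dvd_imp_le le_antisym)
    then show ?thesis by (metis dvd_lcm1)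
  qed
  moreover have "d \<in> A" if "d dvd n" for d
  proof -
    have "int d dvd int n" using that by simp
    moreover have "int n dvd m" "coprime (int n) D" using n by (simp_all add: A_def)
    ultimately have "int d dvd m" "coprime (int d) D"
      using coprime_divisors[of "int d" "int n" D D] by (auto intro: dvd_trans)
    then show ?thesis by (simp add: A_def)
  qed
  ultimately have iff: "d \<in> A \<longleftrightarrow> d dvd n" for d by blast
  show ?thesis
    using n npos iff by (intro exI[of _ n]) (simp add: A_def)
qed

lemma tauc_small_divisor:
  assumes "m \<noteq> 0"
  shows "\<exists>d::nat. d > 0 \<and> int d dvd m \<and> coprime (int d) D \<and> (int d)\<^sup>2 \<le> \<bar>m\<bar> \<and> tauc D m \<le> 2 * (tau d)\<^sup>2"
proof -
  obtain n where n: "n > 0" "int n dvd m" "coprime (int n) D"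
    "\<And>d. int d dvd m \<and> coprime (int d) D \<longleftrightarrow> d dvd n"
    using coprime_part[OF assms] by metis
  obtain d where d: "d dvd n" "d\<^sup>2 \<le> n" "tau n \<le> 2 * (tau d)\<^sup>2" using small_divisor[OF n(1)] by blast
  have "tauc D m = tau n" by (simp add: tauc_def tau_def n(4))
  moreover have "(int d)\<^sup>2 \<le> \<bar>m\<bar>"
  proof -
    have "int n \<le> \<bar>m\<bar>" using n(2) assms by (metis dvd_imp_le_int abs_of_nat)
    moreover have "(int d)\<^sup>2 \<le> int n" using d(2) by (metis of_nat_le_iff of_nat_power)
    ultimately show ?thesis by linarith
  qed
  moreover have "d > 0" using d(1) n(1) by (auto intro: Nat.gr0I)
  ultimately show ?thesis using d n(4)[of d] by auto
qed

lemma card_congruent_le: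
  fixes S :: "int set"
  assumes "S \<subseteq> {- int N..int N}" "m \<ge> 1" "\<And>x y. x \<in> S \<Longrightarrow> y \<in> S \<Longrightarrow> int m dvd x - y"
  shows "real (card S) \<le> 2 * real N / real m + 2"
proof -
  define J where "J = {(- int N) div int m..int N div int m}"
  have "card S \<le> card J"
  proof (rule card_inj_on_le[where f = "\<lambda>x. x div int m"])
    show "inj_on (\<lambda>x. x div int m) S"
    proof (rule inj_onI)
      fix x y assume xy: "x \<in> S" "y \<in> S" "x div int m = y div int m"
      then have "x mod int m = y mod int m" using assms(3) by (simp add: mod_eq_dvd_iff)
      then show "x = y" using xy(3) by (metis div_mult_mod_eq)
    qed
    show "(\<lambda>x. x div int m) ` S \<subseteq> J" using assms(1,2) by (force simp: J_def intro!: zdiv_mono1)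
  qed (simp add: J_def)
  also have "card J = nat (int N div int m - (- int N) div int m + 1)" by (simp add: J_def)
  finally have "real (card S) \<le> real (nat (int N div int m - (- int N) div int m + 1))" by simp
  also have "\<dots> = real_of_int (int N div int m) - real_of_int ((- int N) div int m) + 1"
  proof -
    have "(- int N) div int m \<le> int N div int m" using assms(2) by (intro zdiv_mono1) auto
    then show ?thesis by simp
  qed
  also have "\<dots> \<le> 2 * real N / real m + 2"
  proof -
    have "real_of_int (int N div int m) \<le> real N / real m"
      using floor_divide_of_int_eq[of "int N" "int m", where 'a = real] by simp linarith
    moreover have "real_of_int ((- int N) div int m) \<ge> - real N / real m - 1"
      using floor_divide_of_int_eq[of "- int N" "int m", where 'a = real] by simp linarith
    ultimately show ?thesis by simp
  qed
  finally show ?thesis .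
qed

text \<open>\<open>y\<close> runs through multiples of \<open>k\<close>, and for fixed
  \<open>y\<close> the coordinate \<open>x\<close> lies in one class modulo \<open>k * e\<close>.
  Both moduli are at most \<open>c * N\<close>, so the count is of order
  \<open>N\<^sup>2 / (k\<^sup>2 * e)\<close>, and \<open>d\<close> divides
  \<open>k\<^sup>2 * e\<close>. The empty set of primes suffices for an upper bound.\<close>

lemma card_lat_sbox_le:
  assumes d: "d > 0" "coprime a (int d)" and k: "k dvd d" and N: "N \<ge> 1" "d \<le> c * N" "c \<ge> 1"
  shows "real (card (lat a b d (k, t, {}) \<inter> sbox N)) \<le> 16 * (real c)\<^sup>2 * (real N)\<^sup>2 / real d"
proof -
  define e where "e = red_mod d k"
  have kpos: "k \<ge> 1" using k d(1) by (auto simp: Suc_le_eq intro: Nat.gr0I)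
  have epos: "e \<ge> 1" using red_mod_pos[OF d(1), of k] by (simp add: e_def Suc_le_eq)
  have ked: "k * e dvd d" unfolding e_def using mult_red_mod_dvd[OF k d(1)] .
  have kle: "k \<le> c * N" "k * e \<le> c * N" using k ked d(1) N(2) by (meson dvd_imp_le le_trans)+
  define Y where "Y = {y \<in> {- int N..int N}. int k dvd y}"
  define X where "X y = {x \<in> {- int N..int N}. int k dvd x \<and> int (k * e) dvd a * x + (b - t) * y}" for y
  \<comment> \<open>The bound on \<open>m\<close> lets the main term absorb the rounding error 2;
    without it the saving \<open>1 / d\<close> would be lost.\<close>
  have bound: "2 * real N / real m + 2 \<le> 4 * real c * real N / real m" if "m \<le> c * N" "m \<ge> 1" for m
  proof -
    have "real m \<le> real c * real N" using that by (metis of_nat_le_iff of_nat_mult)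
    then have "1 \<le> real c * real N / real m" using that by simp
    moreover have "1 * real N \<le> real c * real N" using N(3) by (intro mult_right_mono) auto
    then have "real N / real m \<le> real c * real N / real m" by (simp add: divide_right_mono)
    moreover have "2 * r + 2 \<le> 4 * s" if "1 \<le> s" "r \<le> s" for r s :: real using that by linarith
    ultimately have "2 * (real N / real m) + 2 \<le> 4 * (real c * real N / real m)" by blast
    then show ?thesis by (simp add: mult.assoc)
  qed
  have cY: "real (card Y) \<le> 4 * real c * real N / real k"
    using card_congruent_le[of Y N k] bound[of k] kpos kle by (force simp: Y_def)
  have cX: "real (card (X y)) \<le> 4 * real c * real N / real (k * e)" for y
  proof -
    have "int (k * e) dvd x - x'" if "x \<in> X y" "x' \<in> X y" for x x'
    proof -
      have "int k dvd x - x'" using that by (auto simp: X_def)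
      then obtain u where u: "x - x' = int k * u" by auto
      have "int (k * e) dvd (a * x + (b - t) * y) - (a * x' + (b - t) * y)"
        using that by (intro dvd_diff) (auto simp: X_def simp del: of_nat_mult)
      then have "int (k * e) dvd a * (x - x')" by (simp add: algebra_simps)
      then have "int k * int e dvd int k * (a * u)" unfolding u by (simp add: mult.left_commute)
      then have "int e dvd a * u" using kpos by simp
      moreover have "coprime a (int e)"
        using d(2) red_mod_dvd[of d k] unfolding e_def by (meson coprime_divisors dvd_refl int_dvd_int_iff)
      ultimately have "int e dvd u" by (simp add: coprime_dvd_mult_right_iff coprime_commute)
      then show ?thesis by (simp add: u)
    qed
    then have "real (card (X y)) \<le> 2 * real N / real (k * e) + 2"
      using kpos epos by (intro card_congruent_le) (auto simp: X_def Suc_le_eq)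
    then show ?thesis using bound[OF kle(2)] kpos epos by (simp add: Suc_le_eq del: of_nat_mult)
  qed
  have fin: "finite Y" "finite (X y)" for y unfolding X_def Y_def by (rule finite_Collect_conjI; simp)+
  have "lat a b d (k, t, {}) \<inter> sbox N \<subseteq> (\<lambda>(y, x). (x, y)) ` (SIGMA y:Y. X y)"
    by (auto simp: lat_def sbox_def X_def Y_def e_def image_iff)
  then have "card (lat a b d (k, t, {}) \<inter> sbox N) \<le> card (SIGMA y:Y. X y)"
    using fin by (intro surj_card_le) auto
  also have "\<dots> = (\<Sum>y\<in>Y. card (X y))" using fin by simp
  finally have "real (card (lat a b d (k, t, {}) \<inter> sbox N)) \<le> (\<Sum>y\<in>Y. real (card (X y)))"
    by (metis of_nat_le_iff of_nat_sum)
  also have "\<dots> \<le> real (card Y) * (4 * real c * real N / real (k * e))"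
    using sum_mono[of Y "\<lambda>y. real (card (X y))" "\<lambda>_. 4 * real c * real N / real (k * e)"] cX by simp
  also have "\<dots> \<le> (4 * real c * real N / real k) * (4 * real c * real N / real (k * e))"
    using cY by (intro mult_right_mono) auto
  also have "\<dots> = 16 * (real c)\<^sup>2 * (real N)\<^sup>2 / real (k\<^sup>2 * e)"
    by (simp add: power2_eq_square mult_ac)
  also have "\<dots> \<le> 16 * (real c)\<^sup>2 * (real N)\<^sup>2 / real d"
  proof (intro divide_left_mono mult_pos_pos)
    have "k\<^sup>2 * e > 0" using kpos epos by simp
    then show "real d \<le> real (k\<^sup>2 * e)" "real (k\<^sup>2 * e) > 0"
      using dvd_square_red_mod[of d k] unfolding e_def[symmetric] by (simp_all only: of_nat_le_iff dvd_imp_le of_nat_0_less_iff)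
  qed (use d(1) in auto)
  finally show ?thesis .
qed

text \<open>As only an upper bound is wanted, the signs are dropped and the solutions are covered by
  the lattices with empty \<open>S\<close>; the two factors tau count \<open>k\<close> and
  \<open>t\<close>.\<close>

lemma card_qform_multiples_le:
  assumes d: "d > 0" "odd d" "coprime a (int d)" "coprime (qdet a b c) (int d)"
    and N: "N \<ge> 1" "d \<le> A * N" "A \<ge> 1"
  shows "real (card {p \<in> sbox N. int d dvd qform a b c p}) \<le> 16 * (real A)\<^sup>2 * (real N)\<^sup>2 * (real (tau d))\<^sup>2 / real d"
proof -
  let ?K = "{k. k dvd d}" and ?R = "\<lambda>k. sq_roots (qdet a b c) (red_mod d k)"
  let ?b = "16 * (real A)\<^sup>2 * (real N)\<^sup>2 / real d"
  have finK: "finite ?K" using d(1) by simp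
  have sub: "{p \<in> sbox N. int d dvd qform a b c p} \<subseteq> (\<Union>k\<in>?K. \<Union>t\<in>?R k. lat a b d (k, t, {}) \<inter> sbox N)"
  proof
    fix p assume p: "p \<in> {p \<in> sbox N. int d dvd qform a b c p}"
    then have "(\<Sum>j\<in>lat_idx (qdet a b c) d. lat_sign j * of_bool (p \<in> lat a b d j)) \<noteq> 0"
      by (subst sum_lat_sign[OF d(1,3)]) simp
    then obtain j where j: "j \<in> lat_idx (qdet a b c) d" "p \<in> lat a b d j"
      by (auto elim!: sum.not_neutral_contains_not_neutral)
    obtain k t S where kts: "j = (k, t, S)" by (cases j) auto
    have "p \<in> lat a b d (k, t, {})" using j(2) by (auto simp: kts lat_def)
    then show "p \<in> (\<Union>k\<in>?K. \<Union>t\<in>?R k. lat a b d (k, t, {}) \<inter> sbox N)"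
      using j(1) p by (auto simp: kts lat_idx_def)
  qed
  have "card {p \<in> sbox N. int d dvd qform a b c p} \<le> card (\<Union>k\<in>?K. \<Union>t\<in>?R k. lat a b d (k, t, {}) \<inter> sbox N)"
    using sub finK finite_sq_roots finite_sbox by (intro card_mono) auto
  also have "\<dots> \<le> (\<Sum>k\<in>?K. \<Sum>t\<in>?R k. card (lat a b d (k, t, {}) \<inter> sbox N))"
    by (intro order_trans[OF card_UN_le[OF finK]] sum_mono card_UN_le finite_sq_roots)
  finally have "real (card {p \<in> sbox N. int d dvd qform a b c p}) \<le>
      (\<Sum>k\<in>?K. \<Sum>t\<in>?R k. real (card (lat a b d (k, t, {}) \<inter> sbox N)))"
    unfolding of_nat_sum[symmetric] of_nat_le_iff .
  also have "\<dots> \<le> (\<Sum>k\<in>?K. \<Sum>t\<in>?R k. ?b)"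
    by (intro sum_mono card_lat_sbox_le[OF d(1,3) _ N]) auto
  also have "\<dots> = (\<Sum>k\<in>?K. real (card (?R k)) * ?b)" by simp
  also have "\<dots> \<le> (\<Sum>k\<in>?K. real (tau d) * ?b)"
    using card_sq_roots_red_mod_le[OF d(1,2,4)] by (intro sum_mono mult_right_mono) auto
  also have "\<dots> = real (tau d) * (real (tau d) * ?b)" by (simp add: tau_def)
  finally show ?thesis by (simp add: power2_eq_square mult_ac)
qed

text \<open>What the counting needs of a form: no nontrivial integer zero, so that values have
  finitely many divisors, and enough factors in \<open>D\<close> for the root count modulo any
  \<open>d\<close> prime to \<open>D\<close>.\<close>

definition good_form :: "int \<Rightarrow> int \<Rightarrow> int \<Rightarrow> int \<Rightarrow> bool" where
  "good_form D a b c \<longleftrightarrow> (\<forall>p. p \<noteq> (0, 0) \<longrightarrow> qform a b c p \<noteq> 0) \<and> even D \<and> a dvd D \<and> qdet a b c dvd D"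

lemma good_form_coprime:
  assumes "good_form D a b c" "coprime (int d) D"
  shows "odd d" "coprime a (int d)" "coprime (qdet a b c) (int d)"
proof -
  have "coprime (int d) 2" using assms unfolding good_form_def by (meson coprime_divisors dvd_refl)
  then show "odd d" by (simp add: coprime_commute)
  show "coprime a (int d)" "coprime (qdet a b c) (int d)"
    using assms unfolding good_form_def by (meson coprime_divisors coprime_commute dvd_refl)+
qed

text \<open>Values of the form on the box are at most \<open>(A * N)\<^sup>2\<close>, so their small
  divisors are at most \<open>A * N\<close>, just the range in which solutions can be counted. The
  exponent \<open>2 * k + 2\<close> collects \<open>2 * k\<close> factors tau from the small divisor
  and two from that count.\<close>

lemma sum_tauc_power_le:
  assumes gf: "good_form D a b c"
  shows "\<exists>C\<ge>0. \<forall>N\<ge>1. (\<Sum>p\<in>sbox N - {(0, 0)}. real (tauc D (qform a b c p)) ^ k)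
    \<le> C * (real N)\<^sup>2 * (2 * ln (2 * real N)) ^ (2 ^ (2 * k + 2))"
proof -
  define A where "A = nat (\<bar>a\<bar> + 2 * \<bar>b\<bar> + \<bar>c\<bar>)"
  have A: "int A = \<bar>a\<bar> + 2 * \<bar>b\<bar> + \<bar>c\<bar>" by (simp add: A_def)
  have "qform a b c (1, 0) \<noteq> 0" using gf by (simp add: good_form_def)
  then have A1: "A \<ge> 1" using A by (auto simp: qform_def)
  define E where "E = (2::nat) ^ (2 * k + 2)"
  define C where "C = 2 ^ k * (16 * (real A)\<^sup>2) * (2 + ln (real A)) ^ E"
  have C0: "C \<ge> 0" using A1 by (simp add: C_def)
  have "(\<Sum>p\<in>sbox N - {(0, 0)}. real (tauc D (qform a b c p)) ^ k) \<le> C * (real N)\<^sup>2 * (2 * ln (2 * real N)) ^ E"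
    if N: "N \<ge> 1" for N
  proof -
    let ?q = "qform a b c" and ?P = "sbox N - {(0, 0)}"
    define G where "G = {d \<in> {1..A * N}. coprime (int d) D}"
    have size: "\<bar>?q p\<bar> \<le> (int A * int N)\<^sup>2" if "p \<in> sbox N" for p
    proof -
      obtain x y where p: "p = (x, y)" by (cases p)
      have xy: "\<bar>x\<bar> \<le> int N" "\<bar>y\<bar> \<le> int N" using that by (auto simp: p sbox_def)
      have m: "\<bar>u\<bar> * \<bar>w\<bar> \<le> int N * int N" if "\<bar>u\<bar> \<le> int N" "\<bar>w\<bar> \<le> int N" for u w
        using that by (intro mult_mono) auto
      have "\<bar>?q p\<bar> \<le> \<bar>a\<bar> * (\<bar>x\<bar> * \<bar>x\<bar>) + 2 * \<bar>b\<bar> * (\<bar>x\<bar> * \<bar>y\<bar>) + \<bar>c\<bar> * (\<bar>y\<bar> * \<bar>y\<bar>)"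
        unfolding qform_def p fst_conv snd_conv
        by (intro order_trans[OF abs_triangle_ineq] add_mono) (simp_all add: abs_mult power2_eq_square)
      also have "\<dots> \<le> \<bar>a\<bar> * (int N * int N) + 2 * \<bar>b\<bar> * (int N * int N) + \<bar>c\<bar> * (int N * int N)"
        using xy by (intro add_mono mult_left_mono m) auto
      also have "\<dots> = int A * (int N * int N)" by (simp add: A algebra_simps)
      \<comment> \<open>Replacing \<open>A\<close> by its square makes the bound a perfect square,
        ready for comparison with \<open>d\<^sup>2\<close>.\<close>
      also have "\<dots> \<le> (int A * int A) * (int N * int N)" using A1 by (intro mult_right_mono) auto
      finally show ?thesis by (simp add: power2_eq_square mult_ac)
    qed
    have pt: "real (tauc D (?q p)) ^ k \<le> (\<Sum>d\<in>G. of_bool (int d dvd ?q p) * (2 ^ k * real (tau d) ^ (2 * k)))"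
      if p: "p \<in> ?P" for p
    proof -
      have "?q p \<noteq> 0" using gf p unfolding good_form_def by blast
      then obtain d where d: "d > 0" "int d dvd ?q p" "coprime (int d) D" "(int d)\<^sup>2 \<le> \<bar>?q p\<bar>" "tauc D (?q p) \<le> 2 * (tau d)\<^sup>2"
        using tauc_small_divisor by blast
      have "(int d)\<^sup>2 \<le> (int (A * N))\<^sup>2" using order_trans[OF d(4) size[of p]] p by simp
      then have "int d \<le> int (A * N)" by (rule power2_le_imp_le) simp
      then have dG: "d \<in> G" using d by (simp add: G_def del: of_nat_mult)
      have "real (tauc D (?q p)) ^ k \<le> (2 * (real (tau d))\<^sup>2) ^ k"
      proof (rule power_mono)
        show "real (tauc D (?q p)) \<le> 2 * (real (tau d))\<^sup>2"
          using d(5) by (metis of_nat_le_iff of_nat_mult of_nat_numeral of_nat_power)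
      qed simp
      also have "\<dots> = of_bool (int d dvd ?q p) * (2 ^ k * real (tau d) ^ (2 * k))"
        using d(2) by (simp add: power_mult_distrib power_mult)
      also have "\<dots> \<le> (\<Sum>d\<in>G. of_bool (int d dvd ?q p) * (2 ^ k * real (tau d) ^ (2 * k)))"
        using dG by (intro member_le_sum) (auto simp: G_def)
      finally show ?thesis .
    qed
    have "(\<Sum>p\<in>?P. real (tauc D (?q p)) ^ k) \<le> (\<Sum>p\<in>?P. \<Sum>d\<in>G. of_bool (int d dvd ?q p) * (2 ^ k * real (tau d) ^ (2 * k)))"
      by (intro sum_mono pt)
    also have "\<dots> = (\<Sum>d\<in>G. \<Sum>p\<in>?P. of_bool (int d dvd ?q p) * (2 ^ k * real (tau d) ^ (2 * k)))"
      by (rule sum.swap)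
    also have "\<dots> \<le> (\<Sum>d\<in>G. 2 ^ k * (16 * (real A)\<^sup>2) * (real N)\<^sup>2 * (real (tau d) ^ (2 * k + 2) / real d))"
    proof (rule sum_mono)
      fix d assume d: "d \<in> G"
      have "(\<Sum>p\<in>?P. of_bool (int d dvd ?q p) * (2 ^ k * real (tau d) ^ (2 * k))) =
          real (card {p \<in> ?P. int d dvd ?q p}) * (2 ^ k * real (tau d) ^ (2 * k))"
        unfolding sum_distrib_right[symmetric] using finite_sbox by (simp add: of_bool_def sum.If_cases Int_def)
      also have "card {p \<in> ?P. int d dvd ?q p} \<le> card {p \<in> sbox N. int d dvd ?q p}"
        using finite_sbox by (intro card_mono) auto
      then have "real (card {p \<in> ?P. int d dvd ?q p}) * (2 ^ k * real (tau d) ^ (2 * k)) \<le>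
        (16 * (real A)\<^sup>2 * (real N)\<^sup>2 * (real (tau d))\<^sup>2 / real d) * (2 ^ k * real (tau d) ^ (2 * k))"
        using card_qform_multiples_le[of d a b c N A] good_form_coprime[OF gf, of d] d N A1
        by (intro mult_right_mono) (auto simp: G_def intro: order_trans[OF of_nat_mono])
      also have "\<dots> = 2 ^ k * (16 * (real A)\<^sup>2) * (real N)\<^sup>2 * (real (tau d) ^ (2 * k + 2) / real d)"
        by (simp add: power_add power2_eq_square mult_ac)
      finally show "(\<Sum>p\<in>?P. of_bool (int d dvd ?q p) * (2 ^ k * real (tau d) ^ (2 * k))) \<le>
        2 ^ k * (16 * (real A)\<^sup>2) * (real N)\<^sup>2 * (real (tau d) ^ (2 * k + 2) / real d)" .
    qed
    also have "\<dots> = 2 ^ k * (16 * (real A)\<^sup>2) * (real N)\<^sup>2 * (\<Sum>d\<in>G. real (tau d) ^ (2 * k + 2) / real d)"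
      by (simp only: sum_distrib_left)
    also have "\<dots> \<le> 2 ^ k * (16 * (real A)\<^sup>2) * (real N)\<^sup>2 * (harm (A * N)) ^ E"
    proof (rule mult_left_mono)
      have "(\<Sum>d\<in>G. real (tau d) ^ (2 * k + 2) / real d) \<le> (\<Sum>d=1..A * N. real (tau d) ^ (2 * k + 2) / real d)"
        by (intro sum_mono2) (auto simp: G_def)
      also have "\<dots> \<le> (harm (A * N)) ^ E" unfolding E_def by (rule sum_tau_power_div_le)
      finally show "(\<Sum>d\<in>G. real (tau d) ^ (2 * k + 2) / real d) \<le> (harm (A * N)) ^ E" .
    qed simp
    also have "\<dots> \<le> 2 ^ k * (16 * (real A)\<^sup>2) * (real N)\<^sup>2 * ((2 + ln (real A)) * (2 * ln (2 * real N))) ^ E"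
    proof (intro mult_left_mono power_mono)
      \<comment> \<open>Since \<open>2 * ln 2\<close> is at least 1, the factor
        \<open>2 * ln (2 * N)\<close> can absorb additive constants; \<open>ln (2 * N)\<close>
        itself is below 1 for \<open>N = 1\<close>.\<close>
      have l2: "ln 2 \<ge> (1/2::real)" using ln2_ge_two_thirds by linarith
      have lN: "ln (2 * real N) \<ge> ln 2" using N by simp
      have lNN: "ln (real N) \<le> ln (2 * real N)" using N by simp
      have "harm (A * N) \<le> 1 + ln (real (A * N))" using A1 N by (intro harm_le_one_plus_ln) simp
      also have "\<dots> = 1 + ln (real A) + ln (real N)" using A1 N by (simp add: ln_mult)
      also have "\<dots> \<le> (1 + ln (real A)) * (2 * ln (2 * real N)) + 1 * (2 * ln (2 * real N))"
      proof (rule add_mono)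
        have "(1 + ln (real A)) * 1 \<le> (1 + ln (real A)) * (2 * ln (2 * real N))"
          using A1 l2 lN by (intro mult_left_mono) auto
        then show "1 + ln (real A) \<le> (1 + ln (real A)) * (2 * ln (2 * real N))" by simp
      qed (use lN lNN l2 in auto)
      also have "\<dots> = (2 + ln (real A)) * (2 * ln (2 * real N))" by (simp add: algebra_simps)
      finally show "harm (A * N) \<le> (2 + ln (real A)) * (2 * ln (2 * real N))" .
    qed (auto simp: harm_nonneg)
    also have "\<dots> = C * (real N)\<^sup>2 * (2 * ln (2 * real N)) ^ E"
      by (simp add: C_def power_mult_distrib mult_ac)
    finally show ?thesis .
  qed
  then show ?thesis using C0 unfolding E_def by blast
qed

text \<open>Bounding by the largest factor separates the forms: no joint statistics of their values
  are needed, at the price of moments of order \<open>4 * g\<close> instead of 4.\<close>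

lemma prod_le_sum_power:
  fixes f :: "nat \<Rightarrow> real"
  assumes "g \<ge> 1" "\<And>i. i < g \<Longrightarrow> f i \<ge> 0"
  shows "(\<Prod>i<g. f i) \<le> (\<Sum>i<g. f i ^ g)"
proof -
  define m where "m = Max (f ` {..<g})"
  have ne: "f ` {..<g} \<noteq> {}" using assms(1) by (auto simp: lessThan_empty_iff)
  obtain j where j: "j < g" "f j = m" using Max_in[OF _ ne] by (auto simp: m_def)
  have "(\<Prod>i<g. f i) \<le> (\<Prod>i<g. m)" using assms(2) by (intro prod_mono) (auto simp: m_def)
  also have "\<dots> = f j ^ g" by (simp add: j)
  also have "\<dots> \<le> (\<Sum>i<g. f i ^ g)" using j assms(2) by (intro member_le_sum) auto
  finally show ?thesis .
qed

lemma sum_prod_tauc_le: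
  assumes "g \<ge> 1" and gf: "\<And>i. i < g \<Longrightarrow> good_form D (a i) (b i) (c i)"
  shows "\<exists>C\<ge>0. \<forall>N\<ge>1. (\<Sum>p\<in>sbox N - {(0, 0)}. \<Prod>i<g. real (tauc D (qform (a i) (b i) (c i) p)) ^ 4)
    \<le> C * (real N)\<^sup>2 * (2 * ln (2 * real N)) ^ (2 ^ (8 * g + 2))"
proof -
  have "\<forall>i\<in>{..<g}. \<exists>C\<ge>0. \<forall>N\<ge>1. (\<Sum>p\<in>sbox N - {(0, 0)}. real (tauc D (qform (a i) (b i) (c i) p)) ^ (4 * g))
    \<le> C * (real N)\<^sup>2 * (2 * ln (2 * real N)) ^ (2 ^ (8 * g + 2))"
    using sum_tauc_power_le[OF gf, of _ "4 * g"] by simp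
  then obtain C where C: "\<And>i. i < g \<Longrightarrow> C i \<ge> 0"
    "\<And>i N. i < g \<Longrightarrow> N \<ge> 1 \<Longrightarrow> (\<Sum>p\<in>sbox N - {(0, 0)}. real (tauc D (qform (a i) (b i) (c i) p)) ^ (4 * g))
    \<le> C i * (real N)\<^sup>2 * (2 * ln (2 * real N)) ^ (2 ^ (8 * g + 2))"
    by (metis lessThan_iff)
  have "(\<Sum>p\<in>sbox N - {(0, 0)}. \<Prod>i<g. real (tauc D (qform (a i) (b i) (c i) p)) ^ 4)
    \<le> (\<Sum>i<g. C i) * (real N)\<^sup>2 * (2 * ln (2 * real N)) ^ (2 ^ (8 * g + 2))" if N: "N \<ge> 1" for N
  proof -
    have "(\<Sum>p\<in>sbox N - {(0, 0)}. \<Prod>i<g. real (tauc D (qform (a i) (b i) (c i) p)) ^ 4)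
      \<le> (\<Sum>p\<in>sbox N - {(0, 0)}. \<Sum>i<g. (real (tauc D (qform (a i) (b i) (c i) p)) ^ 4) ^ g)"
      by (intro sum_mono prod_le_sum_power assms(1)) auto
    also have "\<dots> = (\<Sum>i<g. \<Sum>p\<in>sbox N - {(0, 0)}. real (tauc D (qform (a i) (b i) (c i) p)) ^ (4 * g))"
      by (subst sum.swap) (simp add: power_mult)
    also have "\<dots> \<le> (\<Sum>i<g. C i * (real N)\<^sup>2 * (2 * ln (2 * real N)) ^ (2 ^ (8 * g + 2)))"
      using C(2) N by (intro sum_mono) auto
    finally show ?thesis by (simp only: sum_distrib_right)
  qed
  moreover have "(\<Sum>i<g. C i) \<ge> 0" using C(1) by (intro sum_nonneg) auto
  ultimately show ?thesis by blast
qed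

text \<open>Abel summation by induction. The strengthened claim keeps the term
  \<open>W(n) / n\<close>, with \<open>W\<close> the partial sums; replacing its denominator by
  \<open>n + 1\<close> costs at most \<open>B\<close>.\<close>

lemma partial_summation_bound:
  fixes w :: "nat \<Rightarrow> real"
  assumes "B \<ge> 0" "\<And>n. n \<ge> 1 \<Longrightarrow> n \<le> N \<Longrightarrow> (\<Sum>m=1..n. w m) \<le> B * (real n)\<^sup>2"
  shows "(\<Sum>m=1..N. w m / real m) \<le> 2 * B * real N"
proof -
  have *: "(\<Sum>m=1..n. w m / real m) \<le> (\<Sum>m=1..n. w m) / real n + B * real n" if "n \<ge> 1" "n \<le> N" for n
    using that
  proof (induction n rule: dec_induct)
    case base
    then show ?case using assms(1) by simp
  next
    case (step n)
    let ?W = "\<Sum>m=1..n. w m"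
    have "?W / real n - ?W / real (Suc n) \<le> B"
    proof -
      have "?W / real n - ?W / real (Suc n) = ?W / (real n * real (Suc n))"
        using step(1) by (simp add: field_simps)
      also have "\<dots> \<le> B * (real n)\<^sup>2 / (real n * real (Suc n))"
        using assms(2)[of n] step by (intro divide_right_mono) auto
      also have "\<dots> = B * (real n / real (Suc n))" using step(1) by (simp add: power2_eq_square)
      also have "\<dots> \<le> B" using assms(1) by (intro mult_left_le) auto
      finally show ?thesis .
    qed
    then have "?W / real n + w (Suc n) / real (Suc n) \<le> (?W + w (Suc n)) / real (Suc n) + B"
      unfolding add_divide_distrib by linarith
    moreover have "(\<Sum>m=1..n. w m / real m) \<le> ?W / real n + B * real n" using step by simp
    ultimately show ?case by (simp add: algebra_simps)
  qed
  show ?thesis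
  proof (cases "N = 0")
    case False
    then have "(\<Sum>m=1..N. w m) / real N \<le> B * (real N)\<^sup>2 / real N"
      using assms(2)[of N] by (intro divide_right_mono) auto
    also have "\<dots> = B * real N" using False by (simp add: power2_eq_square)
    finally show ?thesis using *[of N] False by simp
  qed simp
qed

lemma snorm_pos: "p \<noteq> (0, 0) \<Longrightarrow> snorm p \<ge> 1"
  by (cases p) (auto simp: snorm_def)

text \<open>Grouping by sup norm reduces the plane to one dimension: the shells up to
  \<open>n\<close> make up the box \<open>sbox n\<close>.\<close>

lemma sum_div_snorm_le:
  fixes f :: "int \<times> int \<Rightarrow> real"
  assumes "B \<ge> 0" "\<And>n. n \<ge> 1 \<Longrightarrow> n \<le> N \<Longrightarrow> (\<Sum>p\<in>sbox n - {(0, 0)}. f p) \<le> B * (real n)\<^sup>2"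
  shows "(\<Sum>p\<in>sbox N - {(0, 0)}. f p / real_of_int (snorm p)) \<le> 2 * B * real N"
proof -
  define w where "w m = (\<Sum>p\<in>{p \<in> sbox N - {(0, 0)}. nat (snorm p) = m}. f p)" for m
  have grp: "(\<Sum>m=1..n. h m) = (\<Sum>p\<in>sbox n - {(0, 0)}. k p)"
    if n: "n \<le> N" and h: "\<And>m. h m = (\<Sum>p\<in>{p \<in> sbox N - {(0, 0)}. nat (snorm p) = m}. k p)" for n and h k :: "_ \<Rightarrow> real"
  proof -
    have "(\<Sum>m=1..n. h m) = (\<Sum>m=1..n. \<Sum>p\<in>{p \<in> sbox n - {(0, 0)}. nat (snorm p) = m}. k p)"
      unfolding h using n snorm_pos by (intro sum.cong refl) (force simp: mem_sbox_iff)
    also have "\<dots> = (\<Sum>p\<in>sbox n - {(0, 0)}. k p)"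
    proof (rule sum.group)
      show "(\<lambda>p. nat (snorm p)) ` (sbox n - {(0, 0)}) \<subseteq> {1..n}"
      proof (rule image_subsetI)
        fix p assume "p \<in> sbox n - {(0, 0)}"
        then have "snorm p \<le> int n" "snorm p \<ge> 1" using snorm_pos[of p] mem_sbox_iff[of p n] by blast+
        then show "nat (snorm p) \<in> {1..n}" by auto
      qed
    qed (simp_all add: finite_sbox)
    finally show ?thesis .
  qed
  have "(\<Sum>m=1..N. w m / real m) \<le> 2 * B * real N"
  proof (rule partial_summation_bound[OF assms(1)])
    fix n assume n: "n \<ge> 1" "n \<le> N"
    have "(\<Sum>m=1..n. w m) = (\<Sum>p\<in>sbox n - {(0, 0)}. f p)" using n(2) by (rule grp) (rule w_def)
    then show "(\<Sum>m=1..n. w m) \<le> B * (real n)\<^sup>2" using assms(2)[OF n] by simp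
  qed
  moreover have "(\<Sum>m=1..N. w m / real m) = (\<Sum>p\<in>sbox N - {(0, 0)}. f p / real_of_int (snorm p))"
  proof (rule grp)
    fix m
    have "f p / real m = f p / real_of_int (snorm p)" if "p \<noteq> (0, 0)" "nat (snorm p) = m" for p
      using snorm_pos[OF that(1)] that(2) by auto
    then show "w m / real m = (\<Sum>p\<in>{p \<in> sbox N - {(0, 0)}. nat (snorm p) = m}. f p / real_of_int (snorm p))"
      unfolding w_def sum_divide_distrib by (intro sum.cong) auto
  qed simp
  ultimately show ?thesis by simp
qed

lemma sum_tau_cubes_le:
  assumes "x \<ge> 1"
  shows "(\<Sum>n=1..nat \<lfloor>x\<rfloor>. real (tau n) ^ 3) \<le> x * (2 * ln (2 * x)) ^ 8"
proof -
  define X where "X = nat \<lfloor>x\<rfloor>"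
  have X: "X \<ge> 1" "real X \<le> x" using assms by (auto simp: X_def le_nat_iff of_nat_nat le_floor_iff)
  have "(\<Sum>n=1..X. real (tau n) ^ 3) \<le> (\<Sum>n=1..X. x * (real (tau n) ^ 3 / real n))"
  proof (rule sum_mono)
    fix n assume n: "n \<in> {1..X}"
    then have "1 \<le> x / real n" using X by (auto simp: le_divide_eq intro: order_trans[of _ "real X"])
    then have "1 * real (tau n) ^ 3 \<le> x / real n * real (tau n) ^ 3" by (intro mult_right_mono) auto
    then show "real (tau n) ^ 3 \<le> x * (real (tau n) ^ 3 / real n)" by simp
  qed
  also have "\<dots> = x * (\<Sum>n=1..X. real (tau n) ^ 3 / real n)" by (simp only: sum_distrib_left)
  also have "\<dots> \<le> x * harm X ^ (2 ^ 3)" using assms by (intro mult_left_mono sum_tau_power_div_le) auto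
  also have "\<dots> \<le> x * (2 * ln (2 * x)) ^ (2 ^ 3)"
  proof (intro mult_left_mono power_mono)
    have l2: "ln 2 \<ge> (1/2::real)" using ln2_ge_two_thirds by linarith
    have "harm X \<le> 1 + ln (real X)" using X by (intro harm_le_one_plus_ln) simp
    also have "\<dots> \<le> 1 + ln x" using X by simp
    also have "\<dots> \<le> 2 * (ln 2 + ln x)" 
    proof -
      have "1 \<le> 2 * ln (2::real)" "0 \<le> ln x" using l2 assms by simp_all
      then have "1 + ln x \<le> 2 * ln 2 + 2 * ln x" by simp
      then show ?thesis by (simp only: distrib_left)
    qed
    also have "\<dots> = 2 * ln (2 * x)" using assms by (simp add: ln_mult)
    finally show "harm X \<le> 2 * ln (2 * x)" .
  qed (use assms in \<open>auto simp: harm_nonneg\<close>)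
  finally show ?thesis by (simp add: X_def)
qed

section \<open>The error term\<close>

text \<open>Gauss's argument made explicit: for a primitive zero \<open>(r, s)\<close>,
  \<open>s\<close> divides \<open>a\<close> and \<open>r\<close> divides \<open>c\<close>, and the
  form splits over the integers as \<open>(s * x - r * y) * (\<alpha> * x - \<gamma> * y)\<close>.
  Both factors involve \<open>y\<close>, so neither is a unit.\<close>

lemma irreducible_qform_nonzero:
  assumes irr: "irreducible (qform_poly a b c)" and "a \<noteq> 0" "c \<noteq> 0" and p: "p \<noteq> (0, 0)"
  shows "qform a b c p \<noteq> 0"
proof
  assume q0: "qform a b c p = 0"
  obtain x y where xy: "p = (x, y)" by (cases p)
  define h where "h = gcd x y"
  have h: "h \<noteq> 0" using p by (auto simp: h_def xy)
  obtain r s where rs: "x = h * r" "y = h * s" "coprime r s"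
    using gcd_coprime_exists[of x y] h unfolding h_def by (metis mult.commute)
  have "h\<^sup>2 * qform a b c (r, s) = 0" using q0 by (simp add: xy rs(1,2) qform_scale)
  then have z: "a * r\<^sup>2 + 2 * b * r * s + c * s\<^sup>2 = 0" using h by (simp add: qform_def)
  have s0: "s \<noteq> 0"
  proof
    assume s: "s = 0"
    then have "r \<noteq> 0" using p xy rs by auto
    then show False using z s assms(2) by simp
  qed
  have r0: "r \<noteq> 0"
  proof
    assume r: "r = 0"
    then show False using z s0 assms(3) by simp
  qed
  have "s dvd a * r\<^sup>2"
  proof -
    have "a * r\<^sup>2 = s * (- 2 * b * r - c * s)" using z by (simp add: power2_eq_square algebra_simps)
    then show ?thesis by simp
  qed
  then have "s dvd a" using rs(3) by (simp add: coprime_dvd_mult_left_iff coprime_commute)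
  then obtain \<alpha> where al: "a = s * \<alpha>" by auto
  have "r dvd c * s\<^sup>2"
  proof -
    have "c * s\<^sup>2 = r * (- 2 * b * s - a * r)" using z by (simp add: power2_eq_square algebra_simps)
    then show ?thesis by simp
  qed
  then have "r dvd c" using rs(3) by (simp add: coprime_dvd_mult_left_iff coprime_commute)
  then obtain \<gamma> where ga: "c = r * \<gamma>" by auto
  have "r * s * (\<alpha> * r + 2 * b + \<gamma> * s) = 0" using z by (simp add: al ga power2_eq_square algebra_simps)
  then have b: "2 * b = - \<alpha> * r - \<gamma> * s" using r0 s0 by auto
  have "qform_poly a b c = [: [:0, s:], [:- r:] :] * [: [:0, \<alpha>:], [:- \<gamma>:] :]"
    unfolding qform_poly_def b al ga by (simp add: algebra_simps)
  then have "[: [:0, s:], [:- r:] :] dvd 1 \<or> [: [:0, \<alpha>:], [:- \<gamma>:] :] dvd (1 :: int poly poly)"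
    using irr by (simp add: irreducible_def)
  then show False using r0 assms(3) ga by (auto simp: is_unit_poly_iff)
qed

text \<open>The prime 2 is among the primes up to \<open>2 * g\<close>, and \<open>qdisc\<close> is
  four times \<open>qdet\<close>.\<close>

lemma bigD_good_form:
  assumes "g \<ge> 2" "bigD g a b c \<noteq> 0" "i < g" "irreducible (qform_poly (a i) (b i) (c i))"
  shows "good_form (bigD g a b c) (a i) (b i) (c i)"
proof -
  let ?S = "{p::nat. prime p \<and> p \<le> 2 * g}"
  have "finite ?S" by (rule finite_subset[of _ "{..2 * g}"]) auto
  then have "2 dvd \<Prod>?S" using assms(1) by (intro dvd_prodI[of ?S 2 "\<lambda>x. x", simplified]) auto
  then have "int 2 dvd int (\<Prod>?S)" unfolding int_dvd_int_iff .
  then have "even (bigD g a b c)" unfolding bigD_def by (intro dvd_mult2) simp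
  moreover have k: "a i * c i * qdisc (a i) (b i) (c i) dvd bigD g a b c"
  proof -
    have "a i * c i * qdisc (a i) (b i) (c i) dvd (\<Prod>k<g. a k * c k * qdisc (a k) (b k) (c k))"
      using assms(3) by (intro dvd_prodI) auto
    then show ?thesis unfolding bigD_def by (intro dvd_mult2 dvd_mult)
  qed
  moreover have "qdet (a i) (b i) (c i) dvd qdisc (a i) (b i) (c i)"
    by (intro dvdI[of _ _ 4]) (simp add: qdisc_def power2_eq_square)
  moreover have "a i \<noteq> 0" "c i \<noteq> 0" using k assms(2) by auto
  ultimately show ?thesis
    unfolding good_form_def using irreducible_qform_nonzero[OF assms(4)]
    by (auto intro: dvd_mult_left dvd_mult_right dvd_trans)
qed

lemma int_lattice_lat: "d > 0 \<Longrightarrow> j \<in> lat_idx \<Delta> d \<Longrightarrow> int_lattice (lat a b d j)"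
  unfolding int_lattice_def
  using multiples_in_lat[of d j \<Delta> 0 0 a b] lat_diff[of _ a b d j]
  by (auto simp: minus_prod_def)

lemma int_lattice_Inter:
  assumes "\<And>i. i \<in> A \<Longrightarrow> int_lattice (L i)"
  shows "int_lattice {p. \<forall>i\<in>A. p \<in> L i}"
  using assms by (auto simp: int_lattice_def)

text \<open>Chinese remainder theorem from \<open>s * P + t * D = 1\<close>. The point
  \<open>s * P * z\<close> lies in \<open>L\<close> and is congruent to \<open>z\<close> modulo
  \<open>D\<close>, so the residue class is a translate of \<open>L'\<close>. As \<open>D\<close> is
  invertible modulo \<open>P\<close>, scaling by \<open>D\<close> preserves membership in
  \<open>L\<close>; it maps one period of \<open>L\<close> onto one of \<open>L'\<close>, which
  divides the density by \<open>D\<^sup>2\<close>.\<close>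

lemma lattice_residue_class:
  fixes D P :: int
  assumes L: "int_lattice L" and P: "P > 0" "\<And>x y. P dvd x \<Longrightarrow> P dvd y \<Longrightarrow> (x, y) \<in> L"
    and cop: "coprime P D" and D: "D \<noteq> 0"
  defines "L' \<equiv> {p \<in> L. D dvd fst p \<and> D dvd snd p}"
  shows "int_lattice L'" "\<And>x y. P * \<bar>D\<bar> dvd x \<Longrightarrow> P * \<bar>D\<bar> dvd y \<Longrightarrow> (x, y) \<in> L'"
    "card (L' \<inter> box_points (P * \<bar>D\<bar>)) = card (L \<inter> box_points P)"
    "\<exists>z0. \<forall>p. p - z0 \<in> L' \<longleftrightarrow> p \<in> L \<and> p \<in> Psi D z"
proof -
  show "int_lattice L'" using L by (auto simp: L'_def int_lattice_def)
  show "(x, y) \<in> L'" if "P * \<bar>D\<bar> dvd x" "P * \<bar>D\<bar> dvd y" for x y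
  proof -
    have "P dvd x" "P dvd y" "\<bar>D\<bar> dvd x" "\<bar>D\<bar> dvd y" using that by (auto intro: dvd_mult_left dvd_mult_right)
    then show ?thesis using P(2) by (simp add: L'_def)
  qed
  obtain s t where st: "s * P + t * D = 1" using cop bezout_int[of P D] by (auto simp: coprime_iff_gcd_eq_1)
  have unscale: "q \<in> L" if "(D * fst q, D * snd q) \<in> L" for q
  proof -
    have "q = lcomb t (D * fst q, D * snd q) 1 (s * P * fst q, s * P * snd q)"
    proof -
      have "(s * P + t * D) * x = t * (D * x) + s * P * x" for x by (simp add: algebra_simps)
      then show ?thesis using st by (simp add: lcomb_def prod_eq_iff)
    qed
    moreover have "(s * P * fst q, s * P * snd q) \<in> L" by (intro P(2)) auto
    ultimately show ?thesis using lattice_lcomb[OF L that] by metis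
  qed
  have scale: "(D * fst q, D * snd q) \<in> L" if "q \<in> L" for q
    using lattice_lcomb[OF L that that, of D 0] by (simp add: lcomb_def)
  have absD: "\<bar>D\<bar> > 0" using D by simp
  have sgn: "(\<bar>D\<bar> * x, \<bar>D\<bar> * y) \<in> L \<longleftrightarrow> (x, y) \<in> L" for x y
  proof (cases "D > 0")
    case True
    then show ?thesis using scale[of "(x, y)"] unscale[of "(x, y)"] by auto
  next
    case False
    have neg: "(- u, - w) \<in> L" if "(u, w) \<in> L" for u w
      using lattice_lcomb[OF L that that, of "-1" 0] by (simp add: lcomb_def)
    have "(\<bar>D\<bar> * x, \<bar>D\<bar> * y) \<in> L \<longleftrightarrow> (D * x, D * y) \<in> L"
      using False neg[of "D * x" "D * y"] neg[of "- (D * x)" "- (D * y)"] by auto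
    then show ?thesis using scale[of "(x, y)"] unscale[of "(x, y)"] by auto
  qed
  have "bij_betw (\<lambda>q. (\<bar>D\<bar> * fst q, \<bar>D\<bar> * snd q)) (L \<inter> box_points P) (L' \<inter> box_points (P * \<bar>D\<bar>))"
    unfolding bij_betw_def
  proof
    show "inj_on (\<lambda>q. (\<bar>D\<bar> * fst q, \<bar>D\<bar> * snd q)) (L \<inter> box_points P)"
      using D by (auto simp: inj_on_def)
    show "(\<lambda>q. (\<bar>D\<bar> * fst q, \<bar>D\<bar> * snd q)) ` (L \<inter> box_points P) = L' \<inter> box_points (P * \<bar>D\<bar>)"
    proof (intro equalityI subsetI)
      fix p assume "p \<in> (\<lambda>q. (\<bar>D\<bar> * fst q, \<bar>D\<bar> * snd q)) ` (L \<inter> box_points P)"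
      then obtain q where q: "p = (\<bar>D\<bar> * fst q, \<bar>D\<bar> * snd q)" "q \<in> L" "q \<in> box_points P" by blast
      obtain x y where "q = (x, y)" by (cases q)
      then have xy: "p = (\<bar>D\<bar> * x, \<bar>D\<bar> * y)" "(x, y) \<in> L" "(x, y) \<in> box_points P" using q by simp_all
      have "\<bar>D\<bar> * u < P * \<bar>D\<bar> \<longleftrightarrow> u < P" for u using absD by (simp add: mult.commute[of P])
      then show "p \<in> L' \<inter> box_points (P * \<bar>D\<bar>)"
        using xy sgn[of x y] by (simp add: L'_def box_points_def)
    next
      fix p assume p: "p \<in> L' \<inter> box_points (P * \<bar>D\<bar>)"
      then have "\<bar>D\<bar> dvd fst p" "\<bar>D\<bar> dvd snd p" by (auto simp: L'_def)
      then obtain x y where "fst p = \<bar>D\<bar> * x" "snd p = \<bar>D\<bar> * y" unfolding dvd_def by blast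
      then have xy: "p = (\<bar>D\<bar> * x, \<bar>D\<bar> * y)" by (simp add: prod_eq_iff)
      have u: "u \<in> {0..<P}" if "\<bar>D\<bar> * u \<in> {0..<P * \<bar>D\<bar>}" for u
        using that absD by (simp add: mult.commute[of P] zero_le_mult_iff)
      have "(x, y) \<in> L" using p sgn[of x y] unfolding xy L'_def by blast
      moreover have "x \<in> {0..<P}" "y \<in> {0..<P}" using p unfolding xy box_points_def by (intro u; blast)+
      ultimately have "(x, y) \<in> L \<inter> box_points P" unfolding box_points_def by blast
      then show "p \<in> (\<lambda>q. (\<bar>D\<bar> * fst q, \<bar>D\<bar> * snd q)) ` (L \<inter> box_points P)"
        unfolding xy by (intro image_eqI[of _ _ "(x, y)"]) auto
    qed
  qed
  then show "card (L' \<inter> box_points (P * \<bar>D\<bar>)) = card (L \<inter> box_points P)"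
    by (simp add: bij_betw_same_card)
  define z0 where "z0 = (s * P * fst z, s * P * snd z)"
  have z0L: "z0 \<in> L" unfolding z0_def by (intro P(2)) auto
  have zD: "D dvd u - s * P * w \<longleftrightarrow> [u = w] (mod D)" for u w
  proof -
    have "s * P * w = w - D * (t * w)" using arg_cong[OF st, of "\<lambda>r. r * w"] by (simp add: algebra_simps)
    then have eq: "u - s * P * w = (u - w) + D * (t * w)" by simp
    show ?thesis unfolding cong_iff_dvd_diff eq by (rule dvd_add_left_iff) simp
  qed
  have "p - z0 \<in> L \<longleftrightarrow> p \<in> L" for p
  proof
    assume "p - z0 \<in> L"
    then have "lcomb 1 (p - z0) 1 z0 \<in> L" using lattice_lcomb[OF L _ z0L] by blast
    then show "p \<in> L" by (simp add: lcomb_def)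
  next
    assume "p \<in> L" then show "p - z0 \<in> L" using L z0L by (simp add: int_lattice_def)
  qed
  then show "\<exists>z0. \<forall>p. p - z0 \<in> L' \<longleftrightarrow> p \<in> L \<and> p \<in> Psi D z"
    by (intro exI[of _ z0]) (simp add: L'_def Psi_def zD z0_def)
qed

section \<open>The error for one vector of moduli\<close>

lemma rho_eq: "rho g a b c d = card (Lam g a b c d \<inter> box_points (int (\<Prod>i<g. d i)))"
  unfolding rho_def box_points_def by (rule arg_cong[of _ _ card]) auto

definition gidx :: "nat \<Rightarrow> (nat \<Rightarrow> int) \<Rightarrow> (nat \<Rightarrow> int) \<Rightarrow> (nat \<Rightarrow> int) \<Rightarrow> (nat \<Rightarrow> nat) \<Rightarrow>
    (nat \<Rightarrow> nat \<times> int \<times> nat set) set" where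
  "gidx g a b c d = (\<Pi>\<^sub>E i\<in>{..<g}. lat_idx (qdet (a i) (b i) (c i)) (d i))"

lemma finite_gidx: "(\<And>i. i < g \<Longrightarrow> d i > 0) \<Longrightarrow> finite (gidx g a b c d)"
  unfolding gidx_def by (intro finite_PiE finite_lat_idx) auto

lemma card_gidx_le:
  assumes "\<And>i. i < g \<Longrightarrow> d i > 0 \<and> coprime (int (d i)) D \<and> good_form D (a i) (b i) (c i)"
  shows "card (gidx g a b c d) \<le> (\<Prod>i<g. tau (d i) ^ 3)"
proof -
  have "card (lat_idx (qdet (a i) (b i) (c i)) (d i)) \<le> tau (d i) ^ 3" if "i < g" for i
    using card_lat_idx_le[of "d i" "qdet (a i) (b i) (c i)"] assms[OF that]
      good_form_coprime[of D "a i" "b i" "c i" "d i"] by simp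
  then show ?thesis unfolding gidx_def by (subst card_PiE) (auto intro!: prod_mono)
qed

text \<open>Point count and \<open>rho\<close> are expanded with the same signs, so the error is a
  signed sum of errors of single lattices, each bounded through its own shortest vector.
  \<open>V\<close> is chosen before \<open>M\<close> and \<open>R\<close>, as the supremum
  demands.\<close>

lemma err_bound:
  assumes D: "D = bigD g a b c" "D \<noteq> 0"
    and d: "\<And>i. i < g \<Longrightarrow> d i > 0 \<and> coprime (int (d i)) D \<and> good_form D (a i) (b i) (c i)"
  shows "\<exists>V. (\<forall>J\<in>gidx g a b c d. V J \<in> Lam g a b c d \<and> V J \<noteq> (0, 0)) \<and>
    (\<forall>M R. R \<in> regions M \<longrightarrow>
       err g a b c z d R \<le> (\<Sum>J\<in>gidx g a b c d. 36 * (1 + M / real_of_int (snorm (V J)))))"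
proof -
  define P where "P = (\<Prod>i<g. d i)"
  have Ppos: "P > 0" using d by (auto simp: P_def)
  define I where "I = gidx g a b c d"
  have finI: "finite I" unfolding I_def using d by (intro finite_gidx) auto
  define L where "L J = {p. \<forall>i\<in>{..<g}. p \<in> lat (a i) (b i) (d i) (J i)}" for J
  define sg where "sg J = (\<Prod>i<g. lat_sign (J i))" for J
  have sg1: "\<bar>real_of_int (sg J)\<bar> = 1" for J
    by (simp add: sg_def lat_sign_def abs_prod power_abs split_beta)
  have idx: "J i \<in> lat_idx (qdet (a i) (b i) (c i)) (d i)" if "J \<in> I" "i < g" for J i
    using that by (auto simp: I_def gidx_def)
  have latL: "int_lattice (L J)" if "J \<in> I" for J
    unfolding L_def using idx[OF that] d by (intro int_lattice_Inter int_lattice_lat) auto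
  have PL: "(x, y) \<in> L J" if JP: "J \<in> I" "int P dvd x" "int P dvd y" for J x y
  proof -
    have "(x, y) \<in> lat (a i) (b i) (d i) (J i)" if i: "i < g" for i
    proof -
      have "int (d i) dvd int P"
        unfolding P_def int_dvd_int_iff using i by (intro dvd_prodI) auto
      then have "int (d i) dvd x" "int (d i) dvd y" using JP(2,3) by (auto intro: dvd_trans)
      then show ?thesis using d[OF i] idx[OF JP(1) i] multiples_in_lat by blast
    qed
    then show ?thesis by (simp add: L_def)
  qed
  have LLam: "L J \<subseteq> Lam g a b c d" if J: "J \<in> I" for J
  proof
    fix p assume p: "p \<in> L J"
    have "int (d i) dvd qform (a i) (b i) (c i) p" if i: "i < g" for i
    proof (rule lat_subset[OF _ _ idx[OF J i]])
      show "d i > 0" "coprime (a i) (int (d i))" using d[OF i] good_form_coprime(2) by blast+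
      show "p \<in> lat (a i) (b i) (d i) (J i)" using p i by (simp add: L_def)
    qed
    then show "p \<in> Lam g a b c d" by (simp add: Lam_def)
  qed
  have indicator: "(\<Sum>J\<in>I. sg J * of_bool (p \<in> L J)) = of_bool (p \<in> Lam g a b c d)" for p
  proof -
    have pb: "(\<Prod>i<g. of_bool (Q i)) = (of_bool (\<forall>i<g. Q i) :: int)" for Q :: "nat \<Rightarrow> bool"
      by (induction g) (auto simp: less_Suc_eq)
    have "(\<Sum>J\<in>I. sg J * of_bool (p \<in> L J)) =
      (\<Sum>J\<in>I. \<Prod>i<g. lat_sign (J i) * of_bool (p \<in> lat (a i) (b i) (d i) (J i)))"
      unfolding prod.distrib pb sg_def L_def by (intro sum.cong) auto
    also have "\<dots> = (\<Prod>i<g. \<Sum>j\<in>lat_idx (qdet (a i) (b i) (c i)) (d i). lat_sign j * of_bool (p \<in> lat (a i) (b i) (d i) j))"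
      unfolding I_def gidx_def using d by (intro prod_sum_PiE[symmetric] finite_lat_idx) auto
    also have "\<dots> = (\<Prod>i<g. of_bool (int (d i) dvd qform (a i) (b i) (c i) p))"
    proof (intro prod.cong refl sum_lat_sign)
      fix i assume "i \<in> {..<g}"
      then show "d i > 0" "coprime (a i) (int (d i))" using d[of i] good_form_coprime(2) by blast+
    qed
    also have "\<dots> = of_bool (p \<in> Lam g a b c d)" unfolding pb by (simp add: Lam_def)
    finally show ?thesis .
  qed
  have count: "real (card {p \<in> F. p \<in> Lam g a b c d}) = (\<Sum>J\<in>I. sg J * real (card {p \<in> F. p \<in> L J}))"
    if "finite F" for F
  proof -
    have c1: "int (card {p \<in> F. p \<in> A}) = (\<Sum>p\<in>F. of_bool (p \<in> A))" for A
      using that by (simp add: of_bool_def sum.If_cases Int_def)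
    have "int (card {p \<in> F. p \<in> Lam g a b c d}) = (\<Sum>p\<in>F. \<Sum>J\<in>I. sg J * of_bool (p \<in> L J))"
      unfolding c1 indicator ..
    also have "\<dots> = (\<Sum>J\<in>I. sg J * int (card {p \<in> F. p \<in> L J}))"
      unfolding c1 by (subst sum.swap) (simp only: sum_distrib_left)
    finally have "real_of_int (int (card {p \<in> F. p \<in> Lam g a b c d})) = real_of_int (\<Sum>J\<in>I. sg J * int (card {p \<in> F. p \<in> L J}))"
      by (rule arg_cong)
    then show ?thesis by simp
  qed
  have cop: "coprime (int P) D" unfolding P_def of_nat_prod using d by (intro prod_coprime_left) auto
  define L' where "L' J = {p \<in> L J. D dvd fst p \<and> D dvd snd p}" for J
  note rc = lattice_residue_class[OF latL _ PL cop D(2), folded L'_def]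
  define e where "e = P * nat \<bar>D\<bar>"
  have e: "int e = int P * \<bar>D\<bar>" "e \<ge> 1" using Ppos D(2) by (auto simp: e_def Suc_le_eq)
  define good where "good J v \<longleftrightarrow> v \<in> L' J \<and> v \<noteq> (0, 0) \<and> (\<forall>M R z. R \<in> regions M \<longrightarrow>
     finite {p. p - z \<in> L' J \<and> to_real2 p \<in> R} \<and>
     \<bar>real (card {p. p - z \<in> L' J \<and> to_real2 p \<in> R})
        - measure lebesgue R * real (card (L' J \<inter> box_points (int e))) / (real e)\<^sup>2\<bar>
      \<le> 36 * (1 + M / real_of_int (snorm v)))" for J v
  have "\<exists>v. good J v" if J: "J \<in> I" for J
    unfolding good_def
  proof (rule lattice_point_count[OF rc(1)[OF J _ J] e(2)])
    show "0 < int P" using Ppos by simp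
    show "(x, y) \<in> L' J" if "int e dvd x" "int e dvd y" for x y
      using rc(2)[OF J _ J] Ppos that unfolding e(1) by simp
  qed
  then have "\<forall>J\<in>I. \<exists>v. good J v" by blast
  from bchoice[OF this] obtain V where V: "\<And>J. J \<in> I \<Longrightarrow> good J (V J)" by blast
  have VL: "V J \<in> Lam g a b c d \<and> V J \<noteq> (0, 0)" if "J \<in> I" for J
    using V[OF that] LLam[OF that] unfolding good_def L'_def by blast
  have "err g a b c z d R \<le> (\<Sum>J\<in>I. 36 * (1 + M / real_of_int (snorm (V J))))" if R: "R \<in> regions M" for M R
  proof -
    \<comment> \<open>The full integer plane with modulus 1 gives finiteness of the integer points
      in \<open>R\<close>, which the exchange of sums requires.\<close>
    have "int_lattice UNIV" by (simp add: int_lattice_def)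
    then have finR: "finite {p. to_real2 p \<in> R}"
      using lattice_point_count[of UNIV 1] R by fastforce
    define F where "F = {p. to_real2 p \<in> R \<and> p \<in> Psi D z}"
    have finF: "finite F" using finR by (rule rev_finite_subset) (auto simp: F_def)
    define \<mu> where "\<mu> = measure lebesgue R"
    have eD: "(real e)\<^sup>2 = (real P * real_of_int D)\<^sup>2"
      using D(2) by (simp add: e_def power_mult_distrib)
    have s1: "real (card {p \<in> Lam g a b c d \<inter> Psi D z. to_real2 p \<in> R}) = (\<Sum>J\<in>I. sg J * real (card {p \<in> F. p \<in> L J}))"
    proof -
      have "{p \<in> Lam g a b c d \<inter> Psi D z. to_real2 p \<in> R} = {p \<in> F. p \<in> Lam g a b c d}" by (auto simp: F_def)
      then show ?thesis using count[OF finF] by simp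
    qed
    \<comment> \<open>Passing from \<open>L J\<close> to \<open>L' J\<close> keeps the count and
      enlarges the period from \<open>P\<close> to \<open>e\<close>, so the denominator of the main
      term becomes \<open>e\<^sup>2\<close>.\<close>
    have s2: "real (rho g a b c d) = (\<Sum>J\<in>I. sg J * real (card (L' J \<inter> box_points (int e))))"
    proof -
      have fb: "finite (box_points (int P))" by (simp add: box_points_def)
      have sw: "{p \<in> box_points (int P). p \<in> A} = A \<inter> box_points (int P)" for A by auto
      have "real (rho g a b c d) = (\<Sum>J\<in>I. sg J * real (card (L J \<inter> box_points (int P))))"
        using count[OF fb] unfolding rho_eq P_def[symmetric] sw .
      also have "\<dots> = (\<Sum>J\<in>I. sg J * real (card (L' J \<inter> box_points (int e))))"
        using rc(3) Ppos e(1) by (intro sum.cong) auto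
      finally show ?thesis .
    qed
    have "err g a b c z d R = \<bar>(\<Sum>J\<in>I. sg J * real (card {p \<in> F. p \<in> L J})) -
        \<mu> * (\<Sum>J\<in>I. sg J * real (card (L' J \<inter> box_points (int e)))) / (real e)\<^sup>2\<bar>"
      unfolding err_def Let_def D(1)[symmetric] P_def[symmetric] s1 s2 eD \<mu>_def ..
    also have "\<dots> = \<bar>\<Sum>J\<in>I. sg J * (real (card {p \<in> F. p \<in> L J}) - \<mu> * real (card (L' J \<inter> box_points (int e))) / (real e)\<^sup>2)\<bar>"
      by (simp add: sum_distrib_left sum_divide_distrib sum_subtractf right_diff_distrib mult.left_commute)
    also have "\<dots> \<le> (\<Sum>J\<in>I. \<bar>sg J * (real (card {p \<in> F. p \<in> L J}) - \<mu> * real (card (L' J \<inter> box_points (int e))) / (real e)\<^sup>2)\<bar>)"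
      by (rule sum_abs)
    also have "\<dots> \<le> (\<Sum>J\<in>I. 36 * (1 + M / real_of_int (snorm (V J))))"
    proof (rule sum_mono)
      fix J assume J: "J \<in> I"
      obtain z0 where z0: "\<And>p. p - z0 \<in> L' J \<longleftrightarrow> p \<in> L J \<and> p \<in> Psi D z"
        using rc(4)[OF J _ J, of z] Ppos unfolding of_nat_0_less_iff by blast
      have "{p \<in> F. p \<in> L J} = {p. p - z0 \<in> L' J \<and> to_real2 p \<in> R}" by (auto simp: F_def z0)
      note eq = this
      have "\<bar>real (card {p \<in> F. p \<in> L J}) - \<mu> * real (card (L' J \<inter> box_points (int e))) / (real e)\<^sup>2\<bar>
          \<le> 36 * (1 + M / real_of_int (snorm (V J)))"
        using V[OF J] R unfolding \<mu>_def good_def eq by blast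
      then show "\<bar>sg J * (real (card {p \<in> F. p \<in> L J}) - \<mu> * real (card (L' J \<inter> box_points (int e))) / (real e)\<^sup>2)\<bar>
          \<le> 36 * (1 + M / real_of_int (snorm (V J)))"
        by (simp add: abs_mult sg1)
    qed
    finally show ?thesis .
  qed
  then show ?thesis using VL unfolding I_def by blast
qed

text \<open>The short vectors are sorted by their value \<open>p\<close>: since \<open>d i\<close> divides \<open>q\<^sub>i(p)\<close>, few \<open>d\<close> share one.\<close>
lemma sum_inverse_short_vectors_le:
  assumes gf: "\<And>i. i < g \<Longrightarrow> good_form D (a i) (b i) (c i)"
    and S: "finite S" "\<And>d i. d \<in> S \<Longrightarrow> i < g \<Longrightarrow> d i > 0 \<and> coprime (int (d i)) D"
      "\<And>d. d \<in> S \<Longrightarrow> d \<in> extensional {..<g}"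
    and V: "\<And>d J. d \<in> S \<Longrightarrow> J \<in> gidx g a b c d \<Longrightarrow> V d J \<in> Lam g a b c d \<and> V d J \<noteq> (0, 0)"
  shows "(\<Sum>d\<in>S. \<Sum>J\<in>gidx g a b c d. of_bool (V d J \<in> sbox N) / real_of_int (snorm (V d J)))
    \<le> (\<Sum>p\<in>sbox N - {(0, 0)}. (\<Prod>i<g. real (tauc D (qform (a i) (b i) (c i) p)) ^ 4) / real_of_int (snorm p))"
proof -
  let ?P = "sbox N - {(0, 0)}" and ?G = "gidx g a b c"
  have fG: "finite (?G d)" if "d \<in> S" for d using S(2)[OF that] by (intro finite_gidx) auto
  have "(\<Sum>d\<in>S. \<Sum>J\<in>?G d. of_bool (V d J \<in> sbox N) / real_of_int (snorm (V d J))) =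
    (\<Sum>d\<in>S. \<Sum>J\<in>?G d. \<Sum>p\<in>?P. of_bool (V d J = p) / real_of_int (snorm p))"
  proof (intro sum.cong refl)
    fix d J assume dJ: "d \<in> S" "J \<in> ?G d"
    have "(\<Sum>p\<in>?P. of_bool (V d J = p) / real_of_int (snorm p)) =
        (\<Sum>p\<in>?P. if p = V d J then 1 / real_of_int (snorm p) else 0)"
      by (intro sum.cong) auto
    also have "\<dots> = of_bool (V d J \<in> sbox N) / real_of_int (snorm (V d J))"
      using V[OF dJ] finite_sbox by simp
    finally show "of_bool (V d J \<in> sbox N) / real_of_int (snorm (V d J)) =
      (\<Sum>p\<in>?P. of_bool (V d J = p) / real_of_int (snorm p))" by simp
  qed
  also have "\<dots> = (\<Sum>d\<in>S. \<Sum>p\<in>?P. \<Sum>J\<in>?G d. of_bool (V d J = p) / real_of_int (snorm p))"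
    by (intro sum.cong refl sum.swap)
  also have "\<dots> = (\<Sum>p\<in>?P. \<Sum>d\<in>S. \<Sum>J\<in>?G d. of_bool (V d J = p) / real_of_int (snorm p))"
    by (rule sum.swap)
  also have "\<dots> \<le> (\<Sum>p\<in>?P. (\<Prod>i<g. real (tauc D (qform (a i) (b i) (c i) p)) ^ 4) / real_of_int (snorm p))"
  proof (rule sum_mono)
    fix p assume p: "p \<in> ?P"
    let ?q = "\<lambda>i. qform (a i) (b i) (c i) p"
    have q0: "?q i \<noteq> 0" if "i < g" for i using gf[OF that] p unfolding good_form_def by blast
    define E where "E i = {n::nat. int n dvd ?q i \<and> coprime (int n) D}" for i
    have finE: "finite (E i)" if "i < g" for i
      using finite_int_divisors[OF q0[OF that]] by (rule rev_finite_subset) (auto simp: E_def)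
    have tE: "tau n \<le> tauc D (?q i)" if "n \<in> E i" "i < g" for n i
      unfolding tau_def tauc_def
    proof (rule card_mono)
      show "finite {d::nat. int d dvd ?q i \<and> coprime (int d) D}" using finE[OF that(2)] by (simp add: E_def)
      show "{d. d dvd n} \<subseteq> {d::nat. int d dvd ?q i \<and> coprime (int d) D}"
      proof
        fix m assume "m \<in> {d. d dvd n}"
        then have "int m dvd int n" by simp
        moreover have "int n dvd ?q i" "coprime (int n) D" using that(1) by (auto simp: E_def)
        ultimately show "m \<in> {d::nat. int d dvd ?q i \<and> coprime (int d) D}"
          using coprime_divisors[of "int m" "int n" D D] by (auto intro: dvd_trans)
      qed
    qed
    have s1: "(\<Sum>d\<in>S. \<Sum>J\<in>?G d. of_bool (V d J = p)) \<le> (\<Sum>d\<in>S. of_bool (p \<in> Lam g a b c d) * (\<Prod>i<g. real (tau (d i)) ^ 3))"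
    proof (rule sum_mono)
      fix d assume d: "d \<in> S"
      show "(\<Sum>J\<in>?G d. of_bool (V d J = p)) \<le> of_bool (p \<in> Lam g a b c d) * (\<Prod>i<g. real (tau (d i)) ^ 3)"
      proof (cases "p \<in> Lam g a b c d")
        case True
        have "(\<Sum>J\<in>?G d. of_bool (V d J = p)) \<le> (\<Sum>J\<in>?G d. (1::real))" by (intro sum_mono) auto
        also have "\<dots> = real (card (?G d))" by simp
        also have "\<dots> \<le> real (\<Prod>i<g. tau (d i) ^ 3)"
          using S(2)[OF d] gf by (intro of_nat_mono card_gidx_le) auto
        finally show ?thesis using True by simp
      next
        case False
        then have "V d J \<noteq> p" if "J \<in> ?G d" for J using V[OF d that] by auto
        then show ?thesis using False by (simp add: of_bool_def)
      qed
    qed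
    have s2: "(\<Sum>d\<in>S. of_bool (p \<in> Lam g a b c d) * (\<Prod>i<g. real (tau (d i)) ^ 3)) =
      (\<Sum>d\<in>{d \<in> S. p \<in> Lam g a b c d}. \<Prod>i<g. real (tau (d i)) ^ 3)"
      using S(1) by (intro sum.mono_neutral_cong_right) auto
    \<comment> \<open>Enlarging the range to all vectors of admissible divisors, without the bounds
      \<open>Q i\<close>, makes the sum a product over the forms.\<close>
    have s3: "(\<Sum>d\<in>{d \<in> S. p \<in> Lam g a b c d}. \<Prod>i<g. real (tau (d i)) ^ 3) \<le>
      (\<Sum>d\<in>(\<Pi>\<^sub>E i\<in>{..<g}. E i). \<Prod>i<g. real (tau (d i)) ^ 3)"
    proof (rule sum_mono2)
      show "finite (\<Pi>\<^sub>E i\<in>{..<g}. E i)" using finE by (intro finite_PiE) auto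
      show "{d \<in> S. p \<in> Lam g a b c d} \<subseteq> (\<Pi>\<^sub>E i\<in>{..<g}. E i)"
      proof (intro subsetI PiE_I)
        fix d i assume d: "d \<in> {d \<in> S. p \<in> Lam g a b c d}"
        show "d i \<in> E i" if "i \<in> {..<g}" using d that S(2)[of d i] by (simp add: E_def Lam_def)
        show "d i = undefined" if "i \<notin> {..<g}" using d that S(3)[of d] by (auto simp: extensional_def)
      qed
    qed (rule prod_nonneg, simp)
    have s4: "(\<Sum>d\<in>(\<Pi>\<^sub>E i\<in>{..<g}. E i). \<Prod>i<g. real (tau (d i)) ^ 3) = (\<Prod>i<g. \<Sum>n\<in>E i. real (tau n) ^ 3)"
      by (rule prod_sum_PiE[where f = "\<lambda>i n. real (tau n) ^ 3", symmetric]) (simp_all add: finE)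
    \<comment> \<open>There are \<open>tauc\<close> many divisors, each with at most
      \<open>tauc\<close> divisors of its own: the fourth power is one plus three.\<close>
    have s5i: "(\<Sum>n\<in>E i. real (tau n) ^ 3) \<le> real (tauc D (?q i)) ^ 4" if i: "i < g" for i
    proof -
      have "real (tau n) ^ 3 \<le> real (tauc D (?q i)) ^ 3" if "n \<in> E i" for n
        using tE[OF that i] by (simp add: power_mono)
      then have "(\<Sum>n\<in>E i. real (tau n) ^ 3) \<le> (\<Sum>n\<in>E i. real (tauc D (?q i)) ^ 3)"
        by (rule sum_mono)
      also have "\<dots> = real (tauc D (?q i)) * real (tauc D (?q i)) ^ 3" by (simp add: tauc_def E_def)
      also have "\<dots> = real (tauc D (?q i)) ^ 4" by (simp flip: power_Suc)
      finally show ?thesis .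
    qed
    have s5: "(\<Prod>i<g. \<Sum>n\<in>E i. real (tau n) ^ 3) \<le> (\<Prod>i<g. real (tauc D (?q i)) ^ 4)"
      using s5i by (intro prod_mono conjI sum_nonneg) simp_all
    have "(\<Sum>d\<in>S. \<Sum>J\<in>?G d. of_bool (V d J = p)) \<le> (\<Prod>i<g. real (tauc D (?q i)) ^ 4)"
      using order_trans[OF s1[unfolded s2] order_trans[OF s3[unfolded s4] s5]] .
    moreover have "real_of_int (snorm p) > 0" using snorm_pos[of p] p by auto
    ultimately show "(\<Sum>d\<in>S. \<Sum>J\<in>?G d. of_bool (V d J = p) / real_of_int (snorm p)) \<le>
        (\<Prod>i<g. real (tauc D (?q i)) ^ 4) / real_of_int (snorm p)"
      unfolding sum_divide_distrib[symmetric] by (intro divide_right_mono) auto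
  qed
  finally show ?thesis .
qed

text \<open>After dropping coprimality the sum factors over \<open>i\<close>; each sum of cubes of
  tau contributes \<open>2 ^ 3 = 8\<close> logarithms, whence \<open>8 * g\<close>.\<close>

lemma sum_card_gidx_le:
  assumes gf: "\<And>i. i < g \<Longrightarrow> good_form D (a i) (b i) (c i)" and Q: "\<And>i. i < g \<Longrightarrow> Q i \<ge> 1"
  shows "(\<Sum>d\<in>{d \<in> (\<Pi>\<^sub>E i\<in>{..<g}. {1..nat \<lfloor>Q i\<rfloor>}). \<forall>i<g. coprime (int (d i)) D}. real (card (gidx g a b c d)))
    \<le> (\<Prod>i<g. Q i) * (2 * ln (2 * (\<Prod>i<g. Q i))) ^ (8 * g)"
proof -
  let ?S = "{d \<in> (\<Pi>\<^sub>E i\<in>{..<g}. {1..nat \<lfloor>Q i\<rfloor>}). \<forall>i<g. coprime (int (d i)) D}"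
  let ?L = "2 * ln (2 * (\<Prod>i<g. Q i))"
  have Qle: "Q i \<le> (\<Prod>i<g. Q i)" if "i < g" for i
  proof -
    have "(\<Prod>j\<in>{i}. Q j) \<le> (\<Prod>j<g. Q j)"
      using that Q by (intro prod_mono2) (auto intro: order_trans[OF zero_le_one])
    then show ?thesis by simp
  qed
  have "(\<Sum>d\<in>?S. real (card (gidx g a b c d))) \<le> (\<Sum>d\<in>?S. \<Prod>i<g. real (tau (d i)) ^ 3)"
  proof (rule sum_mono)
    fix d assume d: "d \<in> ?S"
    have "d i > 0" if "i < g" for i
    proof -
      have "d \<in> (\<Pi>\<^sub>E i\<in>{..<g}. {1..nat \<lfloor>Q i\<rfloor>})" using d by blast
      then have "d i \<in> {1..nat \<lfloor>Q i\<rfloor>}" by (rule PiE_mem) (simp add: that)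
      then show ?thesis by simp
    qed
    then have "card (gidx g a b c d) \<le> (\<Prod>i<g. tau (d i) ^ 3)"
      using d gf by (intro card_gidx_le) auto
    then have "real (card (gidx g a b c d)) \<le> real (\<Prod>i<g. tau (d i) ^ 3)" by (rule of_nat_mono)
    then show "real (card (gidx g a b c d)) \<le> (\<Prod>i<g. real (tau (d i)) ^ 3)" by simp
  qed
  also have "\<dots> \<le> (\<Sum>d\<in>(\<Pi>\<^sub>E i\<in>{..<g}. {1..nat \<lfloor>Q i\<rfloor>}). \<Prod>i<g. real (tau (d i)) ^ 3)"
  proof (rule sum_mono2)
    show "?S \<subseteq> (\<Pi>\<^sub>E i\<in>{..<g}. {1..nat \<lfloor>Q i\<rfloor>})" by blast
  qed (simp_all add: finite_PiE prod_nonneg)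
  also have "\<dots> = (\<Prod>i<g. \<Sum>n=1..nat \<lfloor>Q i\<rfloor>. real (tau n) ^ 3)"
    by (rule prod_sum_PiE[where f = "\<lambda>i n. real (tau n) ^ 3", symmetric]) simp_all
  also have "\<dots> \<le> (\<Prod>i<g. Q i * ?L ^ 8)"
  proof (rule prod_mono, rule conjI)
    fix i assume "i \<in> {..<g}"
    then have i: "i < g" by simp
    show "0 \<le> (\<Sum>n=1..nat \<lfloor>Q i\<rfloor>. real (tau n) ^ 3)" by (intro sum_nonneg) auto
    have "(\<Sum>n=1..nat \<lfloor>Q i\<rfloor>. real (tau n) ^ 3) \<le> Q i * (2 * ln (2 * Q i)) ^ 8"
      by (rule sum_tau_cubes_le[OF Q[OF i]])
    also have "\<dots> \<le> Q i * ?L ^ 8"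
      using Q[OF i] Qle[OF i] by (intro mult_left_mono power_mono) auto
    finally show "(\<Sum>n=1..nat \<lfloor>Q i\<rfloor>. real (tau n) ^ 3) \<le> Q i * ?L ^ 8" .
  qed
  also have "\<dots> = (\<Prod>i<g. Q i) * ?L ^ (8 * g)"
    by (simp add: prod.distrib power_mult)
  finally show ?thesis .
qed

text \<open>\<open>T1\<close> counts all lattices and \<open>T2\<close> sums
  \<open>1 / snorm\<close> over those with a short vector. Long vectors cost
  \<open>M * T1 / sqrt q\<close>, where the factor \<open>q\<close> in the bound for
  \<open>T1\<close> turns into \<open>sqrt q\<close>.\<close>

lemma Tsum_le:
  assumes "g \<ge> 2" and D: "D = bigD g a b c" "D \<noteq> 0"
    and gf: "\<And>i. i < g \<Longrightarrow> good_form D (a i) (b i) (c i)"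
  shows "\<exists>C\<ge>0. \<forall>M Q. M \<ge> 1 \<and> (\<forall>i<g. Q i \<ge> 1) \<longrightarrow>
    Tsum g a b c z M Q \<le> ereal (36 * ((\<Prod>i<g. Q i) * (2 * ln (2 * (\<Prod>i<g. Q i))) ^ (8 * g)
      + M * (sqrt (\<Prod>i<g. Q i) * (2 * ln (2 * (\<Prod>i<g. Q i))) ^ (8 * g)
             + C * sqrt (\<Prod>i<g. Q i) * (2 * ln (2 * (\<Prod>i<g. Q i))) ^ (2 ^ (8 * g + 2)))))"
proof -
  define E where "E = (2::nat) ^ (8 * g + 2)"
  have "g \<ge> 1" using assms(1) by simp
  define U where "U N = (\<Sum>p\<in>sbox N - {(0, 0)}. \<Prod>i<g. real (tauc D (qform (a i) (b i) (c i) p)) ^ 4)" for N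
  have "\<exists>C\<ge>0. \<forall>N\<ge>1. U N \<le> C * (real N)\<^sup>2 * (2 * ln (2 * real N)) ^ E"
    unfolding U_def E_def using \<open>g \<ge> 1\<close> gf by (rule sum_prod_tauc_le)
  then obtain C where C: "C \<ge> 0" "\<And>N. N \<ge> 1 \<Longrightarrow> U N \<le> C * (real N)\<^sup>2 * (2 * ln (2 * real N)) ^ E"
    by blast
  have "Tsum g a b c z M Q \<le> ereal (36 * ((\<Prod>i<g. Q i) * (2 * ln (2 * (\<Prod>i<g. Q i))) ^ (8 * g)
      + M * (sqrt (\<Prod>i<g. Q i) * (2 * ln (2 * (\<Prod>i<g. Q i))) ^ (8 * g)
             + 2 * C * sqrt (\<Prod>i<g. Q i) * (2 * ln (2 * (\<Prod>i<g. Q i))) ^ E)))"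
    if M: "M \<ge> 1" and Q: "\<And>i. i < g \<Longrightarrow> Q i \<ge> 1" for M Q
  proof -
    define q where "q = (\<Prod>i<g. Q i)"
    define L where "L = 2 * ln (2 * q)"
    have q1: "q \<ge> 1" unfolding q_def using Q by (intro prod_ge_1) auto
    define S where "S = {d \<in> (\<Pi>\<^sub>E i\<in>{..<g}. {1..nat \<lfloor>Q i\<rfloor>}). \<forall>i<g. coprime (int (d i)) D}"
    let ?G = "gidx g a b c"
    have finS: "finite S" unfolding S_def by (rule finite_subset[of _ "\<Pi>\<^sub>E i\<in>{..<g}. {1..nat \<lfloor>Q i\<rfloor>}"]) (auto intro: finite_PiE)
    have Sd: "d i > 0 \<and> coprime (int (d i)) D" if "d \<in> S" "i < g" for d i
    proof
      have "d \<in> (\<Pi>\<^sub>E i\<in>{..<g}. {1..nat \<lfloor>Q i\<rfloor>})" using that unfolding S_def by blast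
      then have "d i \<in> {1..nat \<lfloor>Q i\<rfloor>}" by (rule PiE_mem) (simp add: that)
      then show "d i > 0" by simp
      show "coprime (int (d i)) D" using that unfolding S_def by blast
    qed
    have Sext: "d \<in> extensional {..<g}" if "d \<in> S" for d using that unfolding S_def PiE_def by blast
    define ok where "ok d V \<longleftrightarrow> (\<forall>J\<in>?G d. V J \<in> Lam g a b c d \<and> V J \<noteq> (0, 0)) \<and>
      (\<forall>M R. R \<in> regions M \<longrightarrow>
         err g a b c z d R \<le> (\<Sum>J\<in>?G d. 36 * (1 + M / real_of_int (snorm (V J)))))" for d V
    have "\<exists>V. ok d V" if "d \<in> S" for d
      unfolding ok_def using Sd[OF that] gf by (intro err_bound[OF D]) blast
    then have "\<forall>d\<in>S. \<exists>V. ok d V" by blast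
    from bchoice[OF this] obtain V where ok: "\<And>d. d \<in> S \<Longrightarrow> ok d (V d)" by blast
    have V: "V d J \<in> Lam g a b c d \<and> V d J \<noteq> (0, 0)" if "d \<in> S" "J \<in> ?G d" for d J
      using ok[OF that(1)] that(2) unfolding ok_def by blast
    have Verr: "err g a b c z d R \<le> (\<Sum>J\<in>?G d. 36 * (1 + M / real_of_int (snorm (V d J))))"
      if "d \<in> S" "R \<in> regions M" for d M R
      using ok[OF that(1)] that(2) unfolding ok_def by blast
    \<comment> \<open>With the integer part, a vector outside \<open>sbox N\<close> has sup norm at
      least \<open>N + 1\<close>, hence above \<open>sqrt q\<close>.\<close>
    define N where "N = nat \<lfloor>sqrt q\<rfloor>"
    have sq1: "sqrt q \<ge> 1" using q1 by simp
    have N: "N \<ge> 1" "real N \<le> sqrt q" "sqrt q < real N + 1"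
      using sq1 by (auto simp: N_def le_nat_iff le_floor_iff of_nat_nat)
    have Nq: "real N \<le> q"
    proof -
      have "sqrt q \<le> q" using q1 real_sqrt_le_mono[of q "q * q"] by (simp add: mult_le_cancel_left)
      then show ?thesis using N by simp
    qed
    have inv: "1 / real_of_int (snorm v) \<le> 1 / sqrt q + of_bool (v \<in> sbox N) / real_of_int (snorm v)" if "v \<noteq> (0, 0)" for v
    proof (cases "v \<in> sbox N")
      case True
      then show ?thesis using q1 by simp
    next
      case False
      then have "int N + 1 \<le> snorm v" by (simp add: mem_sbox_iff)
      then have "real_of_int (int N + 1) \<le> real_of_int (snorm v)" by (simp only: of_int_le_iff)
      then have le: "sqrt q \<le> real_of_int (snorm v)" using N by simp
      have pos: "0 < real_of_int (snorm v)" "0 < sqrt q" using le sq1 by linarith+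
      have "1 / real_of_int (snorm v) \<le> 1 / sqrt q"
        by (rule divide_left_mono[OF le _ mult_pos_pos[OF pos]]) simp
      then show ?thesis using False by simp
    qed
    define T1 where "T1 = (\<Sum>d\<in>S. real (card (?G d)))"
    define T2 where "T2 = (\<Sum>d\<in>S. \<Sum>J\<in>?G d. of_bool (V d J \<in> sbox N) / real_of_int (snorm (V d J)))"
    have T1: "T1 \<le> q * L ^ (8 * g)"
      unfolding T1_def S_def L_def q_def by (rule sum_card_gidx_le[OF gf Q])
    have T2: "T2 \<le> 2 * C * sqrt q * L ^ E"
    proof -
      have "T2 \<le> (\<Sum>p\<in>sbox N - {(0, 0)}. (\<Prod>i<g. real (tauc D (qform (a i) (b i) (c i) p)) ^ 4) / real_of_int (snorm p))"
        unfolding T2_def by (rule sum_inverse_short_vectors_le[where V = V]) (fact gf finS Sd Sext V)+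
      also have "\<dots> \<le> 2 * (C * L ^ E) * real N"
      proof (rule sum_div_snorm_le)
        have "L \<ge> 0" using q1 by (simp add: L_def)
        then show "C * L ^ E \<ge> 0" using C(1) by simp
        fix n assume n: "n \<ge> 1" "n \<le> N"
        have "(\<Sum>p\<in>sbox n - {(0, 0)}. \<Prod>i<g. real (tauc D (qform (a i) (b i) (c i) p)) ^ 4)
          \<le> C * (real n)\<^sup>2 * (2 * ln (2 * real n)) ^ E" using C(2)[OF n(1)] unfolding U_def .
        also have "\<dots> \<le> C * (real n)\<^sup>2 * L ^ E"
          using n Nq C(1) unfolding L_def by (intro mult_left_mono power_mono) auto
        finally show "(\<Sum>p\<in>sbox n - {(0, 0)}. \<Prod>i<g. real (tauc D (qform (a i) (b i) (c i) p)) ^ 4)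
          \<le> C * L ^ E * (real n)\<^sup>2" by (simp add: mult_ac)
      qed
      also have "\<dots> \<le> 2 * (C * L ^ E) * sqrt q"
        using N C(1) q1 by (intro mult_left_mono) (auto simp: L_def)
      finally show ?thesis by (simp add: mult_ac)
    qed
    have "Tsum g a b c z M Q = (\<Sum>d\<in>S. SUP R\<in>regions M. ereal (err g a b c z d R))"
      by (simp add: Tsum_def S_def D(1))
    also have "\<dots> \<le> (\<Sum>d\<in>S. ereal (\<Sum>J\<in>?G d. 36 * (1 + M / real_of_int (snorm (V d J)))))"
      by (intro sum_mono SUP_least) (simp only: ereal_less_eq Verr)
    also have "\<dots> = ereal (\<Sum>d\<in>S. \<Sum>J\<in>?G d. 36 * (1 + M / real_of_int (snorm (V d J))))"
      by simp
    also have "\<dots> \<le> ereal (36 * (T1 + M * (T1 / sqrt q + T2)))"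
      unfolding ereal_less_eq
    proof -
      have "(\<Sum>d\<in>S. \<Sum>J\<in>?G d. 36 * (1 + M / real_of_int (snorm (V d J)))) \<le>
         (\<Sum>d\<in>S. \<Sum>J\<in>?G d. 36 * (1 + M * (1 / sqrt q + of_bool (V d J \<in> sbox N) / real_of_int (snorm (V d J)))))"
      proof (intro sum_mono)
        fix d J assume "d \<in> S" "J \<in> ?G d"
        then have "M * (1 / real_of_int (snorm (V d J))) \<le> M * (1 / sqrt q + of_bool (V d J \<in> sbox N) / real_of_int (snorm (V d J)))"
          using M V by (intro mult_left_mono inv) auto
        then show "36 * (1 + M / real_of_int (snorm (V d J))) \<le> 36 * (1 + M * (1 / sqrt q + of_bool (V d J \<in> sbox N) / real_of_int (snorm (V d J))))"
          by simp
      qed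
      also have "\<dots> = 36 * (T1 + M * (T1 / sqrt q + T2))"
        unfolding T1_def T2_def
        by (simp add: sum.distrib sum_distrib_left sum_divide_distrib distrib_left mult_ac)
      finally show "(\<Sum>d\<in>S. \<Sum>J\<in>?G d. 36 * (1 + M / real_of_int (snorm (V d J)))) \<le> 36 * (T1 + M * (T1 / sqrt q + T2))" .
    qed
    also have "\<dots> \<le> ereal (36 * (q * L ^ (8 * g) + M * (sqrt q * L ^ (8 * g) + 2 * C * sqrt q * L ^ E)))"
    proof -
      have "T1 / sqrt q \<le> q * L ^ (8 * g) / sqrt q" using T1 q1 by (intro divide_right_mono) auto
      also have "\<dots> = q / sqrt q * L ^ (8 * g)" by simp
      also have "q / sqrt q = sqrt q" using q1 by (intro real_div_sqrt) simp
      finally have "M * (T1 / sqrt q + T2) \<le> M * (sqrt q * L ^ (8 * g) + 2 * C * sqrt q * L ^ E)"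
        using M T2 by (intro mult_left_mono add_mono) auto
      then show ?thesis using T1 by simp
    qed
    finally show ?thesis unfolding L_def q_def .
  qed
  then show ?thesis using C(1) unfolding E_def by (intro exI[of _ "2 * C"]) auto
qed

theorem theorem2p1:
  fixes g :: nat
  assumes "g \<ge> 2"
  shows "\<exists>\<nu>1 \<nu>2 :: real. \<nu>1 > 1 \<and> \<nu>2 > 1 \<and>
    (\<forall>(a :: nat \<Rightarrow> int) (b :: nat \<Rightarrow> int) (c :: nat \<Rightarrow> int) (z :: int \<times> int).
       (\<forall>i<g. irreducible (qform_poly (a i) (b i) (c i)) \<and> [a i = 1] (mod 4))
       \<and> bigD g a b c \<noteq> 0
       \<and> (\<forall>i<g. gcd (qform (a i) (b i) (c i) z) (bigD g a b c) = 1)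
       \<longrightarrow> (\<exists>C :: real. \<forall>(M :: real) (Q :: nat \<Rightarrow> real).
              M \<ge> 1 \<and> (\<forall>i<g. Q i \<ge> 1) \<longrightarrow>
              Tsum g a b c z M Q \<le>
                ereal (C * ((\<Prod>i<g. Q i) * ln (2 * (\<Prod>i<g. Q i)) powr \<nu>1
                  + M * sqrt (\<Prod>i<g. Q i) * ln (2 * (\<Prod>i<g. Q i)) powr \<nu>2))))"
proof -
  define E where "E = (2::nat) ^ (8 * g + 2)"
  \<comment> \<open>One exponent that dominates both logarithmic powers multiplied by
    \<open>M\<close>.\<close>
  define k where "k = 8 * g + E"
  have bound: "\<exists>C :: real. \<forall>(M :: real) (Q :: nat \<Rightarrow> real). M \<ge> 1 \<and> (\<forall>i<g. Q i \<ge> 1) \<longrightarrow>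
      Tsum g a b c z M Q \<le> ereal (C * ((\<Prod>i<g. Q i) * ln (2 * (\<Prod>i<g. Q i)) powr real (8 * g)
                  + M * sqrt (\<Prod>i<g. Q i) * ln (2 * (\<Prod>i<g. Q i)) powr real k))"
    if irr: "\<And>i. i < g \<Longrightarrow> irreducible (qform_poly (a i) (b i) (c i))" and D0: "bigD g a b c \<noteq> 0"
    for a b c :: "nat \<Rightarrow> int" and z
  proof -
    define T where "T C M Q = 36 * ((\<Prod>i<g. Q i) * (2 * ln (2 * (\<Prod>i<g. Q i))) ^ (8 * g)
      + M * (sqrt (\<Prod>i<g. Q i) * (2 * ln (2 * (\<Prod>i<g. Q i))) ^ (8 * g)
             + C * sqrt (\<Prod>i<g. Q i) * (2 * ln (2 * (\<Prod>i<g. Q i))) ^ E))" for C M and Q :: "nat \<Rightarrow> real"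
    have "\<exists>C\<ge>0. \<forall>M Q. M \<ge> 1 \<and> (\<forall>i<g. Q i \<ge> 1) \<longrightarrow> Tsum g a b c z M Q \<le> ereal (T C M Q)"
      unfolding T_def E_def
      by (rule Tsum_le[OF assms refl D0]) (rule bigD_good_form[OF assms D0 _ irr])
    then obtain C where C: "C \<ge> 0"
      "\<And>M Q. M \<ge> 1 \<and> (\<forall>i<g. Q i \<ge> 1) \<Longrightarrow> Tsum g a b c z M Q \<le> ereal (T C M Q)"
      by blast
    define C' where "C' = 36 * (1 + C) * 2 ^ k"
    show ?thesis
    proof (intro exI[of _ C'] allI impI)
      fix M :: real and Q :: "nat \<Rightarrow> real"
      assume MQ: "M \<ge> 1 \<and> (\<forall>i<g. Q i \<ge> 1)"
      define q where "q = (\<Prod>i<g. Q i)"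
      define l where "l = ln (2 * q)"
      have q1: "q \<ge> 1" unfolding q_def using MQ by (intro prod_ge_1) auto
      have "l \<ge> ln 2" using q1 by (simp add: l_def)
      then have l: "l > 0" "2 * l \<ge> 1" using ln2_ge_two_thirds by linarith+
      \<comment> \<open>Exponents are raised on \<open>2 * l\<close>, which is at least 1;
        \<open>l\<close> itself may be as small as \<open>ln 2\<close>, where raising the exponent
        would lower the power.\<close>
      have pw: "(2 * l) ^ m \<le> 2 ^ k * l ^ k" if "m \<le> k" for m
        using power_increasing[OF that l(2)] by (simp add: power_mult_distrib)
      have p1: "(2 * l) ^ (8 * g) \<le> 2 ^ k * l ^ (8 * g)"
        using l by (simp add: power_mult_distrib k_def mult_right_mono power_increasing)
      have "36 * (q * (2 * l) ^ (8 * g) + M * (sqrt q * (2 * l) ^ (8 * g) + C * sqrt q * (2 * l) ^ E))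
        \<le> 36 * (q * (2 ^ k * l ^ (8 * g)) + M * (sqrt q * (2 ^ k * l ^ k) + C * sqrt q * (2 ^ k * l ^ k)))"
        using q1 C(1) MQ p1 pw[of "8 * g"] pw[of E]
        by (intro mult_left_mono add_mono) (auto simp: k_def)
      also have "\<dots> = 36 * 2 ^ k * (q * l ^ (8 * g)) + 36 * (1 + C) * 2 ^ k * (M * sqrt q * l ^ k)"
        by (simp add: algebra_simps)
      also have "\<dots> \<le> 36 * (1 + C) * 2 ^ k * (q * l ^ (8 * g)) + 36 * (1 + C) * 2 ^ k * (M * sqrt q * l ^ k)"
        using C(1) q1 l by (intro add_right_mono mult_right_mono) auto
      also have "\<dots> = C' * (q * l ^ (8 * g) + M * sqrt q * l ^ k)"
        by (simp add: C'_def distrib_left)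
      finally have fin: "36 * (q * (2 * l) ^ (8 * g) + M * (sqrt q * (2 * l) ^ (8 * g) + C * sqrt q * (2 * l) ^ E))
        \<le> C' * (q * l powr real (8 * g) + M * sqrt q * l powr real k)"
        using l(1) by (simp only: powr_realpow)
      show "Tsum g a b c z M Q \<le> ereal (C' * ((\<Prod>i<g. Q i) * ln (2 * (\<Prod>i<g. Q i)) powr real (8 * g)
          + M * sqrt (\<Prod>i<g. Q i) * ln (2 * (\<Prod>i<g. Q i)) powr real k))"
        unfolding q_def[symmetric] l_def[symmetric]
        by (rule order_trans[OF C(2)[OF MQ, unfolded T_def q_def[symmetric] l_def[symmetric]]
              iffD2[OF ereal_less_eq(3) fin]])
    qed
  qed
  have gt: "real (8 * g) > 1" "real k > 1" using assms by (auto simp: k_def)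
  show ?thesis
    by (rule exI[of _ "real (8 * g)"], rule exI[of _ "real k"], intro conjI gt allI impI, rule bound) blast+
qed

end
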